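(* Let $1\le s\le N$ and $\underline{\ell}=(\ell_1,\ldots,\ell_N)\in\mathbb{C}^N$ be such that $\ell_s=k+\frac12$ with $k\in\frac12\mathbb{Z}_{\ge0}$. Put $$\underline{\ell}'=(\ell_1,\ldots,\ell_{s-1},k,\tfrac12,\ell_{s+1},\ldots,\ell_N)\in\mathbb{C}^{N+1},\qquad\mathbf{t}'=(t_1,\ldots,t_{s-1},t_s+\tfrac{\eta}{2},t_s-k\eta,t_{s+1},\ldots,t_N)$$ for $\mathbf{t}=(t_1,\ldots,t_N)\in\mathbb{C}^N$. Let $$f_S^{\underline{\ell}}:\mathbb{C}^N\to M^{(\ell_1,\ldots,\ell_{s-1})}\otimes V^{k+\frac12}\otimes M^{(\ell_{s+1},\ldots,\ell_N)},\qquad f_S^{\underline{\ell}'}:\mathbb{C}^{N+1}\to M^{(\ell_1,\ldots,\ell_{s-1})}\otimes V^k\otimes V^{\frac12}\otimes M^{(\ell_{s+1},\ldots,\ell_N)}$$ be the (mero-uniformly convergent) Jackson integral solutions of the boundary qKZ equations defined in the context, having the same base point $\mathbf{x}_0\in\mathbb{C}^S$, the same weight factors $g_{\xi_+,\xi_-}$, $h$ and $F^{\ell_j}$ ($j\in\{1,\ldots,N\}\setminus\{s\}$), and with the remaining weight factors $F^{k+\frac12}$, $F^k$ and $F^{\frac12}$ satisfying the compatibility condition $$F^{k+\frac12}(x)=F^k(x+\tfrac{\eta}{2})\,F^{\frac12}(x-k\eta).$$ Then $f_S^{\underline{\ell}}=\mathrm{Fus}_s^{\underline{\ell}}(f_S^{\underline{\ell}'})$,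 where $\mathrm{Fus}_s^{\underline{\ell}}(f_S^{\underline{\ell}'})$ is the unique meromorphic function of $\mathbf{t}\in\mathbb{C}^N$ with values in $M^{(\ell_1,\ldots,\ell_{s-1})}\otimes V^{k+\frac12}\otimes M^{(\ell_{s+1},\ldots,\ell_N)}$ satisfying $j_s^k\,\mathrm{Fus}_s^{\underline{\ell}}(f_S^{\underline{\ell}'})(\mathbf{t})=f_S^{\underline{\ell}'}(\mathbf{t}')$. Equivalently, $j_s^kf_S^{\underline{\ell}}(\mathbf{t})=f_S^{\underline{\ell}'}(\mathbf{t}')$.
   Context: Modules. Fix $\eta\in\mathbb{C}$ generic, in particular $e^\eta$ not a root of unity; $\tau\in\mathbb{C}^\times$, $\xi_+,\xi_-\in\mathbb{C}$, $S\ge0$ an integer. For $\ell\in\mathbb{C}$, $M^\ell=\bigoplus_{n\ge1}\mathbb{C}m_n^\ell$ (the Verma module of highest weight $\ell$ over quantum $\mathfrak{sl}_2$), with $m_0^\ell:=0$. For $k\in\frac12\mathbb{Z}_{\ge0}$, $V^k$ is the quotient of $M^k$ by $\bigoplus_{n\ge2k+2}\mathbb{C}m_n^k$, $\mathrm{pr}^k:M^k\to V^k$ is the projection, and $v_n^k=\mathrm{pr}^k(m_n^k)$ ($1\le n\le2k+1$) is a basis of $V^k$; $v_0^k:=v_{2k+2}^k:=0$. $M^{(\ell_1,\ldots,\ell_N)}=M^{\ell_1}\otimes\cdots\otimes M^{\ell_N}$ (empty tensor products are $\mathbb{C}$). Bethe vectors. $L^\ell(x)$ is the operator on $V^{\frac12}\otimes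 M^\ell$ which, as a $2\times2$ matrix $\begin{pmatrix}A^\ell(x)&B^\ell(x)\\C^\ell(x)&D^\ell(x)\end{pmatrix}$ of operators on $M^\ell$ with respect to the ordered basis $(v_1^{\frac12},v_2^{\frac12})$ of $V^{\frac12}$, is given by $A^\ell(x)m_n^\ell=\frac{\sinh(x+(\frac32+\ell-n)\eta)}{\sinh(x+(\frac12+\ell)\eta)}m_n^\ell$, $B^\ell(x)m_n^\ell=\frac{\sinh(\eta)\,e^{(-\ell-\frac12+n)\eta}}{\sinh(x+(\frac12+\ell)\eta)}m_{n+1}^\ell$, $C^\ell(x)m_n^\ell=\frac{\sinh((n-1)\eta)\sinh((2\ell+2-n)\eta)\,e^{(\ell+\frac32-n)\eta}}{\sinh(\eta)\sinh(x+(\frac12+\ell)\eta)}m_{n-1}^\ell$, $D^\ell(x)m_n^\ell=\frac{\sinh(x+(-\frac12-\ell+n)\eta)}{\sinh(x+(\frac12+\ell)\eta)}m_n^\ell$. For any $N$ and $\underline\ell\in\mathbb{C}^N$, on $V^{\frac12}\otimes M^{\underline\ell}$ put $T(x;\mathbf{t})=L^{\ell_1}(x-t_1)\cdots L^{\ell_N}(x-t_N)$, where $L^{\ell_r}$ acts on $V^{\frac12}$ and the $r$-th factor of $M^{\underline\ell}$. Let $K^\xi(x)$ be the operator on $V^{\frac12}$ with $K^\xi(x)v_1^{\frac12}=v_1^{\frac12}$, $K^\xi(x)v_2^{\frac12}=\frac{\sinh(\xi-x)}{\sinh(\xi+x)}v_2^{\frac12}$; $\mathcal{U}^\xi(x;\mathbf{t})=T(x;\mathbf{t})^{-1}K^\xi(x)^{-1}T(-x;\mathbf{t})=\begin{pmatrix}\mathcal{A}^\xi&\mathcal{B}^\xi\\\mathcal{C}^\xi&\mathcal{D}^\xi\end{pmatrix}(x;\mathbf{t})$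 with respect to $(v_1^{\frac12},v_2^{\frac12})$, and $$\overline{\mathcal{B}}^{\xi}(x;\mathbf{t})=\Bigl(\prod_{r=1}^N\frac{\sinh(x-t_r-\ell_r\eta)}{\sinh(x-t_r+\ell_r\eta)}\Bigr)\frac{\sinh(\xi-x-\frac{\eta}{2})\sinh(2x)}{\sinh(2x+\eta)}\,\mathcal{B}^{\xi}(x+\tfrac{\eta}{2};\mathbf{t}).$$ These operators on $M^{\underline\ell}$ commute for different $x$. $\Omega=m_1^{\ell_1}\otimes\cdots\otimes m_1^{\ell_N}$. Jackson integral solutions. Let $g_{\xi_+,\xi_-},h,F^\ell$ be meromorphic functions on $\mathbb{C}$ with $g_{\xi_+,\xi_-}(x+\tau)=\frac{\sinh(\xi_--x-\frac{\eta}{2})\sinh(\xi_+-x-\frac{\tau}{2}-\frac{\eta}{2})}{\sinh(\xi_-+x+\tau-\frac{\eta}{2})\sinh(\xi_++x+\frac{\tau}{2}-\frac{\eta}{2})}g_{\xi_+,\xi_-}(x)$, $h(x+\tau)=\frac{\sinh(x+\tau)\sinh(x+\eta)}{\sinh(x)\sinh(x+\tau-\eta)}h(x)$, $F^\ell(x+\tau)=\frac{\sinh(x+\tau-\ell\eta)}{\sinh(x+\tau+\ell\eta)}F^\ell(x)$. For $\underline\ell\in\mathbb{C}^N$ and generic $\mathbf{x}_0\in\mathbb{C}^S$ the $M^{\underline\ell}$-valued Jackson integral solution of the boundary qKZ equations is $$\sum_{\mathbf{x}\in\mathbf{x}_0+\tau\mathbb{Z}^S}\Bigl(\prod_{i=1}^Sg_{\xi_+,\xi_-}(x_i)\Bigr)\Bigl(\prod_{1\le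 i<j\le S}h(x_i+x_j)h(x_i-x_j)\Bigr)\Bigl(\prod_{r=1}^N\prod_{i=1}^SF^{\ell_r}(t_r+x_i)F^{\ell_r}(t_r-x_i)\Bigr)\Bigl(\prod_{i=1}^S\overline{\mathcal{B}}^{\xi_-}(x_i;\mathbf{t})\Bigr)\Omega,$$ assumed to converge mero-uniformly in $\mathbf{t}\in\mathbb{C}^N$. In the claim, $f_S^{\underline\ell}$ denotes the image of this function under $\mathrm{pr}^{k+\frac12}$ applied to the $s$-th tensor component, and $f_S^{\underline\ell'}$ denotes the image of the corresponding $M^{\underline\ell'}$-valued function (with $N+1$ in place of $N$ and $\underline\ell'$ in place of $\underline\ell$) under $\mathrm{pr}^k\otimes\mathrm{pr}^{\frac12}$ applied to the $s$-th and $(s+1)$-th tensor components. Mero-uniform convergence. For $\mathcal{C}\subset\mathbb{C}^M$ discrete and $w(\mathbf{x};\mathbf{t})$ ($\mathbf{x}\in\mathcal{C}$) meromorphic in $\mathbf{t}\in\mathbb{C}^N$, the sum $\sum_{\mathbf{x}\in\mathcal{C}}w(\mathbf{x};\mathbf{t})$ converges mero-uniformly if every $\mathbf{t}_0\in\mathbb{C}^N$ has an open neighbourhood $U_{\mathbf{t}_0}$ and a nonzero holomorphic function $v_{\mathbf{t}_0}$ on it such that $v_{\mathbf{t}_0}(\mathbf{t})w(\mathbf{x};\mathbf{t})$ is holomorphic on $U_{\mathbf{t}_0}$ for all $\mathbf{x}$ and $\sum_{\mathbf{x}}v_{\mathbf{t}_0}(\mathbf{t})w(\mathbf{x};\mathbf{t})$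 converges absolutely and uniformly on $U_{\mathbf{t}_0}$; the sum then denotes the unique meromorphic $f$ on $\mathbb{C}^N$ with $v_{\mathbf{t}_0}f=\sum_{\mathbf{x}}v_{\mathbf{t}_0}w(\mathbf{x};\cdot)$ on each $U_{\mathbf{t}_0}$. It extends to vector-valued summands in the obvious way. Fusion map. The injective linear map $j^k:V^{k+\frac12}\to V^k\otimes V^{\frac12}$ is $$j^k(v_n^{k+\frac12})=e^{\frac{\eta}{2}(n-1)}v_n^k\otimes v_1^{\frac12}+e^{-\frac{\eta}{2}(n-2-2k)}\frac{\sinh((n-1)\eta)}{\sinh(\eta)}v_{n-1}^k\otimes v_2^{\frac12},$$ and $j_s^k=\mathrm{Id}_{M^{(\ell_1,\ldots,\ell_{s-1})}}\otimes j^k\otimes\mathrm{Id}_{M^{(\ell_{s+1},\ldots,\ell_N)}}$. *)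

theory Defs
  imports "HOL-Complex_Analysis.Complex_Analysis" "HOL-Library.Poly_Mapping"
begin

section \<open>Meromorphic functions of several complex variables\<close>

text \<open>Points of $\mathbb{C}^N$ are lists of length $N$.  In this section a function on
  $\mathbb{C}^N$ is a function on all lists of which only the values at lists of length $N$
  matter.\<close>

definition polydisc :: "complex list \<Rightarrow> real \<Rightarrow> complex list set" where
  "polydisc t r = {u. list_all2 (\<lambda>a b. dist a b < r) t u}"

definition open_Cn :: "nat \<Rightarrow> complex list set \<Rightarrow> bool" where
  "open_Cn N U \<longleftrightarrow> (\<forall>t\<in>U. length t = N \<and> (\<exists>r>0. polydisc t r \<subseteq> U))"

text \<open>Holomorphic means complex (Frechet) differentiable at every point.\<close>

definition holomorphic_Cn :: "complex list set \<Rightarrow> (complex list \<Rightarrow> complex) \<Rightarrow> bool" where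
  "holomorphic_Cn U f \<longleftrightarrow>
     (\<forall>t\<in>U. \<exists>D :: nat \<Rightarrow> complex. \<forall>e>0. \<exists>r>0. \<forall>u\<in>polydisc t r.
        norm (f u - f t - (\<Sum>i<length t. D i * (u ! i - t ! i)))
          \<le> e * (\<Sum>i<length t. norm (u ! i - t ! i)))"

text \<open>A holomorphic function that is nonzero on every connected component of U.\<close>

definition nonzero_holomorphic :: "nat \<Rightarrow> complex list set \<Rightarrow> (complex list \<Rightarrow> complex) \<Rightarrow> bool" where
  "nonzero_holomorphic N U v \<longleftrightarrow> holomorphic_Cn U v \<and>
     (\<forall>V. open_Cn N V \<and> V \<noteq> {} \<and> V \<subseteq> U \<longrightarrow> (\<exists>t\<in>V. v t \<noteq> 0))"

text \<open>P holds on U off the zero set of a nonzero holomorphic function, locally.  Identities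
  between meromorphic functions are identities in this sense.\<close>

definition generically :: "nat \<Rightarrow> complex list set \<Rightarrow> (complex list \<Rightarrow> bool) \<Rightarrow> bool" where
  "generically N U P \<longleftrightarrow>
     (\<forall>t\<in>U. \<exists>V v. open_Cn N V \<and> t \<in> V \<and> V \<subseteq> U \<and> nonzero_holomorphic N V v \<and>
        (\<forall>u\<in>V. v u \<noteq> 0 \<longrightarrow> P u))"

definition regular_value :: "nat \<Rightarrow> (complex list \<Rightarrow> complex) \<Rightarrow> complex list \<Rightarrow> complex \<Rightarrow> bool" where
  "regular_value N f t c \<longleftrightarrow>
     (\<exists>U G. open_Cn N U \<and> t \<in> U \<and> holomorphic_Cn U G \<and>
        generically N U (\<lambda>u. f u = G u) \<and> G t = c)"

text \<open>A meromorphic function is locally a quotient of holomorphic functions.  As an element of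
  the function field it is represented by exactly one total function: the one which takes the
  correct value at every point where the meromorphic function is regular, and the value 0
  everywhere else (the convention of \<^const>\<open>remove_sings\<close> in one variable), in particular at
  lists whose length is not N.\<close>

definition meromorphic_Cn :: "nat \<Rightarrow> (complex list \<Rightarrow> complex) \<Rightarrow> bool" where
  "meromorphic_Cn N f \<longleftrightarrow>
     (\<forall>t. length t = N \<longrightarrow>
        (\<exists>U p q. open_Cn N U \<and> t \<in> U \<and> holomorphic_Cn U p \<and> nonzero_holomorphic N U q \<and>
           (\<forall>u\<in>U. q u \<noteq> 0 \<longrightarrow> f u = p u / q u))) \<and>
     (\<forall>t c. regular_value N f t c \<longrightarrow> f t = c) \<and>
     (\<forall>t. (\<nexists>c. regular_value N f t c) \<longrightarrow> f t = 0)"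

text \<open>Vectors are finite linear combinations of basis vectors indexed by type \<^typ>\<open>'i\<close>;
  vector-valued functions are treated coefficientwise.\<close>

definition regular_vec :: "nat \<Rightarrow> (complex list \<Rightarrow> 'i \<Rightarrow>\<^sub>0 complex) \<Rightarrow> complex list \<Rightarrow> bool" where
  "regular_vec N f t \<longleftrightarrow> (\<forall>i. \<exists>c. regular_value N (\<lambda>u. Poly_Mapping.lookup (f u) i) t c)"

definition meromorphic_vec :: "nat \<Rightarrow> (complex list \<Rightarrow> 'i \<Rightarrow>\<^sub>0 complex) \<Rightarrow> bool" where
  "meromorphic_vec N f \<longleftrightarrow> (\<forall>i. meromorphic_Cn N (\<lambda>t. Poly_Mapping.lookup (f t) i))"

section \<open>Mero-uniform convergence\<close>

text \<open>The functions W x are the holomorphic extensions to U of the products v w(x;.), whose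
  pointwise values are meaningful only off the poles of w(x;.).\<close>

definition mero_uniform_on ::
  "nat \<Rightarrow> 'x set \<Rightarrow> ('x \<Rightarrow> complex list \<Rightarrow> 'i \<Rightarrow>\<^sub>0 complex) \<Rightarrow> complex list set \<Rightarrow>
   (complex list \<Rightarrow> complex) \<Rightarrow> ('x \<Rightarrow> complex list \<Rightarrow> 'i \<Rightarrow>\<^sub>0 complex) \<Rightarrow> bool" where
  "mero_uniform_on N C w U v W \<longleftrightarrow>
     open_Cn N U \<and> nonzero_holomorphic N U v \<and>
     (\<forall>i. (\<forall>x\<in>C. holomorphic_Cn U (\<lambda>t. Poly_Mapping.lookup (W x t) i) \<and>
             generically N U (\<lambda>t. Poly_Mapping.lookup (W x t) i = v t * Poly_Mapping.lookup (w x t) i)) \<and>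
          (\<forall>t\<in>U. (\<lambda>x. norm (Poly_Mapping.lookup (W x t) i)) summable_on C) \<and>
          uniform_limit U (\<lambda>X t. \<Sum>x\<in>X. Poly_Mapping.lookup (W x t) i)
            (\<lambda>t. \<Sum>\<^sub>\<infinity>x\<in>C. Poly_Mapping.lookup (W x t) i) (finite_subsets_at_top C))"

text \<open>The sum of w(x;.) over C converges mero-uniformly on $\mathbb{C}^N$, and its sum is the
  meromorphic function f.\<close>

definition mero_sums ::
  "nat \<Rightarrow> 'x set \<Rightarrow> ('x \<Rightarrow> complex list \<Rightarrow> 'i \<Rightarrow>\<^sub>0 complex) \<Rightarrow> (complex list \<Rightarrow> 'i \<Rightarrow>\<^sub>0 complex) \<Rightarrow> bool" where
  "mero_sums N C w f \<longleftrightarrow> meromorphic_vec N f \<and>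
     (\<forall>t0. length t0 = N \<longrightarrow>
        (\<exists>U v W. t0 \<in> U \<and> mero_uniform_on N C w U v W \<and>
           (\<forall>i. generically N U (\<lambda>t. v t * Poly_Mapping.lookup (f t) i =
                  (\<Sum>\<^sub>\<infinity>x\<in>C. Poly_Mapping.lookup (W x t) i)))))"

section \<open>Modules and operators\<close>

definition smult_vec :: "complex \<Rightarrow> ('i \<Rightarrow>\<^sub>0 complex) \<Rightarrow> 'i \<Rightarrow>\<^sub>0 complex" where
  "smult_vec c u = Poly_Mapping.map ((*) c) u"

text \<open>The linear map with prescribed values on basis vectors.\<close>

definition lin_ext :: "('i \<Rightarrow> 'j \<Rightarrow>\<^sub>0 complex) \<Rightarrow> ('i \<Rightarrow>\<^sub>0 complex) \<Rightarrow> 'j \<Rightarrow>\<^sub>0 complex" where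
  "lin_ext b u = (\<Sum>i\<in>Poly_Mapping.keys u. smult_vec (Poly_Mapping.lookup u i) (b i))"

abbreviation basis_vec :: "'i \<Rightarrow> 'i \<Rightarrow>\<^sub>0 complex" where
  "basis_vec i \<equiv> Poly_Mapping.single i 1"

text \<open>A factor $M^\ell$ has the basis indexed by \<^term>\<open>{1..} :: nat set\<close>, and $V^{d/2}$ the basis
  indexed by \<^term>\<open>{1..d + 1} :: nat set\<close>.  A tensor product has the basis indexed by the lists of
  indices of its factors.\<close>

abbreviation M_idx :: "nat set" where
  "M_idx \<equiv> {1..}"

definition V_idx :: "nat \<Rightarrow> nat set" where
  "V_idx d = {1..d + 1}"

definition tensor_space :: "nat set list \<Rightarrow> (nat list \<Rightarrow>\<^sub>0 complex) set" where
  "tensor_space Is = {u. Poly_Mapping.keys u \<subseteq> listset Is}"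

text \<open>The quotient map between tensor products that sends a basis vector to the basis vector
  with the same label, or to 0 if there is none.\<close>

definition pr :: "nat set list \<Rightarrow> (nat list \<Rightarrow>\<^sub>0 complex) \<Rightarrow> nat list \<Rightarrow>\<^sub>0 complex" where
  "pr Is = lin_ext (\<lambda>ns. if ns \<in> listset Is then basis_vec ns else 0)"

definition M_vec :: "nat \<Rightarrow> nat \<Rightarrow>\<^sub>0 complex" where
  "M_vec n = (if n = 0 then 0 else basis_vec n)"

definition A_op :: "complex \<Rightarrow> complex \<Rightarrow> complex \<Rightarrow> nat \<Rightarrow> nat \<Rightarrow>\<^sub>0 complex" where
  "A_op \<eta> l x n = smult_vec
     (sinh (x + (3/2 + l - of_nat n) * \<eta>) / sinh (x + (1/2 + l) * \<eta>)) (M_vec n)"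

definition B_op :: "complex \<Rightarrow> complex \<Rightarrow> complex \<Rightarrow> nat \<Rightarrow> nat \<Rightarrow>\<^sub>0 complex" where
  "B_op \<eta> l x n = smult_vec
     (sinh \<eta> * exp ((- l - 1/2 + of_nat n) * \<eta>) / sinh (x + (1/2 + l) * \<eta>)) (M_vec (n + 1))"

definition C_op :: "complex \<Rightarrow> complex \<Rightarrow> complex \<Rightarrow> nat \<Rightarrow> nat \<Rightarrow>\<^sub>0 complex" where
  "C_op \<eta> l x n = smult_vec
     (sinh ((of_nat n - 1) * \<eta>) * sinh ((2 * l + 2 - of_nat n) * \<eta>) *
        exp ((l + 3/2 - of_nat n) * \<eta>) / (sinh \<eta> * sinh (x + (1/2 + l) * \<eta>))) (M_vec (n - 1))"

definition D_op :: "complex \<Rightarrow> complex \<Rightarrow> complex \<Rightarrow> nat \<Rightarrow> nat \<Rightarrow>\<^sub>0 complex" where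
  "D_op \<eta> l x n = smult_vec
     (sinh (x + (- 1/2 - l + of_nat n) * \<eta>) / sinh (x + (1/2 + l) * \<eta>)) (M_vec n)"

text \<open>The image of the tensor product of the basis vectors labelled by ns under an operator
  acting on the tensor factor number r, counted from 0.\<close>

definition at_site :: "nat \<Rightarrow> (nat \<Rightarrow> nat \<Rightarrow>\<^sub>0 complex) \<Rightarrow> nat list \<Rightarrow> nat list \<Rightarrow>\<^sub>0 complex" where
  "at_site r \<phi> ns = lin_ext (\<lambda>n. basis_vec (ns[r := n])) (\<phi> (ns ! r))"

text \<open>The auxiliary space $V^{1/2}$ is the first tensor factor, so its label heads the list.\<close>

definition aux_tensor :: "nat \<Rightarrow> (nat list \<Rightarrow>\<^sub>0 complex) \<Rightarrow> nat list \<Rightarrow>\<^sub>0 complex" where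
  "aux_tensor a = lin_ext (\<lambda>ns. basis_vec (a # ns))"

definition aux_coeff :: "nat \<Rightarrow> (nat list \<Rightarrow>\<^sub>0 complex) \<Rightarrow> nat list \<Rightarrow>\<^sub>0 complex" where
  "aux_coeff a = lin_ext (\<lambda>js. if hd js = a then basis_vec (tl js) else 0)"

definition aux_space :: "nat \<Rightarrow> (nat list \<Rightarrow>\<^sub>0 complex) set" where
  "aux_space N = tensor_space (V_idx 1 # replicate N M_idx)"

definition L_op :: "complex \<Rightarrow> complex \<Rightarrow> complex \<Rightarrow> nat \<Rightarrow> (nat list \<Rightarrow>\<^sub>0 complex) \<Rightarrow> nat list \<Rightarrow>\<^sub>0 complex" where
  "L_op \<eta> l x r = lin_ext (\<lambda>js.
     if hd js = 1
     then aux_tensor 1 (at_site r (A_op \<eta> l x) (tl js)) + aux_tensor 2 (at_site r (C_op \<eta> l x) (tl js))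
     else aux_tensor 1 (at_site r (B_op \<eta> l x) (tl js)) + aux_tensor 2 (at_site r (D_op \<eta> l x) (tl js)))"

definition T_op :: "complex \<Rightarrow> complex list \<Rightarrow> complex \<Rightarrow> complex list \<Rightarrow> (nat list \<Rightarrow>\<^sub>0 complex) \<Rightarrow> nat list \<Rightarrow>\<^sub>0 complex" where
  "T_op \<eta> ls x t = foldr (\<lambda>r R. L_op \<eta> (ls ! r) (x - t ! r) r \<circ> R) [0..<length ls] id"

definition K_op :: "complex \<Rightarrow> complex \<Rightarrow> (nat list \<Rightarrow>\<^sub>0 complex) \<Rightarrow> nat list \<Rightarrow>\<^sub>0 complex" where
  "K_op \<xi> x = lin_ext (\<lambda>js.
     if hd js = 1 then basis_vec js else smult_vec (sinh (\<xi> - x) / sinh (\<xi> + x)) (basis_vec js))"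

text \<open>The inverses are the inverses of the operators on \<^const>\<open>aux_space\<close>; they exist for generic
  x and t.\<close>

definition U_op :: "complex \<Rightarrow> complex \<Rightarrow> complex list \<Rightarrow> complex \<Rightarrow> complex list \<Rightarrow> (nat list \<Rightarrow>\<^sub>0 complex) \<Rightarrow> nat list \<Rightarrow>\<^sub>0 complex" where
  "U_op \<eta> \<xi> ls x t =
     inv_into (aux_space (length ls)) (T_op \<eta> ls x t) \<circ>
     inv_into (aux_space (length ls)) (K_op \<xi> x) \<circ>
     T_op \<eta> ls (- x) t"

text \<open>The upper right matrix entry of the previous operator.\<close>

definition B_bdry :: "complex \<Rightarrow> complex \<Rightarrow> complex list \<Rightarrow> complex \<Rightarrow> complex list \<Rightarrow> (nat list \<Rightarrow>\<^sub>0 complex) \<Rightarrow> nat list \<Rightarrow>\<^sub>0 complex" where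
  "B_bdry \<eta> \<xi> ls x t u = aux_coeff 1 (U_op \<eta> \<xi> ls x t (aux_tensor 2 u))"

definition B_bar :: "complex \<Rightarrow> complex \<Rightarrow> complex list \<Rightarrow> complex \<Rightarrow> complex list \<Rightarrow> (nat list \<Rightarrow>\<^sub>0 complex) \<Rightarrow> nat list \<Rightarrow>\<^sub>0 complex" where
  "B_bar \<eta> \<xi> ls x t u = smult_vec
     ((\<Prod>r<length ls. sinh (x - t ! r - ls ! r * \<eta>) / sinh (x - t ! r + ls ! r * \<eta>)) *
        (sinh (\<xi> - x - \<eta>/2) * sinh (2 * x) / sinh (2 * x + \<eta>)))
     (B_bdry \<eta> \<xi> ls (x + \<eta>/2) t u)"

definition bethe_vec :: "complex \<Rightarrow> complex \<Rightarrow> complex list \<Rightarrow> complex list \<Rightarrow> complex list \<Rightarrow> nat list \<Rightarrow>\<^sub>0 complex" where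
  "bethe_vec \<eta> \<xi> ls x t = foldr (\<lambda>z. B_bar \<eta> \<xi> ls z t) x (basis_vec (replicate (length ls) 1))"

section \<open>Jackson integral solutions\<close>

definition g_weight :: "complex \<Rightarrow> complex \<Rightarrow> complex \<Rightarrow> complex \<Rightarrow> (complex \<Rightarrow> complex) \<Rightarrow> bool" where
  "g_weight \<eta> \<tau> \<xi>p \<xi>m g \<longleftrightarrow> g meromorphic_on UNIV \<and>
     (\<forall>\<^sub>\<approx>x\<in>UNIV. g (x + \<tau>) =
        sinh (\<xi>m - x - \<eta>/2) * sinh (\<xi>p - x - \<tau>/2 - \<eta>/2) /
        (sinh (\<xi>m + x + \<tau> - \<eta>/2) * sinh (\<xi>p + x + \<tau>/2 - \<eta>/2)) * g x)"

definition h_weight :: "complex \<Rightarrow> complex \<Rightarrow> (complex \<Rightarrow> complex) \<Rightarrow> bool" where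
  "h_weight \<eta> \<tau> h \<longleftrightarrow> h meromorphic_on UNIV \<and>
     (\<forall>\<^sub>\<approx>x\<in>UNIV. h (x + \<tau>) =
        sinh (x + \<tau>) * sinh (x + \<eta>) / (sinh x * sinh (x + \<tau> - \<eta>)) * h x)"

definition F_weight :: "complex \<Rightarrow> complex \<Rightarrow> complex \<Rightarrow> (complex \<Rightarrow> complex) \<Rightarrow> bool" where
  "F_weight \<eta> \<tau> l F \<longleftrightarrow> F meromorphic_on UNIV \<and>
     (\<forall>\<^sub>\<approx>x\<in>UNIV. F (x + \<tau>) = sinh (x + \<tau> - l * \<eta>) / sinh (x + \<tau> + l * \<eta>) * F x)"

definition jackson_lattice :: "complex \<Rightarrow> complex list \<Rightarrow> complex list set" where
  "jackson_lattice \<tau> x0 =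
     {x. length x = length x0 \<and> (\<forall>i<length x0. \<exists>n::int. x ! i = x0 ! i + of_int n * \<tau>)}"

text \<open>Genericity of the base point: no factor of the summand that does not depend on t is
  singular at a point of the lattice.  The conditions with \<open>\<xi>\<close> say that $K^\xi(x_i+\eta/2)$ is
  defined and invertible.\<close>

definition generic_base ::
  "complex \<Rightarrow> complex \<Rightarrow> complex \<Rightarrow> (complex \<Rightarrow> complex) \<Rightarrow> (complex \<Rightarrow> complex) \<Rightarrow> complex list \<Rightarrow> bool" where
  "generic_base \<eta> \<tau> \<xi> g h x0 \<longleftrightarrow>
     (\<forall>x\<in>jackson_lattice \<tau> x0.
        (\<forall>i<length x0. g analytic_on {x ! i} \<and> sinh (2 * (x ! i) + \<eta>) \<noteq> 0 \<and>
           sinh (\<xi> - x ! i - \<eta>/2) \<noteq> 0 \<and> sinh (\<xi> + x ! i + \<eta>/2) \<noteq> 0) \<and>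
        (\<forall>j<length x0. \<forall>i<j. h analytic_on {x ! i + x ! j} \<and> h analytic_on {x ! i - x ! j}))"

definition jackson_summand ::
  "complex \<Rightarrow> complex \<Rightarrow> (complex \<Rightarrow> complex) \<Rightarrow> (complex \<Rightarrow> complex) \<Rightarrow> (complex \<Rightarrow> complex \<Rightarrow> complex) \<Rightarrow>
   complex list \<Rightarrow> complex list \<Rightarrow> complex list \<Rightarrow> nat list \<Rightarrow>\<^sub>0 complex" where
  "jackson_summand \<eta> \<xi> g h F ls x t = smult_vec
     ((\<Prod>i<length x. g (x ! i)) *
      (\<Prod>j<length x. \<Prod>i<j. h (x ! i + x ! j) * h (x ! i - x ! j)) *
      (\<Prod>r<length ls. \<Prod>i<length x. F (ls ! r) (t ! r + x ! i) * F (ls ! r) (t ! r - x ! i)))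
     (bethe_vec \<eta> \<xi> ls x t)"

text \<open>f is the mero-uniformly convergent Jackson integral solution with values in
  $M^{\underline\ell}$; the weight factor attached to $\ell$ is F l.\<close>

definition jackson_solution ::
  "complex \<Rightarrow> complex \<Rightarrow> complex \<Rightarrow> (complex \<Rightarrow> complex) \<Rightarrow> (complex \<Rightarrow> complex) \<Rightarrow> (complex \<Rightarrow> complex \<Rightarrow> complex) \<Rightarrow>
   complex list \<Rightarrow> complex list \<Rightarrow> (complex list \<Rightarrow> nat list \<Rightarrow>\<^sub>0 complex) \<Rightarrow> bool" where
  "jackson_solution \<eta> \<tau> \<xi> g h F x0 ls f \<longleftrightarrow>
     mero_sums (length ls) (jackson_lattice \<tau> x0) (jackson_summand \<eta> \<xi> g h F ls) f"

section \<open>Fusion\<close>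

text \<open>Replaces the entry number s (counted from 1) by two entries.  Throughout, d stands for
  $2k$.\<close>

definition split_at :: "nat \<Rightarrow> 'a \<Rightarrow> 'a \<Rightarrow> 'a list \<Rightarrow> 'a list" where
  "split_at s a b xs = take (s - 1) xs @ [a, b] @ drop s xs"

definition fused_idx :: "nat \<Rightarrow> nat \<Rightarrow> nat \<Rightarrow> nat set list" where
  "fused_idx N s d = (replicate N M_idx)[s - 1 := V_idx (d + 1)]"

definition unfused_idx :: "nat \<Rightarrow> nat \<Rightarrow> nat \<Rightarrow> nat set list" where
  "unfused_idx N s d = split_at s (V_idx d) (V_idx 1) (replicate N M_idx)"

definition unfused_pt :: "complex \<Rightarrow> nat \<Rightarrow> nat \<Rightarrow> complex list \<Rightarrow> complex list" where
  "unfused_pt \<eta> s d t = split_at s (t ! (s - 1) + \<eta>/2) (t ! (s - 1) - of_nat d / 2 * \<eta>) t"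

definition V_vec :: "nat \<Rightarrow> nat \<Rightarrow> nat \<Rightarrow>\<^sub>0 complex" where
  "V_vec d n = (if n \<in> V_idx d then basis_vec n else 0)"

definition tensor2 :: "(nat \<Rightarrow>\<^sub>0 complex) \<Rightarrow> (nat \<Rightarrow>\<^sub>0 complex) \<Rightarrow> nat list \<Rightarrow>\<^sub>0 complex" where
  "tensor2 u v = lin_ext (\<lambda>a. lin_ext (\<lambda>b. basis_vec [a, b]) v) u"

definition j_map :: "complex \<Rightarrow> nat \<Rightarrow> nat \<Rightarrow> nat list \<Rightarrow>\<^sub>0 complex" where
  "j_map \<eta> d n =
     smult_vec (exp (\<eta>/2 * (of_nat n - 1))) (tensor2 (V_vec d n) (V_vec 1 1)) +
     smult_vec (exp (- \<eta>/2 * (of_nat n - 2 - of_nat d)) * (sinh ((of_nat n - 1) * \<eta>) / sinh \<eta>))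
       (tensor2 (V_vec d (n - 1)) (V_vec 1 2))"

definition j_site :: "complex \<Rightarrow> nat \<Rightarrow> nat \<Rightarrow> (nat list \<Rightarrow>\<^sub>0 complex) \<Rightarrow> nat list \<Rightarrow>\<^sub>0 complex" where
  "j_site \<eta> s d = lin_ext (\<lambda>ns.
     lin_ext (\<lambda>ms. basis_vec (take (s - 1) ns @ ms @ drop s ns)) (j_map \<eta> d (ns ! (s - 1))))"

text \<open>The identity $j_s^k\,G(\mathbf{t}) = f(\mathbf{t}')$ of meromorphic functions of t in
  $\mathbb{C}^N$, for f meromorphic on $\mathbb{C}^{N+1}$; the restriction of f to the points
  $\mathbf{t}'$ is meaningful only if f is regular at generic points of this form.\<close>

definition fusion_identity ::
  "complex \<Rightarrow> nat \<Rightarrow> nat \<Rightarrow> nat \<Rightarrow> (complex list \<Rightarrow> nat list \<Rightarrow>\<^sub>0 complex) \<Rightarrow> (complex list \<Rightarrow> nat list \<Rightarrow>\<^sub>0 complex) \<Rightarrow> bool" where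
  "fusion_identity \<eta> N s d f G \<longleftrightarrow>
     generically N {t. length t = N} (\<lambda>t.
       regular_vec (N + 1) f (unfused_pt \<eta> s d t) \<and>
       j_site \<eta> s d (G t) = f (unfused_pt \<eta> s d t))"

definition is_fusion ::
  "complex \<Rightarrow> nat \<Rightarrow> nat \<Rightarrow> nat \<Rightarrow> (complex list \<Rightarrow> nat list \<Rightarrow>\<^sub>0 complex) \<Rightarrow> (complex list \<Rightarrow> nat list \<Rightarrow>\<^sub>0 complex) \<Rightarrow> bool" where
  "is_fusion \<eta> N s d f G \<longleftrightarrow> meromorphic_vec N G \<and>
     (\<forall>t. G t \<in> tensor_space (fused_idx N s d)) \<and> fusion_identity \<eta> N s d f G"

definition Fus ::
  "complex \<Rightarrow> nat \<Rightarrow> nat \<Rightarrow> nat \<Rightarrow> (complex list \<Rightarrow> nat list \<Rightarrow>\<^sub>0 complex) \<Rightarrow> complex list \<Rightarrow> nat list \<Rightarrow>\<^sub>0 complex" where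
  "Fus \<eta> N s d f = (THE G. is_fusion \<eta> N s d f G)"

end

theory Submission
  imports Defs
begin

text \<open>Both solutions are sums over the same lattice, so the theorem has an algebraic part, the
  correspondence of the summands under the fusion map, and an analytic part, the evaluation of the
  second sum on the hyperplane of the points $\mathbf{t}'$.

  Algebra.  Call vectors u and u' fused if the image of u under the projection and the map j is the
  projection of u' (\<open>fused\<close>).  Every operator that enters a Bethe vector preserves this relation.
  For L-operators away from the split site and for the boundary matrix this is clear.  At the split
  site the product of the L-operators of spins k and 1/2, at spectral parameters that the
  substitution $\mathbf{t}\mapsto\mathbf{t}'$ produces, acts on the image of j as the L-operator of spin
  k + 1/2 (\<open>fused_L_op\<close>); this comes down to a few identities of the form
  $\sinh a\sinh b+\sinh c\sinh d=\sinh e\sinh f$.  The inverse of an L-operator is the L-operator at the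
  opposite parameter (\<open>L_op_inverse\<close>), so the inverse monodromy is an explicit product and is treated
  in the same way (\<open>fused_L_op_reversed\<close>).  Scalar prefactors multiply correctly, by telescoping and
  by the compatibility condition of the weight factors.  Hence the summands at t and at
  $\mathbf{t}'$ are fused wherever both are regular (\<open>fused_jackson_summand\<close>).

  Analysis.  Mero-uniform convergence in N + 1 variables provides near $\mathbf{t}'$ a multiplier v'
  whose products with the terms are holomorphic and uniformly summable, but v' may vanish on the whole
  hyperplane of the points $\mathbf{t}'$.  The terms themselves are regular at generic points of the
  hyperplane, because none of their poles depends on the difference of the two new coordinates.
  Therefore the power of the equation of the hyperplane contained in v' also divides each product,
  and by the maximum principle the divided series still converges to the divided sum
  (\<open>holomorphic_Cn_factor_hyperplane\<close>, \<open>divide_series_hyperplane\<close>).  What remains of v' is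
  a nonzero holomorphic function of t, and off its zeros the second solution is regular at
  $\mathbf{t}'$, with the value given by the divided series.  Comparing the series term by term gives the
  fusion identity (\<open>jackson_fusion_identity\<close>).  This uses a small amount of function theory in several
  variables, developed from Osgood's lemma (\<open>Osgood\<close>): a locally bounded, separately holomorphic
  function is holomorphic.

  Uniqueness holds because j is injective (\<open>j_site_injective\<close>), and a meromorphic function is
  determined by its generic values (\<open>meromorphic_Cn_eqI\<close>).\<close>

section \<open>Holomorphic functions on lists\<close>

lemma polydisc_iff:
  "u \<in> polydisc t r \<longleftrightarrow> length u = length t \<and> (\<forall>i<length t. dist (t ! i) (u ! i) < r)"
  by (auto simp: polydisc_def list_all2_conv_all_nth)

lemma centre_in_polydisc: "r > 0 \<Longrightarrow> t \<in> polydisc t r"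
  by (simp add: polydisc_iff)

lemma polydisc_mono: "r \<le> r' \<Longrightarrow> polydisc t r \<subseteq> polydisc t r'"
  by (force simp: polydisc_iff)

lemma polydisc_triangle:
  assumes "u \<in> polydisc t r" "w \<in> polydisc u e" shows "w \<in> polydisc t (r + e)"
  using assms unfolding polydisc_iff
  by (auto intro: order.strict_trans1[OF dist_triangle add_strict_mono])

lemma polydisc_update:
  assumes "u \<in> polydisc t r" "dist (t ! i) z < r" shows "u[i := z] \<in> polydisc t r"
  unfolding polydisc_iff
proof (intro conjI allI impI)
  show "length (u[i := z]) = length t" using assms(1) by (simp add: polydisc_iff)
  fix j assume "j < length t"
  then show "dist (t ! j) (u[i := z] ! j) < r"
    using assms by (cases "i = j") (auto simp: polydisc_iff)
qed

lemma open_polydisc: "open_Cn (length t) (polydisc t r)"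
  unfolding open_Cn_def
proof (intro ballI conjI)
  fix u assume u: "u \<in> polydisc t r"
  then show "length u = length t" by (simp add: polydisc_iff)
  define e where "e = Min (insert 1 ((\<lambda>i. r - dist (t ! i) (u ! i)) ` {..<length t}))"
  have e: "e > 0" using u by (auto simp: e_def polydisc_iff)
  have le: "dist (t ! i) (u ! i) + e \<le> r" if "i < length t" for i
  proof -
    have "e \<le> r - dist (t ! i) (u ! i)" unfolding e_def by (rule Min_le) (use that in auto)
    then show ?thesis by simp
  qed
  have "w \<in> polydisc t r" if "w \<in> polydisc u e" for w
    unfolding polydisc_iff
  proof (intro conjI allI impI)
    show "length w = length t" using that u by (simp add: polydisc_iff)
    fix i assume i: "i < length t"
    have "dist (t ! i) (w ! i) \<le> dist (t ! i) (u ! i) + dist (u ! i) (w ! i)" by (rule dist_triangle)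
    moreover have "dist (u ! i) (w ! i) < e" using that u i by (simp add: polydisc_iff)
    ultimately show "dist (t ! i) (w ! i) < r" using le[OF i] by linarith
  qed
  then show "\<exists>e>0. polydisc u e \<subseteq> polydisc t r" using e by blast
qed

lemma open_Cn_Int: 
  assumes "open_Cn N U" "open_Cn N V" shows "open_Cn N (U \<inter> V)"
  unfolding open_Cn_def
proof (intro ballI conjI)
  fix t assume t: "t \<in> U \<inter> V"
  show "length t = N" using assms t by (auto simp: open_Cn_def)
  obtain r r' where "r > 0" "polydisc t r \<subseteq> U" "r' > 0" "polydisc t r' \<subseteq> V"
    using assms t unfolding open_Cn_def by blast
  then have "polydisc t (min r r') \<subseteq> U \<inter> V" "min r r' > 0"
    using polydisc_mono[of "min r r'" r t] polydisc_mono[of "min r r'" r' t] by auto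
  then show "\<exists>r>0. polydisc t r \<subseteq> U \<inter> V" by blast
qed

lemma open_Cn_UNIV: "open_Cn N {t. length t = N}"
  unfolding open_Cn_def by (auto simp: polydisc_iff intro!: exI[of _ 1])

text \<open>Lists carry no topology, but the polydiscs around a point generate a filter; this gives
  access to the calculus of limits.\<close>

definition nhds_Cn :: "complex list \<Rightarrow> complex list filter" where
  "nhds_Cn t = (INF r\<in>{0<..}. principal (polydisc t r))"

lemma eventually_nhds_Cn: "eventually P (nhds_Cn t) \<longleftrightarrow> (\<exists>r>0. \<forall>u\<in>polydisc t r. P u)"
proof -
  have "eventually P (nhds_Cn t) \<longleftrightarrow> (\<exists>r\<in>{0<..}. eventually P (principal (polydisc t r)))"
    unfolding nhds_Cn_def
  proof (rule eventually_INF_base)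
    show "{0<..} \<noteq> ({}::real set)" by (auto intro: exI[of _ 1])
    fix a b :: real assume "a \<in> {0<..}" "b \<in> {0<..}"
    then show "\<exists>x\<in>{0<..}. principal (polydisc t x) \<le> inf (principal (polydisc t a)) (principal (polydisc t b))"
      using polydisc_mono[of "min a b" a t] polydisc_mono[of "min a b" b t]
      by (intro bexI[of _ "min a b"]) auto
  qed
  then show ?thesis by (auto simp: eventually_principal)
qed

lemma eventually_nhds_Cn_open: "open_Cn N U \<Longrightarrow> t \<in> U \<Longrightarrow> eventually (\<lambda>u. u \<in> U) (nhds_Cn t)"
  unfolding eventually_nhds_Cn open_Cn_def by blast

lemma eventually_nhds_Cn_at: "eventually P (nhds_Cn t) \<Longrightarrow> P t"
  unfolding eventually_nhds_Cn using centre_in_polydisc by blast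

lemma nhds_Cn_neq_bot [simp]: "nhds_Cn t \<noteq> bot"
  using eventually_nhds_Cn_at[of "\<lambda>_. False" t] by (auto simp: trivial_limit_def)

lemma tendsto_nth_Cn:
  assumes "i < length t" shows "((\<lambda>u. u ! i) \<longlongrightarrow> t ! i) (nhds_Cn t)"
  unfolding tendsto_iff eventually_nhds_Cn
  using assms by (auto simp: polydisc_iff dist_commute)

lemma open_Cn_eventually:
  assumes "open_Cn N U" "\<And>t. t \<in> U \<Longrightarrow> P t \<Longrightarrow> eventually P (nhds_Cn t)"
  shows "open_Cn N {t\<in>U. P t}"
  unfolding open_Cn_def
proof (intro ballI conjI)
  fix t assume t: "t \<in> {t\<in>U. P t}"
  show "length t = N" using assms(1) t by (auto simp: open_Cn_def)
  have "eventually (\<lambda>u. u \<in> U \<and> P u) (nhds_Cn t)"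
    using eventually_nhds_Cn_open[OF assms(1)] assms(2) t by (simp add: eventually_conj)
  then show "\<exists>r>0. polydisc t r \<subseteq> {t\<in>U. P t}" unfolding eventually_nhds_Cn by blast
qed

text \<open>Coordinate sections and the substitution of the fusion points are both affine in each coordinate;
  complex lines treat them uniformly.\<close>

definition line_Cn :: "complex list \<Rightarrow> complex list \<Rightarrow> complex \<Rightarrow> complex list" where
  "line_Cn b d z = map2 (\<lambda>x y. x + z * y) b d"

lemma length_line_Cn [simp]: "length d = length b \<Longrightarrow> length (line_Cn b d z) = length b"
  by (simp add: line_Cn_def)

lemma nth_line_Cn [simp]: "length d = length b \<Longrightarrow> i < length b \<Longrightarrow> line_Cn b d z ! i = b ! i + z * d ! i"
  by (simp add: line_Cn_def)

lemma line_Cn_line_Cn: "length d = length b \<Longrightarrow> line_Cn (line_Cn b d w) d z = line_Cn b d (w + z)"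
  by (auto intro!: nth_equalityI simp: algebra_simps)

lemma holomorphic_Cn_line:
  assumes "holomorphic_Cn U f" "t \<in> U"
  shows "\<exists>D. \<forall>d. length d = length t \<longrightarrow>
           ((\<lambda>z. f (line_Cn t d z)) has_field_derivative (\<Sum>i<length t. D i * d ! i)) (at 0)"
proof -
  obtain D :: "nat \<Rightarrow> complex" where D: "\<And>e. e > 0 \<Longrightarrow> \<exists>r>0. \<forall>u\<in>polydisc t r.
        norm (f u - f t - (\<Sum>i<length t. D i * (u ! i - t ! i)))
          \<le> e * (\<Sum>i<length t. norm (u ! i - t ! i))"
    using assms unfolding holomorphic_Cn_def by meson
  have "((\<lambda>z. f (line_Cn t d z)) has_field_derivative (\<Sum>i<length t. D i * d ! i)) (at 0)"
    if d: "length d = length t" for d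
    unfolding has_field_derivative_def has_derivative_at_alt
  proof (intro conjI allI impI)
    show "bounded_linear ((*) (\<Sum>i<length t. D i * d ! i))" by (rule bounded_linear_mult_right)
    fix e :: real assume e: "e > 0"
    define K where "K = (\<Sum>i<length t. norm (d ! i)) + 1"
    have K: "K > 0" unfolding K_def by (intro add_nonneg_pos sum_nonneg) auto
    have dK: "norm (d ! i) < K" if "i < length t" for i
      using that member_le_sum[of i "{..<length t}" "\<lambda>i. norm (d ! i)"] unfolding K_def by auto
    obtain r where r: "r > 0" "\<forall>u\<in>polydisc t r.
        norm (f u - f t - (\<Sum>i<length t. D i * (u ! i - t ! i)))
          \<le> (e / K) * (\<Sum>i<length t. norm (u ! i - t ! i))"
      using D[of "e / K"] e K by auto
    have "norm (f (line_Cn t d y) - f (line_Cn t d 0) - (\<Sum>i<length t. D i * d ! i) * (y - 0))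
            \<le> e * norm (y - 0)" if y: "norm (y - 0) < r / K" for y
    proof -
      have "norm (y * d ! i) < r" if "i < length t" for i
      proof -
        have "norm y * norm (d ! i) \<le> norm y * K" using dK[OF that] by (intro mult_left_mono) auto
        also have "\<dots> < r" using y K by (simp add: field_simps)
        finally show ?thesis by (simp add: norm_mult)
      qed
      then have "line_Cn t d y \<in> polydisc t r" using d by (auto simp: polydisc_iff dist_norm norm_minus_commute)
      with r have "norm (f (line_Cn t d y) - f t - (\<Sum>i<length t. D i * (y * d ! i)))
          \<le> (e / K) * (\<Sum>i<length t. norm (y * d ! i))" using d by fastforce
      also have "\<dots> = (e / K) * (norm y * (K - 1))"
        by (simp add: norm_mult K_def sum_distrib_left)
      also have "\<dots> \<le> e * norm y" using e K by (simp add: field_simps)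
      finally have "norm (f (line_Cn t d y) - f t - (\<Sum>i<length t. D i * (y * d ! i))) \<le> e * norm y" .
      moreover have "line_Cn t d 0 = t" using d by (auto intro: nth_equalityI)
      moreover have "(\<Sum>i<length t. D i * (y * d ! i)) = (\<Sum>i<length t. D i * d ! i) * y"
        unfolding sum_distrib_right by (rule sum.cong) (auto simp: mult_ac)
      ultimately show ?thesis by simp
    qed
    then show "\<exists>r>0. \<forall>y. norm (y - 0) < r \<longrightarrow>
      norm (f (line_Cn t d y) - f (line_Cn t d 0) - (\<Sum>i<length t. D i * d ! i) * (y - 0)) \<le> e * norm (y - 0)"
      using r K by (intro exI[of _ "r / K"]) auto
  qed
  then show ?thesis by blast
qed

lemma holomorphic_Cn_field_differentiable_line:
  assumes "holomorphic_Cn U f" "length d = length b" "line_Cn b d w \<in> U"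
  shows "(\<lambda>z. f (line_Cn b d z)) field_differentiable (at w)"
proof -
  obtain c where "((\<lambda>z. f (line_Cn (line_Cn b d w) d z)) has_field_derivative c) (at 0)"
    using holomorphic_Cn_line[OF assms(1,3)] assms(2) by auto
  then have "((\<lambda>z. f (line_Cn b d (w + z))) has_field_derivative c) (at (w - w))"
    using assms(2) by (simp add: line_Cn_line_Cn)
  then have "((\<lambda>z. f (line_Cn b d z)) has_field_derivative c) (at w)"
    using DERIV_shift[of "\<lambda>z. f (line_Cn b d z)" c 0 w] by (simp add: add.commute)
  then show ?thesis by (auto simp: field_differentiable_def)
qed

lemma update_as_line_Cn:
  assumes "i < length t"
  shows "t[i := z] = line_Cn t ((replicate (length t) 0)[i := 1]) (z - t ! i)"
  using assms by (auto intro!: nth_equalityI simp: nth_list_update)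

lemma holomorphic_Cn_section:
  assumes "holomorphic_Cn U f" "t \<in> U" "i < length t"
  shows "(\<lambda>z. f (t[i := z])) field_differentiable (at (t ! i))"
proof -
  let ?d = "(replicate (length t) 0)[i := 1]"
  have "line_Cn (t[i := 0]) ?d (t ! i) = t" 
    using assms(3) by (auto intro!: nth_equalityI simp: nth_list_update)
  then have "(\<lambda>z. f (line_Cn (t[i := 0]) ?d z)) field_differentiable (at (t ! i))"
    using assms by (intro holomorphic_Cn_field_differentiable_line[of U]) auto
  moreover have "line_Cn (t[i := 0]) ?d z = t[i := z]" for z
    using assms(3) by (auto intro!: nth_equalityI simp: nth_list_update)
  ultimately show ?thesis by simp
qed

lemma holomorphic_Cn_tendsto:
  assumes "holomorphic_Cn U f" "t \<in> U"
  shows "(f \<longlongrightarrow> f t) (nhds_Cn t)"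
proof -
  obtain D :: "nat \<Rightarrow> complex" and r where r: "r > 0" "\<forall>u\<in>polydisc t r.
        norm (f u - f t - (\<Sum>i<length t. D i * (u ! i - t ! i)))
          \<le> 1 * (\<Sum>i<length t. norm (u ! i - t ! i))"
    using assms unfolding holomorphic_Cn_def by (meson zero_less_one)
  let ?L = "\<lambda>u. \<Sum>i<length t. D i * (u ! i - t ! i)"
  have 1: "((\<lambda>u. 1 * (\<Sum>i<length t. norm (u ! i - t ! i))) \<longlongrightarrow> 1 * (\<Sum>i<length t. norm (t ! i - t ! i))) (nhds_Cn t)"
    by (intro tendsto_intros tendsto_nth_Cn) auto
  have "((\<lambda>u. f u - f t - ?L u) \<longlongrightarrow> 0) (nhds_Cn t)"
    by (rule Lim_null_comparison[OF _ 1[simplified]]) (use r in \<open>auto simp: eventually_nhds_Cn\<close>)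
  moreover have "(?L \<longlongrightarrow> (\<Sum>i<length t. D i * (t ! i - t ! i))) (nhds_Cn t)"
    by (intro tendsto_intros tendsto_nth_Cn) auto
  ultimately have "((\<lambda>u. (f u - f t - ?L u) + ?L u + f t) \<longlongrightarrow> 0 + 0 + f t) (nhds_Cn t)"
    by (intro tendsto_add tendsto_const) auto
  then show ?thesis by simp
qed

text \<open>On the outer half of the disc the denominator is at least R/2, which bounds the quotient there; the
  maximum principle carries this bound to the centre.  Used once, the lemma is a Lipschitz estimate,
  used twice, a second order expansion, both with constants that depend only on the bound and the
  radius.\<close>

lemma bounded_difference_quotient:
  fixes \<phi> :: "complex \<Rightarrow> complex"
  assumes hol: "\<phi> holomorphic_on ball a R" and R: "R > 0" and B: "\<And>z. z \<in> ball a R \<Longrightarrow> norm (\<phi> z) \<le> B"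
  obtains q where "q holomorphic_on ball a R" "\<And>z. \<phi> z = \<phi> a + (z - a) * q z" "q a = deriv \<phi> a"
    "\<And>z. z \<in> ball a R \<Longrightarrow> norm (q z) \<le> 4 * B / R"
proof
  let ?q = "\<lambda>z. if z = a then deriv \<phi> a else (\<phi> z - \<phi> a) / (z - a)"
  show q: "?q holomorphic_on ball a R"
    by (rule pole_lemma[OF hol]) (use R in auto)
  have far: "norm (?q z) \<le> 4 * B / R" if "z \<in> ball a R" "dist a z \<ge> R / 2" for z
  proof -
    have za: "z \<noteq> a" using that R by auto
    have "norm (\<phi> z - \<phi> a) \<le> B + B"
      using B[OF that(1)] B[of a] R by (intro norm_triangle_le_diff add_mono) auto
    moreover have "norm (z - a) \<ge> R / 2" using that by (simp add: dist_norm norm_minus_commute)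
    ultimately have "norm (\<phi> z - \<phi> a) / norm (z - a) \<le> (B + B) / (R / 2)"
      using R B[of a] order_trans[OF norm_ge_zero B[of a]] by (intro frac_le) auto
    then show ?thesis using za by (simp add: norm_divide)
  qed
  show "norm (?q z) \<le> 4 * B / R" if z: "z \<in> ball a R" for z
  proof (cases "dist a z \<ge> R / 2")
    case True then show ?thesis using far z by blast
  next
    case False
    show ?thesis
    proof (rule maximum_modulus_frontier[of ?q "cball a (R/2)"])
      show "?q holomorphic_on interior (cball a (R/2))"
        by (rule holomorphic_on_subset[OF q]) (use R in auto)
      show "continuous_on (closure (cball a (R/2))) ?q"
        by (rule continuous_on_subset[OF holomorphic_on_imp_continuous_on[OF q]]) (use R in auto)
      show "z \<in> cball a (R/2)" using False by auto
      show "norm (?q w) \<le> 4 * B / R" if "w \<in> frontier (cball a (R/2))" for w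
        by (rule far) (use that R in \<open>auto simp: frontier_def\<close>)
    qed auto
  qed
qed auto

lemma bounded_Lipschitz:
  fixes \<phi> :: "complex \<Rightarrow> complex"
  assumes "\<phi> holomorphic_on ball a R" "R > 0" "\<And>z. z \<in> ball a R \<Longrightarrow> norm (\<phi> z) \<le> B" "z \<in> ball a R"
  shows "norm (\<phi> z - \<phi> a) \<le> 4 * B / R * norm (z - a)"
proof -
  obtain q where q: "\<And>z. \<phi> z = \<phi> a + (z - a) * q z" "\<And>z. z \<in> ball a R \<Longrightarrow> norm (q z) \<le> 4 * B / R"
    using bounded_difference_quotient[OF assms(1,2,3)] by metis
  have "norm (\<phi> z - \<phi> a) = norm (q z) * norm (z - a)"
    using q(1)[of z] by (simp add: norm_mult mult.commute)
  then show ?thesis using mult_right_mono[OF q(2)[OF assms(4)], of "norm (z - a)"] by simp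
qed

lemma bounded_second_order:
  fixes \<phi> :: "complex \<Rightarrow> complex"
  assumes "\<phi> holomorphic_on ball a R" "R > 0" "\<And>z. z \<in> ball a R \<Longrightarrow> norm (\<phi> z) \<le> B" "z \<in> ball a R"
  shows "norm (\<phi> z - \<phi> a - deriv \<phi> a * (z - a)) \<le> 16 * B / R\<^sup>2 * (norm (z - a))\<^sup>2"
proof -
  obtain q where q: "q holomorphic_on ball a R" "\<And>z. \<phi> z = \<phi> a + (z - a) * q z" "q a = deriv \<phi> a"
     "\<And>z. z \<in> ball a R \<Longrightarrow> norm (q z) \<le> 4 * B / R"
    using bounded_difference_quotient[OF assms(1,2,3)] by metis
  have "norm (q z - q a) \<le> 4 * (4 * B / R) / R * norm (z - a)"
    using bounded_Lipschitz[OF q(1) assms(2) q(4) assms(4)] .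
  then have "norm (z - a) * norm (q z - q a) \<le> norm (z - a) * (4 * (4 * B / R) / R * norm (z - a))"
    by (intro mult_left_mono) auto
  moreover have "\<phi> z - \<phi> a - deriv \<phi> a * (z - a) = (z - a) * (q z - q a)"
    using q(2)[of z] q(3) by (simp add: algebra_simps)
  ultimately show ?thesis by (simp add: norm_mult power2_eq_square mult_ac)
qed

section \<open>Osgood's lemma, uniform limits and the identity theorem\<close>

definition separately_holomorphic :: "complex list set \<Rightarrow> (complex list \<Rightarrow> complex) \<Rightarrow> bool" where
  "separately_holomorphic U f \<longleftrightarrow>
     (\<forall>t\<in>U. \<forall>i<length t. (\<lambda>z. f (t[i := z])) field_differentiable (at (t ! i)))"

lemma separately_holomorphic_section:
  assumes "separately_holomorphic U f" "i < length u" "\<And>z. z \<in> A \<Longrightarrow> u[i := z] \<in> U"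
  shows "(\<lambda>z. f (u[i := z])) holomorphic_on A"
  unfolding holomorphic_on_def
proof
  fix z assume z: "z \<in> A"
  have "(\<lambda>z'. f (u[i := z, i := z'])) field_differentiable (at (u[i := z] ! i))"
    using assms z unfolding separately_holomorphic_def by (metis length_list_update)
  then show "(\<lambda>z. f (u[i := z])) field_differentiable (at z within A)"
    using assms(2) by (simp add: field_differentiable_at_within)
qed

lemma holomorphic_Cn_imp_separately: "holomorphic_Cn U f \<Longrightarrow> separately_holomorphic U f"
  unfolding separately_holomorphic_def using holomorphic_Cn_section by blast

lemma holomorphic_Cn_section_on:
  assumes "holomorphic_Cn U f" "i < length u" "\<And>z. z \<in> A \<Longrightarrow> u[i := z] \<in> U"
  shows "(\<lambda>z. f (u[i := z])) holomorphic_on A"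
  using separately_holomorphic_section[OF holomorphic_Cn_imp_separately[OF assms(1)]] assms by blast

lemma telescope_Cn:
  fixes f :: "complex list \<Rightarrow> complex"
  assumes "length u = length t"
  shows "f u - f t = (\<Sum>k<length t. f ((take k u @ drop k t)[k := u ! k]) - f (take k u @ drop k t))"
proof -
  have "(take k u @ drop k t)[k := u ! k] = take (Suc k) u @ drop (Suc k) t" if "k < length t" for k
    using that assms by (auto intro!: nth_equalityI simp: nth_append nth_list_update)
  then have "(\<Sum>k<length t. f ((take k u @ drop k t)[k := u ! k]) - f (take k u @ drop k t))
      = (\<Sum>k<length t. f (take (Suc k) u @ drop (Suc k) t) - f (take k u @ drop k t))"
    by (intro sum.cong) auto
  also have "\<dots> = f (take (length t) u @ drop (length t) t) - f (take 0 u @ drop 0 t)"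
    by (rule sum_lessThan_telescope)
  finally show ?thesis using assms by simp
qed

lemma hybrid_in_polydisc:
  assumes "u \<in> polydisc t r" "w \<in> polydisc t r" shows "take k u @ drop k w \<in> polydisc t r"
  using assms by (auto simp: polydisc_iff nth_append min_def)

lemma bounded_separately_holomorphic_Lipschitz:
  assumes sep: "separately_holomorphic (polydisc t R) f" and R: "R > 0"
    and B: "\<And>u. u \<in> polydisc t R \<Longrightarrow> norm (f u) \<le> B"
    and v: "v \<in> polydisc t (R/4)" and w: "w \<in> polydisc t (R/4)"
  shows "norm (f v - f w) \<le> 8 * B / R * (\<Sum>k<length t. norm (v ! k - w ! k))"
proof -
  have len: "length v = length t" "length w = length t" using v w by (auto simp: polydisc_iff)
  have "norm (f ((take k v @ drop k w)[k := v ! k]) - f (take k v @ drop k w)) \<le> 8 * B / R * norm (v ! k - w ! k)"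
    if k: "k < length t" for k
  proof -
    let ?h = "take k v @ drop k w"
    have h: "?h \<in> polydisc t (R/4)" by (rule hybrid_in_polydisc[OF v w])
    have hk: "?h ! k = w ! k" "length ?h = length t" using len k by (auto simp: nth_append)
    have inP: "?h[k := z] \<in> polydisc t R" if "z \<in> ball (w ! k) (R/2)" for z
    proof (rule polydisc_update)
      show "?h \<in> polydisc t R" using h polydisc_mono[of "R/4" R t] R by auto
      have "dist (t ! k) (w ! k) < R / 4" using w k by (simp add: polydisc_iff)
      moreover have "dist (w ! k) z < R / 2" using that by simp
      ultimately show "dist (t ! k) z < R" using dist_triangle[of "t ! k" z "w ! k"] R by linarith
    qed
    have "norm (f (?h[k := v ! k]) - f (?h[k := w ! k])) \<le> 4 * B / (R/2) * norm (v ! k - w ! k)"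
    proof (rule bounded_Lipschitz[where \<phi> = "\<lambda>z. f (?h[k := z])"])
      show "(\<lambda>z. f (?h[k := z])) holomorphic_on ball (w ! k) (R/2)"
        by (rule separately_holomorphic_section[OF sep]) (use inP hk k in auto)
      show "v ! k \<in> ball (w ! k) (R / 2)"
      proof -
        have "dist (t ! k) (w ! k) < R / 4" "dist (t ! k) (v ! k) < R / 4" 
          using v w k by (simp_all add: polydisc_iff)
        then show ?thesis using dist_triangle2[of "w ! k" "v ! k" "t ! k"] by (simp add: dist_commute)
      qed
    qed (use R inP B in auto)
    moreover have "?h[k := w ! k] = ?h" using hk(1) by (metis list_update_id)
    moreover have "4 * B / (R/2) = 8 * B / R" by simp
    ultimately show ?thesis by simp
  qed
  then have "norm (\<Sum>k<length w. f ((take k v @ drop k w)[k := v ! k]) - f (take k v @ drop k w))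
      \<le> (\<Sum>k<length t. 8 * B / R * norm (v ! k - w ! k))"
    unfolding len by (intro sum_norm_le) auto
  then show ?thesis using telescope_Cn[of v w f] len by (simp add: sum_distrib_left)
qed

text \<open>Along the coordinate path from the centre to a nearby point every step has a second order
  expansion.  The slope of a step differs from the partial derivative at the centre by the slope of a
  holomorphic function that is small, because a bounded separately holomorphic function is Lipschitz.
  This makes closure properties accessible: continuity and one-variable differentiability suffice.\<close>

lemma Osgood:
  assumes U: "open_Cn N U" and sep: "separately_holomorphic U f"
    and bdd: "\<And>t. t \<in> U \<Longrightarrow> \<exists>B. eventually (\<lambda>u. norm (f u) \<le> B) (nhds_Cn t)"
  shows "holomorphic_Cn U f"
  unfolding holomorphic_Cn_def
proof
  fix t assume t: "t \<in> U"
  obtain B where "eventually (\<lambda>u. u \<in> U \<and> norm (f u) \<le> B) (nhds_Cn t)"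
    using bdd[OF t] eventually_conj[OF eventually_nhds_Cn_open[OF U t]] by blast
  then obtain R where R: "R > 0" and RU: "polydisc t R \<subseteq> U" and B: "\<And>u. u \<in> polydisc t R \<Longrightarrow> norm (f u) \<le> B"
    unfolding eventually_nhds_Cn by blast
  have B0: "B \<ge> 0" using B[OF centre_in_polydisc[OF R]] norm_ge_zero order_trans by blast
  have sepR: "separately_holomorphic (polydisc t R) f"
    using sep RU unfolding separately_holomorphic_def by blast
  define D where "D k = deriv (\<lambda>z. f (t[k := z])) (t ! k)" for k
  define K where "K = 16 * B / R\<^sup>2 + 128 * B / R\<^sup>2"
  have K0: "K \<ge> 0" using B0 by (simp add: K_def)
  have main: "norm (f u - f t - (\<Sum>i<length t. D i * (u ! i - t ! i))) \<le> K * (\<Sum>i<length t. norm (u ! i - t ! i))\<^sup>2"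
    if u: "u \<in> polydisc t (R/4)" for u
  proof -
    have len: "length u = length t" using u by (simp add: polydisc_iff)
    define \<sigma> where "\<sigma> = (\<Sum>i<length t. norm (u ! i - t ! i))"
    have \<sigma>: "norm (u ! k - t ! k) \<le> \<sigma>" if "k < length t" for k
      unfolding \<sigma>_def using that by (intro member_le_sum) auto
    have \<sigma>0: "\<sigma> \<ge> 0" unfolding \<sigma>_def by (intro sum_nonneg) auto
    have step: "norm (f ((take k u @ drop k t)[k := u ! k]) - f (take k u @ drop k t) - D k * (u ! k - t ! k))
        \<le> norm (u ! k - t ! k) * (K * \<sigma>)" if k: "k < length t" for k
    proof -
      let ?h = "take k u @ drop k t"
      have tP: "t \<in> polydisc t (R/4)" using R by (simp add: centre_in_polydisc)
      have h: "?h \<in> polydisc t (R/4)" by (rule hybrid_in_polydisc[OF u tP])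
      have hk: "?h ! k = t ! k" "length ?h = length t" using len k by (auto simp: nth_append)
      have uk: "u ! k \<in> ball (t ! k) (R/4)" using u k by (simp add: polydisc_iff)
      have inP: "?h[k := z] \<in> polydisc t (R/4)" "t[k := z] \<in> polydisc t (R/4)" if "z \<in> ball (t ! k) (R/4)" for z
        using that by (auto intro!: polydisc_update h tP)
      have inP': "?h[k := z] \<in> polydisc t R" "t[k := z] \<in> polydisc t R" if "z \<in> ball (t ! k) (R/4)" for z
        using inP[OF that] polydisc_mono[of "R/4" R t] R by auto
      have inP2: "t[k := z] \<in> polydisc t R" if "z \<in> ball (t ! k) R" for z
        using that R by (auto intro!: polydisc_update centre_in_polydisc)
      let ?\<chi> = "\<lambda>z. f (?h[k := z]) - f (t[k := z])"
      have "norm (?\<chi> (u ! k) - ?\<chi> (t ! k)) \<le> 4 * (8 * B / R * \<sigma>) / (R/4) * norm (u ! k - t ! k)"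
      proof (rule bounded_Lipschitz[where \<phi> = ?\<chi>])
        show "?\<chi> holomorphic_on ball (t ! k) (R/4)"
          by (intro holomorphic_on_diff separately_holomorphic_section[OF sepR]) (use inP' hk k in auto)
        show "norm (?\<chi> z) \<le> 8 * B / R * \<sigma>" if z: "z \<in> ball (t ! k) (R/4)" for z
        proof -
          have "norm (?\<chi> z) \<le> 8 * B / R * (\<Sum>j<length t. norm (?h[k := z] ! j - t[k := z] ! j))"
            by (rule bounded_separately_holomorphic_Lipschitz[OF sepR R B inP[OF z]])
          also have "(\<Sum>j<length t. norm (?h[k := z] ! j - t[k := z] ! j)) \<le> \<sigma>"
            unfolding \<sigma>_def
          proof (rule sum_mono)
            fix j assume j: "j \<in> {..<length t}"
            then show "norm (?h[k := z] ! j - t[k := z] ! j) \<le> norm (u ! j - t ! j)"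
              using len k hk by (cases "j = k"; cases "j < k") (auto simp: nth_append)
          qed
          then have "8 * B / R * (\<Sum>j<length t. norm (?h[k := z] ! j - t[k := z] ! j)) \<le> 8 * B / R * \<sigma>"
            using B0 R by (intro mult_left_mono) auto
          finally show ?thesis .
        qed
      qed (use R uk in auto)
      moreover have "norm (f (t[k := u ! k]) - f (t[k := t ! k]) - D k * (u ! k - t ! k))
          \<le> 16 * B / R\<^sup>2 * (norm (u ! k - t ! k))\<^sup>2"
        unfolding D_def
      proof (rule bounded_second_order[where \<phi> = "\<lambda>z. f (t[k := z])"])
        show "(\<lambda>z. f (t[k := z])) holomorphic_on ball (t ! k) R"
          by (rule separately_holomorphic_section[OF sepR]) (use inP2 k in auto)
        show "u ! k \<in> ball (t ! k) R" using uk R by auto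
      qed (use R inP2 B in auto)
      moreover have "f (?h[k := u ! k]) - f ?h - D k * (u ! k - t ! k)
          = (?\<chi> (u ! k) - ?\<chi> (t ! k)) + (f (t[k := u ! k]) - f (t[k := t ! k]) - D k * (u ! k - t ! k))"
      proof -
        have "?h[k := t ! k] = ?h" using hk(1) by (metis list_update_id)
        then show ?thesis by simp
      qed
      ultimately have "norm (f (?h[k := u ! k]) - f ?h - D k * (u ! k - t ! k))
          \<le> 4 * (8 * B / R * \<sigma>) / (R/4) * norm (u ! k - t ! k) + 16 * B / R\<^sup>2 * (norm (u ! k - t ! k))\<^sup>2"
        by (simp only: norm_triangle_mono)
      also have "16 * B / R\<^sup>2 * (norm (u ! k - t ! k))\<^sup>2 \<le> 16 * B / R\<^sup>2 * (norm (u ! k - t ! k) * \<sigma>)"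
        using \<sigma>[OF k] B0 unfolding power2_eq_square[of "norm (u ! k - t ! k)"] by (intro mult_left_mono) auto
      also have "4 * (8 * B / R * \<sigma>) / (R/4) * norm (u ! k - t ! k) + 16 * B / R\<^sup>2 * (norm (u ! k - t ! k) * \<sigma>)
          = norm (u ! k - t ! k) * (K * \<sigma>)"
        unfolding K_def by (simp add: field_simps power2_eq_square)
      finally show ?thesis by simp
    qed
    have "f u - f t - (\<Sum>i<length t. D i * (u ! i - t ! i))
        = (\<Sum>k<length t. f ((take k u @ drop k t)[k := u ! k]) - f (take k u @ drop k t) - D k * (u ! k - t ! k))"
      using telescope_Cn[OF len, of f] by (simp add: sum_subtractf)
    also have "norm \<dots> \<le> (\<Sum>k<length t. norm (u ! k - t ! k) * (K * \<sigma>))"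
      using step by (intro sum_norm_le) auto
    also have "\<dots> = K * \<sigma>\<^sup>2" unfolding sum_distrib_right[symmetric] \<sigma>_def by (simp add: power2_eq_square)
    finally show ?thesis unfolding \<sigma>_def .
  qed
  show "\<exists>D. \<forall>e>0. \<exists>r>0. \<forall>u\<in>polydisc t r.
        norm (f u - f t - (\<Sum>i<length t. D i * (u ! i - t ! i))) \<le> e * (\<Sum>i<length t. norm (u ! i - t ! i))"
  proof (rule exI[of _ D], intro allI impI)
    fix e :: real assume e: "e > 0"
    have lim: "((\<lambda>u. K * (\<Sum>i<length t. norm (u ! i - t ! i))) \<longlongrightarrow> K * (\<Sum>i<length t. norm (t ! i - t ! i))) (nhds_Cn t)"
      by (intro tendsto_intros tendsto_nth_Cn) auto
    have "eventually (\<lambda>u. K * (\<Sum>i<length t. norm (u ! i - t ! i)) < e) (nhds_Cn t)"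
      by (rule order_tendstoD(2)[OF lim]) (use e in simp)
    then obtain r where r: "r > 0" "\<forall>u\<in>polydisc t r. K * (\<Sum>i<length t. norm (u ! i - t ! i)) < e"
      unfolding eventually_nhds_Cn by blast
    show "\<exists>r>0. \<forall>u\<in>polydisc t r.
        norm (f u - f t - (\<Sum>i<length t. D i * (u ! i - t ! i))) \<le> e * (\<Sum>i<length t. norm (u ! i - t ! i))"
    proof (intro exI[of _ "min r (R/4)"] conjI ballI)
      show "min r (R/4) > 0" using r R by simp
      fix u assume u: "u \<in> polydisc t (min r (R/4))"
      then have u1: "u \<in> polydisc t r" and u2: "u \<in> polydisc t (R/4)" by (auto simp: polydisc_iff)
      let ?s = "\<Sum>i<length t. norm (u ! i - t ! i)"
      have "K * ?s\<^sup>2 = (K * ?s) * ?s" by (simp add: power2_eq_square)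
      also have "\<dots> \<le> e * ?s" using r(2) u1 by (intro mult_right_mono sum_nonneg) (auto intro: less_imp_le)
      finally show "norm (f u - f t - (\<Sum>i<length t. D i * (u ! i - t ! i))) \<le> e * ?s" using main[OF u2] by simp
    qed
  qed
qed

lemma holomorphic_CnI:
  assumes "open_Cn N U" "\<And>t. t \<in> U \<Longrightarrow> (f \<longlongrightarrow> f t) (nhds_Cn t)"
    and "\<And>t i. t \<in> U \<Longrightarrow> i < length t \<Longrightarrow> (\<lambda>z. f (t[i := z])) field_differentiable (at (t ! i))"
  shows "holomorphic_Cn U f"
proof (rule Osgood[OF assms(1)])
  show "separately_holomorphic U f" using assms(3) by (simp add: separately_holomorphic_def)
  fix t assume t: "t \<in> U"
  have "eventually (\<lambda>u. norm (f u) < norm (f t) + 1) (nhds_Cn t)"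
    by (rule order_tendstoD(2)[OF tendsto_norm[OF assms(2)[OF t]]]) simp
  then show "\<exists>B. eventually (\<lambda>u. norm (f u) \<le> B) (nhds_Cn t)"
    by (intro exI[of _ "norm (f t) + 1"]) (auto elim: eventually_mono)
qed

lemma holomorphic_Cn_subset: "holomorphic_Cn U f \<Longrightarrow> V \<subseteq> U \<Longrightarrow> holomorphic_Cn V f"
  unfolding holomorphic_Cn_def by blast

lemma holomorphic_Cn_const:
  assumes "open_Cn N U" shows "holomorphic_Cn U (\<lambda>_. c)"
  by (rule holomorphic_CnI[OF assms]) (auto intro: field_differentiable_const)

lemma holomorphic_Cn_mult:
  assumes "open_Cn N U" "holomorphic_Cn U f" "holomorphic_Cn U g"
  shows "holomorphic_Cn U (\<lambda>t. f t * g t)"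
  by (rule holomorphic_CnI[OF assms(1)])
    (auto intro!: tendsto_mult field_differentiable_mult
      intro: assms holomorphic_Cn_tendsto[OF assms(2)] holomorphic_Cn_tendsto[OF assms(3)]
        holomorphic_Cn_section[OF assms(2)] holomorphic_Cn_section[OF assms(3)])

lemma holomorphic_Cn_divide:
  assumes "open_Cn N U" "holomorphic_Cn U f" "holomorphic_Cn U g" "\<And>t. t \<in> U \<Longrightarrow> g t \<noteq> 0"
  shows "holomorphic_Cn U (\<lambda>t. f t / g t)"
  by (rule holomorphic_CnI[OF assms(1)])
    (auto intro!: tendsto_divide field_differentiable_divide
      intro: assms holomorphic_Cn_tendsto[OF assms(2)] holomorphic_Cn_tendsto[OF assms(3)]
        holomorphic_Cn_section[OF assms(2)] holomorphic_Cn_section[OF assms(3)] dest: assms(4))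

text \<open>The one-variable theorem applies to the sections, and boundedness near a point is inherited from
  any member of the family that is uniformly close to the limit.\<close>

lemma holomorphic_Cn_uniform_limit:
  assumes U: "open_Cn N U" and F: "F \<noteq> bot" and hol: "\<forall>\<^sub>F n in F. holomorphic_Cn U (f n)"
    and lim: "uniform_limit U f g F"
  shows "holomorphic_Cn U g"
proof (rule Osgood[OF U])
  show "separately_holomorphic U g"
    unfolding separately_holomorphic_def
  proof (intro ballI allI impI)
    fix t i assume t: "t \<in> U" and i: "i < length t"
    obtain r where r: "r > 0" "polydisc t r \<subseteq> U" using U t unfolding open_Cn_def by blast
    have inU: "t[i := z] \<in> U" if "z \<in> cball (t ! i) (r/2)" for z
      using that r by (intro subsetD[OF r(2)] polydisc_update centre_in_polydisc) auto
    have "(\<lambda>z. g (t[i := z])) holomorphic_on ball (t ! i) (r/2)"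
    proof (rule holomorphic_uniform_limit)
      show "\<forall>\<^sub>F n in F. continuous_on (cball (t ! i) (r/2)) (\<lambda>z. f n (t[i := z])) \<and>
          (\<lambda>z. f n (t[i := z])) holomorphic_on ball (t ! i) (r/2)"
        using hol
      proof eventually_elim
        case (elim n)
        have "(\<lambda>z. f n (t[i := z])) holomorphic_on cball (t ! i) (r/2)"
          by (rule holomorphic_Cn_section_on[OF elim i inU])
        then show ?case
          using holomorphic_on_imp_continuous_on holomorphic_on_subset[OF _ ball_subset_cball] by blast
      qed
      show "uniform_limit (cball (t ! i) (r/2)) (\<lambda>n z. f n (t[i := z])) (\<lambda>z. g (t[i := z])) F"
        using lim inU unfolding uniform_limit_iff by (fast elim: eventually_mono)
    qed (use F in auto)
    then show "(\<lambda>z. g (t[i := z])) field_differentiable (at (t ! i))"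
      by (rule holomorphic_on_imp_differentiable_at) (use r in auto)
  qed
  fix t assume t: "t \<in> U"
  have "\<forall>\<^sub>F n in F. \<forall>u\<in>U. dist (f n u) (g u) < 1" using lim unfolding uniform_limit_iff by simp
  then obtain n where n: "\<And>u. u \<in> U \<Longrightarrow> dist (f n u) (g u) < 1" and hn: "holomorphic_Cn U (f n)"
    using eventually_happens'[OF F eventually_conj[OF _ hol]] by blast
  have "eventually (\<lambda>u. norm (f n u) < norm (f n t) + 1) (nhds_Cn t)"
    by (rule order_tendstoD(2)[OF tendsto_norm[OF holomorphic_Cn_tendsto[OF hn t]]]) simp
  then have "eventually (\<lambda>u. norm (g u) \<le> norm (f n t) + 2) (nhds_Cn t)"
    using eventually_nhds_Cn_open[OF U t]
  proof eventually_elim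
    case (elim u)
    have "norm (g u) \<le> norm (f n u) + dist (f n u) (g u)"
      using norm_triangle_sub[of "g u" "f n u"] by (simp add: dist_norm norm_minus_commute)
    then show ?case using n[OF elim(2)] elim(1) by linarith
  qed
  then show "\<exists>B. eventually (\<lambda>u. norm (g u) \<le> B) (nhds_Cn t)" by blast
qed

text \<open>A complex line through two points of a polydisc meets it in a convex set, so the identity theorem in
  one variable applies.\<close>

lemma identity_polydisc:
  assumes hol: "holomorphic_Cn (polydisc t r) f" and V: "open_Cn (length t) V" "V \<noteq> {}" "V \<subseteq> polydisc t r"
    and zero: "\<And>u. u \<in> V \<Longrightarrow> f u = 0" and a: "a \<in> polydisc t r"
  shows "f a = 0"
proof -
  obtain b where b: "b \<in> V" using V by blast
  then have bP: "b \<in> polydisc t r" using V by blast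
  have len: "length a = length t" "length b = length t" using a bP by (auto simp: polydisc_iff)
  define d where "d = map2 (-) a b"
  have dlen: "length d = length b" using len by (simp add: d_def)
  define A where "A = {z. line_Cn b d z \<in> polydisc t r}"
  have A_eq: "A = (\<Inter>i<length t. (\<lambda>z. t ! i - (b ! i + z * d ! i)) -` ball 0 r)"
    using len dlen by (auto simp: A_def polydisc_iff dist_norm norm_minus_commute)
  have A1: "open A" unfolding A_eq by (intro open_INT open_vimage continuous_intros ballI finite_lessThan) auto
  have "convex A" unfolding A_eq
  proof (rule convex_INT)
    fix i
    show "convex ((\<lambda>z. t ! i - (b ! i + z * d ! i)) -` ball 0 r)"
    proof (rule convexI)
      fix x y :: complex and u v :: real
      assume xy: "x \<in> (\<lambda>z. t ! i - (b ! i + z * d ! i)) -` ball 0 r" "y \<in> (\<lambda>z. t ! i - (b ! i + z * d ! i)) -` ball 0 r"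
        and uv: "0 \<le> u" "0 \<le> v" "u + v = 1"
      have "t ! i - (b ! i + (u *\<^sub>R x + v *\<^sub>R y) * d ! i) = 
        u *\<^sub>R (t ! i - (b ! i + x * d ! i)) + v *\<^sub>R (t ! i - (b ! i + y * d ! i))"
      proof -
        have v: "of_real v = 1 - (of_real u :: complex)" using uv(3) by (metis add_diff_cancel_left' of_real_1 of_real_diff)
        show ?thesis unfolding scaleR_conv_of_real v by (simp add: algebra_simps)
      qed
      then show "u *\<^sub>R x + v *\<^sub>R y \<in> (\<lambda>z. t ! i - (b ! i + z * d ! i)) -` ball 0 r"
        using convexD[OF convex_ball, of "t ! i - (b ! i + x * d ! i)" 0 r "t ! i - (b ! i + y * d ! i)" u v] xy uv by simp
    qed
  qed
  then have A2: "connected A" by (rule convex_connected)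
  have line0: "line_Cn b d 0 = b" and line1: "line_Cn b d 1 = a"
    using len dlen by (auto intro!: nth_equalityI simp: d_def)
  have A0: "0 \<in> A" and A1': "1 \<in> A" using line0 line1 bP a by (auto simp: A_def)
  have holA: "(\<lambda>z. f (line_Cn b d z)) holomorphic_on A"
    unfolding holomorphic_on_def A_def
    by (auto intro!: field_differentiable_at_within holomorphic_Cn_field_differentiable_line[OF hol dlen])
  obtain e where e: "e > 0" "polydisc b e \<subseteq> V" using V(1) b unfolding open_Cn_def by blast
  define K where "K = (\<Sum>i<length t. norm (d ! i)) + 1"
  have K: "K > 0" unfolding K_def by (intro add_nonneg_pos sum_nonneg) auto
  have dK: "norm (d ! i) < K" if "i < length t" for i
    using that member_le_sum[of i "{..<length t}" "\<lambda>i. norm (d ! i)"] unfolding K_def by auto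
  have near: "line_Cn b d z \<in> V" if z: "z \<in> ball 0 (e / K)" for z
  proof -
    have "norm (z * d ! i) < e" if "i < length t" for i
    proof -
      have "norm z * norm (d ! i) \<le> norm z * K" using dK[OF that] by (intro mult_left_mono) auto
      also have "\<dots> < e" using z K by (simp add: field_simps)
      finally show ?thesis by (simp add: norm_mult)
    qed
    then have "line_Cn b d z \<in> polydisc b e" using dlen len by (auto simp: polydisc_iff dist_norm norm_minus_commute)
    then show ?thesis using e by blast
  qed
  have "f (line_Cn b d 1) = 0"
  proof (rule analytic_continuation[OF holA A1 A2 _ A0 _ _ A1', of "ball 0 (e / K)"])
    show "ball (0::complex) (e / K) \<subseteq> A" using near V(3) by (auto simp: A_def)
    show "(0::complex) islimpt ball 0 (e / K)" 
      using e K by (intro interior_limit_point) (simp add: interior_open)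
    show "f (line_Cn b d z) = 0" if "z \<in> ball 0 (e / K)" for z using near[OF that] zero by blast
  qed
  then show ?thesis using line1 by simp
qed

section \<open>Properties on open dense sets\<close>

text \<open>A form of genericity that needs no holomorphic function to witness it.  Points at which a given term
  of the series is well behaved form such a set, and continuity extends identities from it.\<close>

definition generic_on :: "nat \<Rightarrow> complex list set \<Rightarrow> (complex list \<Rightarrow> bool) \<Rightarrow> bool" where
  "generic_on N U P \<longleftrightarrow> (\<forall>V. open_Cn N V \<and> V \<noteq> {} \<and> V \<subseteq> U \<longrightarrow>
     (\<exists>V'. open_Cn N V' \<and> V' \<noteq> {} \<and> V' \<subseteq> V \<and> (\<forall>u\<in>V'. P u)))"

lemma generic_onE:
  assumes "generic_on N U P" "open_Cn N V" "V \<noteq> {}" "V \<subseteq> U"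
  obtains V' where "open_Cn N V'" "V' \<noteq> {}" "V' \<subseteq> V" "\<And>u. u \<in> V' \<Longrightarrow> P u"
  using assms unfolding generic_on_def by meson

lemma generic_on_subset: "generic_on N U P \<Longrightarrow> V \<subseteq> U \<Longrightarrow> generic_on N V P"
  unfolding generic_on_def by (meson order_trans)

lemma generic_on_mono: "generic_on N U P \<Longrightarrow> (\<And>u. u \<in> U \<Longrightarrow> P u \<Longrightarrow> Q u) \<Longrightarrow> generic_on N U Q"
  unfolding generic_on_def by (meson order_trans subsetD)

lemma generic_on_conj:
  assumes "generic_on N U P" "generic_on N U Q" shows "generic_on N U (\<lambda>u. P u \<and> Q u)"
  unfolding generic_on_def
proof (intro allI impI)
  fix V assume "open_Cn N V \<and> V \<noteq> {} \<and> V \<subseteq> U"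
  then obtain V1 where V1: "open_Cn N V1" "V1 \<noteq> {}" "V1 \<subseteq> V" "V \<subseteq> U" "\<And>u. u \<in> V1 \<Longrightarrow> P u"
    using generic_onE[OF assms(1), of V] by metis
  then obtain V2 where V2: "open_Cn N V2" "V2 \<noteq> {}" "V2 \<subseteq> V1" "\<And>u. u \<in> V2 \<Longrightarrow> Q u"
    using generic_onE[OF assms(2), of V1] by (metis order_trans)
  show "\<exists>V'. open_Cn N V' \<and> V' \<noteq> {} \<and> V' \<subseteq> V \<and> (\<forall>u\<in>V'. P u \<and> Q u)"
    by (rule exI[of _ V2]) (use V1 V2 in auto)
qed

lemma generic_on_True: "generic_on N U (\<lambda>_. True)"
  unfolding generic_on_def by blast

lemma generic_on_ball_finite:
  assumes "finite A" "\<And>a. a \<in> A \<Longrightarrow> generic_on N U (P a)"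
  shows "generic_on N U (\<lambda>u. \<forall>a\<in>A. P a u)"
  using assms
proof (induction A rule: finite_induct)
  case (insert a A)
  then have "generic_on N U (\<lambda>u. P a u \<and> (\<forall>a\<in>A. P a u))" by (intro generic_on_conj) auto
  then show ?case by (rule generic_on_mono) auto
qed (auto intro: generic_on_True)

lemma generic_on_frequently:
  assumes "generic_on N U P" "open_Cn N U" "t \<in> U"
  shows "\<exists>\<^sub>F u in nhds_Cn t. P u"
proof (rule ccontr)
  assume "\<not> (\<exists>\<^sub>F u in nhds_Cn t. P u)"
  then have "\<forall>\<^sub>F u in nhds_Cn t. \<not> P u \<and> u \<in> U"
    using eventually_nhds_Cn_open[OF assms(2,3)] by (auto simp: not_frequently intro: eventually_conj)
  then obtain r where r: "r > 0" "\<forall>u\<in>polydisc t r. \<not> P u \<and> u \<in> U" unfolding eventually_nhds_Cn by blast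
  have len: "length t = N" using assms(2,3) by (simp add: open_Cn_def)
  obtain V' where "V' \<noteq> {}" "V' \<subseteq> polydisc t r" "\<And>u. u \<in> V' \<Longrightarrow> P u"
    by (rule generic_onE[OF assms(1), of "polydisc t r"])
      (use r len open_polydisc[of t r] centre_in_polydisc[of r t] in auto)
  then show False using r by blast
qed

lemma frequently_eq_limit:
  fixes f g :: "'a \<Rightarrow> complex"
  assumes "(f \<longlongrightarrow> a) F" "(g \<longlongrightarrow> b) F" "\<exists>\<^sub>F x in F. f x = g x" shows "a = b"
proof (rule ccontr)
  assume "a \<noteq> b"
  moreover have "((\<lambda>x. f x - g x) \<longlongrightarrow> a - b) F" using assms by (intro tendsto_diff)
  ultimately have "\<forall>\<^sub>F x in F. f x - g x \<noteq> 0" by (intro tendsto_imp_eventually_ne) auto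
  then show False using assms(3) by (auto simp: frequently_def elim: eventually_mono)
qed

lemma open_Cn_nonzero:
  assumes "open_Cn N U" "holomorphic_Cn U f" shows "open_Cn N {u\<in>U. f u \<noteq> 0}"
  by (rule open_Cn_eventually[OF assms(1)])
    (rule tendsto_imp_eventually_ne[OF holomorphic_Cn_tendsto[OF assms(2)]])

lemma nonzero_holomorphic_generic_on:
  assumes "open_Cn N U" "nonzero_holomorphic N U v" shows "generic_on N U (\<lambda>u. v u \<noteq> 0)"
  unfolding generic_on_def
proof (intro allI impI)
  fix V assume V: "open_Cn N V \<and> V \<noteq> {} \<and> V \<subseteq> U"
  then have "holomorphic_Cn V v" using assms(2) unfolding nonzero_holomorphic_def by (blast intro: holomorphic_Cn_subset)
  then have "open_Cn N {u\<in>V. v u \<noteq> 0}" using V open_Cn_nonzero by blast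
  moreover have "{u\<in>V. v u \<noteq> 0} \<noteq> {}" using assms(2) V unfolding nonzero_holomorphic_def by blast
  ultimately show "\<exists>V'. open_Cn N V' \<and> V' \<noteq> {} \<and> V' \<subseteq> V \<and> (\<forall>u\<in>V'. v u \<noteq> 0)"
    by (intro exI[of _ "{u\<in>V. v u \<noteq> 0}"]) auto
qed

lemma generically_imp_generic_on:
  assumes "generically N U P" shows "generic_on N U P"
  unfolding generic_on_def
proof (intro allI impI)
  fix V assume V: "open_Cn N V \<and> V \<noteq> {} \<and> V \<subseteq> U"
  then obtain t where t: "t \<in> V" by blast
  then obtain V0 v where V0: "open_Cn N V0" "t \<in> V0" "nonzero_holomorphic N V0 v" "\<forall>u\<in>V0. v u \<noteq> 0 \<longrightarrow> P u"
    using assms V unfolding generically_def by blast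
  have "open_Cn N (V \<inter> V0)" using V V0 open_Cn_Int by blast
  then obtain V' where "open_Cn N V'" "V' \<noteq> {}" "V' \<subseteq> V \<inter> V0" "\<And>u. u \<in> V' \<Longrightarrow> v u \<noteq> 0"
    using generic_onE[OF nonzero_holomorphic_generic_on[OF V0(1,3)], of "V \<inter> V0"] t V0(2) by blast
  then show "\<exists>V'. open_Cn N V' \<and> V' \<noteq> {} \<and> V' \<subseteq> V \<and> (\<forall>u\<in>V'. P u)"
    using V0(4) by (intro exI[of _ V']) auto
qed

lemma generic_on_coordinate:
  assumes Q: "\<And>z. eventually Q (at z)" and i: "i < N"
  shows "generic_on N U (\<lambda>u. Q (u ! i))"
  unfolding generic_on_def
proof (intro allI impI)
  fix V assume V: "open_Cn N V \<and> V \<noteq> {} \<and> V \<subseteq> U"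
  then obtain t where t: "t \<in> V" by blast
  have len: "length t = N" using V t by (simp add: open_Cn_def)
  obtain r where r: "r > 0" "polydisc t r \<subseteq> V" using V t unfolding open_Cn_def by blast
  obtain e where e: "e > 0" "\<And>z. z \<noteq> t ! i \<Longrightarrow> dist z (t ! i) < e \<Longrightarrow> Q z"
    using Q[of "t ! i"] unfolding eventually_at by auto
  define s where "s = min r e"
  have s: "s > 0" "s \<le> r" "s \<le> e" using r e by (auto simp: s_def)
  define u where "u = t[i := t ! i + of_real (s / 2)]"
  have ui: "dist (t ! i) (u ! i) = s / 2" "u ! i = t ! i + of_real (s/2)" "length u = N" using i len s by (simp_all add: u_def dist_norm)
  have u: "u \<in> polydisc t (s/2 + s/8)" unfolding u_def
    by (rule polydisc_update) (use s centre_in_polydisc i len in \<open>auto simp: dist_norm\<close>)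
  show "\<exists>V'. open_Cn N V' \<and> V' \<noteq> {} \<and> V' \<subseteq> V \<and> (\<forall>u\<in>V'. Q (u ! i))"
  proof (intro exI[of _ "polydisc u (s/8)"] conjI ballI)
    show "open_Cn N (polydisc u (s/8))" using open_polydisc[of u] ui by simp
    show "polydisc u (s/8) \<noteq> {}" using s centre_in_polydisc[of "s/8" u] by auto
    show "polydisc u (s/8) \<subseteq> V"
    proof
      fix w assume "w \<in> polydisc u (s/8)"
      then have "w \<in> polydisc t (s/2 + s/8 + s/8)" by (rule polydisc_triangle[OF u])
      then show "w \<in> V" using r(2) polydisc_mono[of "s/2 + s/8 + s/8" r t] s by auto
    qed
    fix w assume "w \<in> polydisc u (s/8)"
    then have w: "dist (u ! i) (w ! i) < s/8" using i ui(3) by (simp add: polydisc_iff)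
    have "dist (t ! i) (w ! i) < s" using w ui(1) dist_triangle[of "t ! i" "w ! i" "u ! i"] s by linarith
    moreover have "w ! i \<noteq> t ! i" using w ui(1) s by (auto simp: dist_commute)
    ultimately show "Q (w ! i)" using e s by (auto simp: dist_commute)
  qed
qed

section \<open>Division by the equation of a hyperplane\<close>

lemma holomorphic_Cn_cong:
  assumes U: "open_Cn N U" and hol: "holomorphic_Cn U f" and eq: "\<And>u. u \<in> U \<Longrightarrow> f u = g u"
  shows "holomorphic_Cn U g"
proof (rule holomorphic_CnI[OF U])
  fix t assume t: "t \<in> U"
  have "eventually (\<lambda>u. f u = g u) (nhds_Cn t)"
    using eventually_nhds_Cn_open[OF U t] by eventually_elim (rule eq)
  moreover have "(f \<longlongrightarrow> g t) (nhds_Cn t)"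
    using holomorphic_Cn_tendsto[OF hol t] by (simp only: eq[OF t])
  ultimately show "(g \<longlongrightarrow> g t) (nhds_Cn t)" by (rule Lim_transform_eventually[rotated])
  fix i assume i: "i < length t"
  obtain r where r: "r > 0" "polydisc t r \<subseteq> U" using U t unfolding open_Cn_def by blast
  have inU: "t[i := z] \<in> U" if "z \<in> ball (t ! i) r" for z
    using that r by (intro subsetD[OF r(2)] polydisc_update centre_in_polydisc) auto
  have "(\<lambda>z. f (t[i := z])) holomorphic_on ball (t ! i) r" by (rule holomorphic_Cn_section_on[OF hol i inU])
  then have "(\<lambda>z. g (t[i := z])) holomorphic_on ball (t ! i) r"
    by (rule holomorphic_transform) (use inU eq in auto)
  then show "(\<lambda>z. g (t[i := z])) field_differentiable (at (t ! i))"
    by (rule holomorphic_on_imp_differentiable_at) (use r in auto)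
qed

lemma holomorphic_Cn_coordinate_difference:
  assumes U: "open_Cn N U" and "i < N" "j < N"
  shows "holomorphic_Cn U (\<lambda>u. u ! i - u ! j - c)"
proof (rule holomorphic_CnI[OF U])
  fix t assume t: "t \<in> U"
  have len: "length t = N" using U t by (simp add: open_Cn_def)
  show "((\<lambda>u. u ! i - u ! j - c) \<longlongrightarrow> t ! i - t ! j - c) (nhds_Cn t)"
    using assms len by (intro tendsto_intros tendsto_nth_Cn) auto
  fix k assume k: "k < length t"
  have "(\<lambda>z. t[k := z] ! i - t[k := z] ! j - c) =
      (\<lambda>z. (if k = i then z else t ! i) - (if k = j then z else t ! j) - c)"
    using assms len k by (auto simp: nth_list_update)
  moreover have "(\<lambda>z. (if k = i then z else t ! i) - (if k = j then z else t ! j) - c) field_differentiable (at (t ! k))"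
    by (intro field_differentiable_diff field_differentiable_const; cases "k = i"; cases "k = j")
      (auto intro: field_differentiable_const field_differentiable_ident)
  ultimately show "(\<lambda>z. t[k := z] ! i - t[k := z] ! j - c) field_differentiable (at (t ! k))" by simp
qed

text \<open>Off the hyperplane the quotient is holomorphic.  At a point of the hyperplane the sections of f that
  are transverse to it vanish there, so their difference quotients are bounded uniformly, and this
  gives local boundedness.  For separate holomorphy there are three kinds of directions: transverse to
  the hyperplane in the coordinate i or j, where a one-variable quotient appears, and parallel to it,
  where the quotient is the partial derivative of f and hence a uniform limit of difference
  quotients.\<close>

lemma hyperplane_division:
  fixes f :: "complex list \<Rightarrow> complex"
  assumes U: "open_Cn N U" and hol: "holomorphic_Cn U f" and ij: "i < N" "j < N" "i \<noteq> j"
    and zero: "\<And>u. u \<in> U \<Longrightarrow> u ! i = u ! j + c \<Longrightarrow> f u = 0"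
  obtains g where "holomorphic_Cn U g" "\<And>u. u \<in> U \<Longrightarrow> f u = (u ! i - u ! j - c) * g u"
proof
  define L where "L u = u ! i - u ! j - c" for u :: "complex list"
  define g where "g u = (if L u = 0 then deriv (\<lambda>z. f (u[i := z])) (u ! i) else f u / L u)" for u
  show "f u = (u ! i - u ! j - c) * g u" if "u \<in> U" for u
    using zero[OF that] by (auto simp: g_def L_def)
  have holL: "holomorphic_Cn U L" unfolding L_def using ij by (intro holomorphic_Cn_coordinate_difference[OF U]) auto
  define U' where "U' = {u\<in>U. L u \<noteq> 0}"
  have U': "open_Cn N U'" unfolding U'_def by (rule open_Cn_nonzero[OF U holL])
  have "holomorphic_Cn U' (\<lambda>u. f u / L u)"
    by (rule holomorphic_Cn_divide[OF U'])
      (auto simp: U'_def intro: holomorphic_Cn_subset[OF hol] holomorphic_Cn_subset[OF holL])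
  then have g': "holomorphic_Cn U' g"
    by (rule holomorphic_Cn_cong[OF U']) (auto simp: U'_def g_def)
  have local: "\<exists>R B. R > 0 \<and> polydisc t R \<subseteq> U \<and> (\<forall>u\<in>polydisc t R. norm (f u) \<le> B)" if t: "t \<in> U" for t
  proof -
    have "eventually (\<lambda>u. norm (f u) < norm (f t) + 1) (nhds_Cn t)"
      by (rule order_tendstoD(2)[OF tendsto_norm[OF holomorphic_Cn_tendsto[OF hol t]]]) simp
    then have "eventually (\<lambda>u. norm (f u) < norm (f t) + 1 \<and> u \<in> U) (nhds_Cn t)"
      using eventually_nhds_Cn_open[OF U t] by (rule eventually_conj)
    then show ?thesis unfolding eventually_nhds_Cn by (meson less_imp_le subsetI)
  qed
  have quot: "\<exists>q. q holomorphic_on ball (u ! j + c) (R/2) \<and> (\<forall>z. g (u[i := z]) = q z) \<and>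
      (\<forall>z\<in>ball (u ! j + c) (R/2). norm (q z) \<le> 4 * B / (R/2))"
    if t: "t \<in> U" "L t = 0" and R: "R > 0" "polydisc t R \<subseteq> U" "\<forall>u\<in>polydisc t R. norm (f u) \<le> B"
      and u: "u \<in> polydisc t (R/4)" for t R B u
  proof -
    have len: "length t = N" "length u = N" using U t u by (auto simp: open_Cn_def polydisc_iff)
    let ?a = "u ! j + c"
    have inP: "u[i := z] \<in> polydisc t R" if z: "z \<in> ball ?a (R/2)" for z
    proof (rule polydisc_update)
      show "u \<in> polydisc t R" using u polydisc_mono[of "R/4" R t] R by auto
      have "dist (t ! i) ?a = dist (t ! j) (u ! j)" using t(2) by (simp add: L_def dist_norm algebra_simps)
      also have "\<dots> < R/4" using u ij len by (simp add: polydisc_iff)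
      finally show "dist (t ! i) z < R" using z dist_triangle[of "t ! i" z ?a] R by auto
    qed
    let ?\<psi> = "\<lambda>z. f (u[i := z])"
    have h: "?\<psi> holomorphic_on ball ?a (R/2)"
      by (rule holomorphic_Cn_section_on[OF hol]) (use inP R ij len in auto)
    have hB: "norm (?\<psi> z) \<le> B" if "z \<in> ball ?a (R/2)" for z using inP[OF that] R(3) by blast
    have hR: "R/2 > 0" using R(1) by simp
    obtain q where q: "q holomorphic_on ball ?a (R/2)" "\<And>z. ?\<psi> z = ?\<psi> ?a + (z - ?a) * q z" "q ?a = deriv ?\<psi> ?a"
      "\<And>z. z \<in> ball ?a (R/2) \<Longrightarrow> norm (q z) \<le> 4 * B / (R/2)"
      using bounded_difference_quotient[OF h hR hB] by metis
    have "?\<psi> ?a = 0" by (rule zero) (use inP[of ?a] R ij len in auto)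
    then have fq: "f (u[i := z]) = (z - u ! j - c) * q z" for z
      using q(2)[of z] by (simp only: add_0 diff_diff_eq)
    have "g (u[i := z]) = q z" for z
    proof (cases "z = ?a")
      case True then show ?thesis using q(3) ij len by (simp add: g_def L_def)
    next
      case False
      then have "z - u ! j - c \<noteq> 0" by (simp add: diff_diff_eq)
      then show ?thesis using fq[of z] ij len by (simp add: g_def L_def)
    qed
    then show ?thesis using q by blast
  qed
  show "holomorphic_Cn U g"
  proof (rule Osgood[OF U])
    fix t assume t: "t \<in> U"
    show "\<exists>B. eventually (\<lambda>u. norm (g u) \<le> B) (nhds_Cn t)"
    proof (cases "L t = 0")
      case False
      then have "t \<in> U'" using t by (simp add: U'_def)
      have "eventually (\<lambda>u. norm (g u) < norm (g t) + 1) (nhds_Cn t)"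
        by (rule order_tendstoD(2)[OF tendsto_norm[OF holomorphic_Cn_tendsto[OF g' \<open>t \<in> U'\<close>]]]) simp
      then show ?thesis by (intro exI[of _ "norm (g t) + 1"]) (auto elim: eventually_mono)
    next
      case True
      obtain R B where R: "R > 0" "polydisc t R \<subseteq> U" "\<forall>u\<in>polydisc t R. norm (f u) \<le> B" using local[OF t] by blast
      have "norm (g u) \<le> 4 * B / (R/2)" if u: "u \<in> polydisc t (R/4)" for u
      proof -
        obtain q where q: "\<forall>z. g (u[i := z]) = q z" "\<forall>z\<in>ball (u ! j + c) (R/2). norm (q z) \<le> 4 * B / (R/2)"
          using quot[OF t True R u] by blast
        have len: "length t = N" using U t by (auto simp: open_Cn_def)
        have "dist (t ! i) (u ! j + c) = dist (t ! j) (u ! j)" using True by (simp add: L_def dist_norm algebra_simps)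
        moreover have "dist (t ! j) (u ! j) < R/4" "dist (t ! i) (u ! i) < R/4" using u ij len by (simp_all add: polydisc_iff)
        ultimately have "u ! i \<in> ball (u ! j + c) (R/2)"
          using dist_triangle2[of "u ! j + c" "u ! i" "t ! i"] by (simp add: dist_commute)
        then have "norm (q (u ! i)) \<le> 4 * B / (R/2)" using q by blast
        then show ?thesis using q(1)[rule_format, of "u ! i"] by simp
      qed
      then show ?thesis using R(1) unfolding eventually_nhds_Cn by (intro exI[of _ "4 * B / (R/2)"] exI[of _ "R/4"]) auto
    qed
  next
    show "separately_holomorphic U g"
      unfolding separately_holomorphic_def
    proof (intro ballI allI impI)
      fix t k assume t: "t \<in> U" and k: "k < length t"
      have len: "length t = N" using U t by (auto simp: open_Cn_def)
      show "(\<lambda>z. g (t[k := z])) field_differentiable (at (t ! k))"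
      proof (cases "L t = 0")
        case False
        then show ?thesis using holomorphic_Cn_section[OF g' _ k] t by (simp add: U'_def)
      next
        case True
        then have ti: "t ! i = t ! j + c" by (simp add: L_def algebra_simps)
        obtain R B where R: "R > 0" "polydisc t R \<subseteq> U" "\<forall>u\<in>polydisc t R. norm (f u) \<le> B" using local[OF t] by blast
        have tP: "t \<in> polydisc t r" if "r > 0" for r using that by (rule centre_in_polydisc)
        consider "k = i" | "k = j" | "k \<noteq> i" "k \<noteq> j" by blast
        then show ?thesis
        proof cases
          case 1
          have tP4: "t \<in> polydisc t (R/4)" using R(1) by (intro tP) simp
          obtain q where q: "q holomorphic_on ball (t ! j + c) (R/2)" "\<forall>z. g (t[i := z]) = q z"
            using quot[OF t True R tP4] by blast
          have "q field_differentiable (at (t ! i))"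
            by (rule holomorphic_on_imp_differentiable_at[OF q(1)]) (use R ti in auto)
          then show ?thesis using q(2) 1 by simp
        next
          case 2
          let ?\<psi> = "\<lambda>z. f (t[j := z])"
          have inP: "t[j := z] \<in> polydisc t R" if "z \<in> ball (t ! j) R" for z
            using that R by (auto intro!: polydisc_update tP)
          have h: "?\<psi> holomorphic_on ball (t ! j) R"
            by (rule holomorphic_Cn_section_on[OF hol]) (use inP R ij len in auto)
          have hB: "norm (?\<psi> z) \<le> B" if "z \<in> ball (t ! j) R" for z using inP[OF that] R(3) by blast
          obtain q where q: "q holomorphic_on ball (t ! j) R" "\<And>z. ?\<psi> z = ?\<psi> (t ! j) + (z - t ! j) * q z" "q (t ! j) = deriv ?\<psi> (t ! j)"
            using bounded_difference_quotient[OF h R(1) hB] by metis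
          \<comment> \<open>f vanishes along the hyperplane, so its two partial derivatives at t are opposite.\<close>
          obtain D where D: "\<And>d. length d = length t \<Longrightarrow>
             ((\<lambda>z. f (line_Cn t d z)) has_field_derivative (\<Sum>i<length t. D i * d ! i)) (at 0)"
            using holomorphic_Cn_line[OF hol t] by blast
          have partial: "((\<lambda>z. f (t[m := z])) has_field_derivative D m) (at (t ! m))" if m: "m < length t" for m
          proof -
            let ?e = "(replicate (length t) 0)[m := 1 :: complex]"
            have "(\<Sum>i<length t. D i * ?e ! i) = (\<Sum>i<length t. if i = m then D i else 0)"
              by (intro sum.cong) (auto simp: nth_list_update)
            then have "((\<lambda>z. f (line_Cn t ?e z)) has_field_derivative D m) (at 0)" using D[of ?e] m by simp
            then have "((\<lambda>z. f (line_Cn t ?e z)) has_field_derivative D m) (at (t ! m - t ! m))" by simp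
            then have "((\<lambda>z. f (line_Cn t ?e (z - t ! m))) has_field_derivative D m) (at (t ! m))"
              using DERIV_shift[of "\<lambda>z. f (line_Cn t ?e (z - t ! m))" "D m" 0 "t ! m"] by simp
            then show ?thesis by (simp only: update_as_line_Cn[OF m])
          qed
          let ?d = "(replicate (length t) 0)[i := 1 :: complex, j := 1]"
          have "(\<Sum>m<length t. D m * ?d ! m) = (\<Sum>m<length t. (if m = i then D m else 0) + (if m = j then D m else 0))"
            using ij by (intro sum.cong) (auto simp: nth_list_update)
          also have "\<dots> = D i + D j" using ij len by (simp add: sum.distrib)
          finally have d1: "((\<lambda>z. f (line_Cn t ?d z)) has_field_derivative D i + D j) (at 0)" using D[of ?d] by simp
          have z0: "f (line_Cn t ?d z) = 0" if z: "z \<in> ball 0 R" for z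
          proof (rule zero)
            have "dist (t ! m) (line_Cn t ?d z ! m) < R" if "m < length t" for m
              using that z R(1) ij by (cases "m = i"; cases "m = j") (simp_all add: dist_norm)
            then show "line_Cn t ?d z \<in> U" by (intro subsetD[OF R(2)]) (auto simp: polydisc_iff)
            show "line_Cn t ?d z ! i = line_Cn t ?d z ! j + c" using ij len ti by (simp add: nth_list_update)
          qed
          have "((\<lambda>z. f (line_Cn t ?d z)) has_field_derivative 0) (at 0)"
            by (rule has_field_derivative_transform_within_open[of "\<lambda>_. 0" _ _ "ball 0 R"]) (use R z0 in auto)
          then have DD: "D i + D j = 0" using d1 DERIV_unique by blast
          have "deriv (\<lambda>z. f (t[i := z])) (t ! i) = - deriv ?\<psi> (t ! j)"
            using DERIV_imp_deriv[OF partial[of i]] DERIV_imp_deriv[OF partial[of j]] ij len DD by (simp add: add_eq_0_iff2)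
          then have g0: "g t = - q (t ! j)" using q(3) True by (simp add: g_def)
          have "?\<psi> (t ! j) = 0" using zero[OF t ti] by simp
          then have fq: "f (t[j := z]) = (z - t ! j) * q z" for z
            using q(2)[of z] by (simp only: add_0)
          have "g (t[j := z]) = - q z" for z
          proof (cases "z = t ! j")
            case True then show ?thesis using g0 by simp
          next
            case False
            have "L (t[j := z]) = - (z - t ! j)" using ij len ti by (simp add: L_def)
            then have "g (t[j := z]) = f (t[j := z]) / (- (z - t ! j))" using False by (simp add: g_def)
            moreover have "z - t ! j \<noteq> 0" using False by simp
            ultimately show ?thesis by (simp only: fq divide_minus_right nonzero_mult_div_cancel_left simp_thms)
          qed
          moreover have "(\<lambda>z. - q z) field_differentiable (at (t ! j))"
            by (intro field_differentiable_minus holomorphic_on_imp_differentiable_at[OF q(1)]) (use R in auto)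
          ultimately show ?thesis using 2 by simp
        next
          case 3
          let ?F = "\<lambda>e z. f (t[k := z, i := t ! i + e]) / e"
          have inP: "t[k := z, i := w] \<in> polydisc t R" if "z \<in> ball (t ! k) R" "w \<in> ball (t ! i) R" for z w
            using that R by (auto intro!: polydisc_update tP)
          have est: "norm (?F e z - g (t[k := z])) \<le> 16 * B / R\<^sup>2 * norm e"
            if e: "e \<in> ball 0 R" "e \<noteq> 0" and z: "z \<in> ball (t ! k) R" for e z
          proof -
            let ?\<psi> = "\<lambda>w. f (t[k := z, i := w])"
            have h: "?\<psi> holomorphic_on ball (t ! i) R"
              by (rule holomorphic_Cn_section_on[OF hol]) (use inP R ij z len in auto)
            have "norm (?\<psi> (t ! i + e) - ?\<psi> (t ! i) - deriv ?\<psi> (t ! i) * (t ! i + e - t ! i)) \<le> 16 * B / R\<^sup>2 * (norm (t ! i + e - t ! i))\<^sup>2"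
              by (rule bounded_second_order[OF h]) (use R inP z e in \<open>auto simp: dist_norm\<close>)
            moreover have "?\<psi> (t ! i) = 0"
              by (rule zero) (use inP[OF z, of "t ! i"] R ij len ti 3 in \<open>auto simp: nth_list_update\<close>)
            moreover have "g (t[k := z]) = deriv ?\<psi> (t ! i)" using 3 ti ij len by (simp add: g_def L_def)
            ultimately have "norm (?\<psi> (t ! i + e) - g (t[k := z]) * e) \<le> 16 * B / R\<^sup>2 * norm e * norm e"
              by (simp add: power2_eq_square mult_ac)
            moreover have "?\<psi> (t ! i + e) - g (t[k := z]) * e = (?F e z - g (t[k := z])) * e" using e by (simp add: field_simps)
            ultimately have "norm (?F e z - g (t[k := z])) * norm e \<le> (16 * B / R\<^sup>2 * norm e) * norm e"
              by (simp only: norm_mult)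
            then show ?thesis by (rule mult_right_le_imp_le) (use e in simp)
          qed
          have "(\<lambda>z. g (t[k := z])) holomorphic_on ball (t ! k) (R/2)"
          proof (rule holomorphic_uniform_limit[where f = ?F and F = "at 0"])
            have "\<forall>\<^sub>F e in at (0::complex). e \<in> ball 0 R"
              using R by (auto simp: eventually_at dist_commute intro!: exI[of _ R])
            then show "\<forall>\<^sub>F e in at 0. continuous_on (cball (t ! k) (R/2)) (?F e) \<and> ?F e holomorphic_on ball (t ! k) (R/2)"
            proof eventually_elim
              case (elim e)
              have "(\<lambda>z. f (t[k := z, i := t ! i + e])) = (\<lambda>z. f ((t[i := t ! i + e])[k := z]))"
                using 3 by (simp add: list_update_swap)
              moreover have "(\<lambda>z. f ((t[i := t ! i + e])[k := z])) holomorphic_on ball (t ! k) R"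
              proof (rule holomorphic_Cn_section_on[OF hol])
                show "k < length (t[i := t ! i + e])" using k by simp
                fix z assume "z \<in> ball (t ! k) R"
                then have "t[k := z, i := t ! i + e] \<in> polydisc t R"
                  by (rule inP) (use elim in \<open>simp add: dist_norm\<close>)
                then show "t[i := t ! i + e, k := z] \<in> U"
                  using R(2) list_update_swap[OF 3(1), of t z "t ! i + e"] by auto
              qed
              ultimately have h: "?F e holomorphic_on ball (t ! k) R"
                by (cases "e = 0") (auto intro!: holomorphic_on_divide holomorphic_on_const)
              then show ?case
                using R by (auto intro!: holomorphic_on_imp_continuous_on intro: holomorphic_on_subset[OF h])
            qed
            show "uniform_limit (cball (t ! k) (R/2)) ?F (\<lambda>z. g (t[k := z])) (at 0)"
              unfolding uniform_limit_iff
            proof (intro allI impI)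
              fix s :: real assume s: "s > 0"
              have "((\<lambda>e::complex. 16 * B / R\<^sup>2 * norm e) \<longlongrightarrow> 16 * B / R\<^sup>2 * norm (0::complex)) (at 0)"
                by (intro tendsto_mult_left tendsto_norm[OF tendsto_ident_at])
              then have "\<forall>\<^sub>F e in at (0::complex). 16 * B / R\<^sup>2 * norm e < s"
                by (rule order_tendstoD(2)) (use s in simp)
              moreover have "\<forall>\<^sub>F e in at (0::complex). e \<in> ball 0 R \<and> e \<noteq> 0"
                using R by (auto simp: eventually_at dist_commute intro!: exI[of _ R])
              ultimately show "\<forall>\<^sub>F e in at 0. \<forall>z\<in>cball (t ! k) (R/2). dist (?F e z) (g (t[k := z])) < s"
              proof eventually_elim
                case (elim e)
                show ?case
                proof
                  fix z assume "z \<in> cball (t ! k) (R/2)"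
                  then have z: "z \<in> ball (t ! k) R" using R(1) by auto
                  have "norm (?F e z - g (t[k := z])) \<le> 16 * B / R\<^sup>2 * norm e" by (rule est) (use elim z in auto)
                  then show "dist (?F e z) (g (t[k := z])) < s" using elim by (simp only: dist_norm)
                qed
              qed
            qed
          qed auto
          then show ?thesis by (rule holomorphic_on_imp_differentiable_at) (use R in auto)
        qed
      qed
    qed
  qed
qed

text \<open>If the equation of the hyperplane could be divided out without end, a section of v that is not
  identically zero would have a zero of infinite order.\<close>

lemma holomorphic_Cn_factor_hyperplane:
  fixes v :: "complex list \<Rightarrow> complex"
  assumes hol: "holomorphic_Cn (polydisc t R) v" and ij: "i < length t" "j < length t" "i \<noteq> j"
    and tH: "t ! i = t ! j + c" and u: "u \<in> polydisc t R" "v u \<noteq> 0"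
  obtains m w where "holomorphic_Cn (polydisc t R) w"
    "\<And>u. u \<in> polydisc t R \<Longrightarrow> v u = (u ! i - u ! j - c) ^ m * w u"
    "\<exists>u\<in>polydisc t R. u ! i = u ! j + c \<and> w u \<noteq> 0"
proof -
  define Q where "Q m \<longleftrightarrow> (\<exists>w. holomorphic_Cn (polydisc t R) w \<and>
     (\<forall>u\<in>polydisc t R. v u = (u ! i - u ! j - c) ^ m * w u))" for m
  have Q0: "Q 0" using hol by (auto simp: Q_def)
  have notall: "\<not> (\<forall>m. Q m)"
  proof
    assume all: "\<forall>m. Q m"
    have len: "length u = length t" using u by (simp add: polydisc_iff)
    let ?a = "u ! j + c" and ?\<psi> = "\<lambda>z. v (u[i := z])" and ?A = "ball (t ! i) R"
    have inP: "u[i := z] \<in> polydisc t R" if "z \<in> ?A" for z using that u by (auto intro: polydisc_update)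
    have uj: "u[i := z] ! j = u ! j" for z using ij by simp
    have R: "R > 0" using u ij by (metis polydisc_iff dist_not_less_zero linorder_not_le order_less_le_trans)
    have "dist (t ! i) ?a = dist (t ! j) (u ! j)" using tH by (simp add: dist_norm algebra_simps)
    then have a: "?a \<in> ?A" using u ij by (simp add: polydisc_iff)
    have h: "?\<psi> holomorphic_on ?A" by (rule holomorphic_Cn_section_on[OF hol]) (use inP ij len in auto)
    have ui: "u ! i \<in> ?A" using u ij by (simp add: polydisc_iff)
    have \<psi>u: "?\<psi> (u ! i) \<noteq> 0" using u by simp
    have fac: "\<exists>w. w holomorphic_on ?A \<and> (\<forall>z\<in>?A. ?\<psi> z = (z - ?a) ^ m * w z)" for m
    proof -
      obtain w where w: "holomorphic_Cn (polydisc t R) w"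
        "\<And>u. u \<in> polydisc t R \<Longrightarrow> v u = (u ! i - u ! j - c) ^ m * w u"
        using all unfolding Q_def by blast
      have "(\<lambda>z. w (u[i := z])) holomorphic_on ?A"
        by (rule holomorphic_Cn_section_on[OF w(1)]) (use inP ij len in auto)
      moreover have "?\<psi> z = (z - ?a) ^ m * w (u[i := z])" if "z \<in> ?A" for z
        using w(2)[OF inP[OF that]] ij len by (simp add: diff_diff_eq)
      ultimately show ?thesis by blast
    qed
    have "?\<psi> ?a = 0" using fac[of 1] a by auto
    moreover have "\<not> ?\<psi> constant_on ?A" using calculation \<psi>u a ui unfolding constant_on_def by metis
    ultimately obtain g r n where g: "0 < r" "ball ?a r \<subseteq> ?A" "g holomorphic_on ball ?a r"
      "\<And>w. w \<in> ball ?a r \<Longrightarrow> ?\<psi> w = (w - ?a) ^ n * g w" "\<And>w. w \<in> ball ?a r \<Longrightarrow> g w \<noteq> 0"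
      using holomorphic_factor_zero_nonconstant[OF h open_ball connected_ball a] by metis
    obtain w where w: "w holomorphic_on ?A" "\<And>z. z \<in> ?A \<Longrightarrow> ?\<psi> z = (z - ?a) ^ (Suc n) * w z"
      using fac[of "Suc n"] by blast
    have eq: "g z = (z - ?a) * w z" if "z \<in> ball ?a r" "z \<noteq> ?a" for z
      using g(4)[OF that(1)] w(2)[of z] g(2) that by auto
    have "isCont g ?a" using g(1,3) by (intro continuous_on_interior[OF holomorphic_on_imp_continuous_on]) auto
    moreover have "isCont w ?a" using a w(1) by (intro continuous_on_interior[OF holomorphic_on_imp_continuous_on]) auto
    then have "((\<lambda>z. (z - ?a) * w z) \<longlongrightarrow> (?a - ?a) * w ?a) (at ?a)"
      unfolding isCont_def by (intro tendsto_intros)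
    moreover have "\<forall>\<^sub>F z in at ?a. (z - ?a) * w z = g z"
      using g(1) eq by (auto simp: eventually_at dist_commute intro!: exI[of _ r])
    ultimately have "(g \<longlongrightarrow> g ?a) (at ?a)" "(g \<longlongrightarrow> (?a - ?a) * w ?a) (at ?a)"
      unfolding isCont_def by (blast intro: Lim_transform_eventually)+
    then have "g ?a = 0" using LIM_unique by fastforce
    then show False using g(5)[of ?a] g(1) by simp
  qed
  obtain m where m: "Q m" "\<not> Q (Suc m)" using notall Q0 by (metis nat_induct)
  obtain w where w: "holomorphic_Cn (polydisc t R) w"
    "\<And>u. u \<in> polydisc t R \<Longrightarrow> v u = (u ! i - u ! j - c) ^ m * w u"
    using m(1) unfolding Q_def by blast
  have "\<exists>u\<in>polydisc t R. u ! i = u ! j + c \<and> w u \<noteq> 0"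
  proof (rule ccontr)
    assume "\<not> ?thesis"
    then have z: "w u = 0" if "u \<in> polydisc t R" "u ! i = u ! j + c" for u using that by blast
    obtain w' where w': "holomorphic_Cn (polydisc t R) w'" "\<And>u. u \<in> polydisc t R \<Longrightarrow> w u = (u ! i - u ! j - c) * w' u"
      using hyperplane_division[OF open_polydisc w(1) ij z] by metis
    have "Q (Suc m)" unfolding Q_def using w' w(2) by (intro exI[of _ w']) auto
    then show False using m by blast
  qed
  then show thesis using that w by blast
qed

lemma nonzero_holomorphic_coordinate_difference:
  assumes U: "open_Cn N U" and ij: "i < N" "j < N" "i \<noteq> j"
  shows "nonzero_holomorphic N U (\<lambda>u. u ! i - u ! j - c)"
  unfolding nonzero_holomorphic_def
proof (intro conjI allI impI)
  show "holomorphic_Cn U (\<lambda>u. u ! i - u ! j - c)" by (rule holomorphic_Cn_coordinate_difference[OF U ij(1,2)])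
  fix V assume V: "open_Cn N V \<and> V \<noteq> {} \<and> V \<subseteq> U"
  then obtain b where b: "b \<in> V" by blast
  obtain r where r: "r > 0" "polydisc b r \<subseteq> V" using V b unfolding open_Cn_def by blast
  have len: "length b = N" using V b by (simp add: open_Cn_def)
  let ?b = "b[i := b ! i + of_real (r / 2)]"
  have "?b \<in> V"
    using r by (intro subsetD[OF r(2)] polydisc_update centre_in_polydisc) (auto simp: dist_norm)
  moreover have "?b ! i - ?b ! j - c = (b ! i - b ! j - c) + of_real (r / 2)" using ij len by simp
  then have "b ! i - b ! j - c \<noteq> 0 \<or> ?b ! i - ?b ! j - c \<noteq> 0" using r by auto
  ultimately show "\<exists>t\<in>V. t ! i - t ! j - c \<noteq> 0" using b by blast
qed

text \<open>On a circle around the point u, in a coordinate transverse to the hyperplane, the linear form that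
  defines the hyperplane has constant modulus.  Uniform convergence therefore survives the division on this circle, and Cauchy's
  inequality brings it to the centre.\<close>

lemma has_sum_quotient_hyperplane:
  fixes W W' :: "'x \<Rightarrow> complex list \<Rightarrow> complex"
  assumes ij: "i < length t" "j < length t" "i \<noteq> j" and u: "u \<in> polydisc t R" "u ! i = u ! j + c"
    and hol: "\<And>x. x \<in> C \<Longrightarrow> holomorphic_Cn (polydisc t R) (W' x)" "holomorphic_Cn (polydisc t R) S'"
    and W: "\<And>x u. x \<in> C \<Longrightarrow> u \<in> polydisc t R \<Longrightarrow> W x u = (u ! i - u ! j - c) ^ k * W' x u"
    and S: "\<And>u. u \<in> polydisc t R \<Longrightarrow> S u = (u ! i - u ! j - c) ^ k * S' u"
    and lim: "uniform_limit (polydisc t R) (\<lambda>X u. \<Sum>x\<in>X. W x u) S (finite_subsets_at_top C)"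
  shows "((\<lambda>x. W' x u) has_sum S' u) C"
  unfolding has_sum_def tendsto_iff
proof (intro allI impI)
  fix e :: real assume e: "e > 0"
  have len: "length u = length t" using u by (simp add: polydisc_iff)
  obtain r where r: "r > 0" "polydisc u r \<subseteq> polydisc t R"
    using open_polydisc[of t R] u unfolding open_Cn_def by blast
  define \<rho> where "\<rho> = r / 2"
  have \<rho>: "\<rho> > 0" "\<rho> < r" using r by (auto simp: \<rho>_def)
  have inP: "u[i := z] \<in> polydisc t R" if "z \<in> ball (u ! i) r" for z
    using that r by (intro subsetD[OF r(2)] polydisc_update centre_in_polydisc) auto
  have "\<forall>\<^sub>F X in finite_subsets_at_top C. \<forall>u\<in>polydisc t R. dist (\<Sum>x\<in>X. W x u) (S u) < \<rho> ^ k * (e / 2)"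
    by (rule lim[unfolded uniform_limit_iff, rule_format]) (use e \<rho> in simp)
  moreover have "\<forall>\<^sub>F X in finite_subsets_at_top C. finite X \<and> X \<subseteq> C" by (rule eventually_finite_subsets_at_top_weakI) auto
  ultimately show "\<forall>\<^sub>F X in finite_subsets_at_top C. dist (\<Sum>x\<in>X. W' x u) (S' u) < e"
  proof eventually_elim
    case (elim X)
    let ?E = "\<lambda>z. (\<Sum>x\<in>X. W' x (u[i := z])) - S' (u[i := z])"
    have h: "?E holomorphic_on ball (u ! i) r"
      by (intro holomorphic_on_diff holomorphic_on_sum holomorphic_Cn_section_on[OF hol(1)] holomorphic_Cn_section_on[OF hol(2)])
        (use elim inP ij len in auto)
    have circ: "norm (?E z) \<le> e / 2" if z: "norm (u ! i - z) = \<rho>" for z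
    proof -
      have zP: "u[i := z] \<in> polydisc t R" using z \<rho> by (intro inP) (simp add: dist_norm)
      have L: "u[i := z] ! i - u[i := z] ! j - c = z - u ! i" using ij len u(2) by simp
      have "(\<Sum>x\<in>X. W x (u[i := z])) - S (u[i := z]) = (z - u ! i) ^ k * ?E z"
        using elim zP W S by (simp add: L sum_distrib_left right_diff_distrib subset_iff)
      then have "\<rho> ^ k * norm (?E z) = dist (\<Sum>x\<in>X. W x (u[i := z])) (S (u[i := z]))"
        using z by (simp add: dist_norm norm_mult norm_power norm_minus_commute)
      also have "\<dots> \<le> \<rho> ^ k * (e / 2)" using elim zP by (intro less_imp_le) blast
      finally show ?thesis using \<rho> by simp
    qed
    have "norm ((deriv ^^ 0) ?E (u ! i)) \<le> fact 0 * (e / 2) / \<rho> ^ 0"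
      by (rule Cauchy_inequality[OF holomorphic_on_subset[OF h] _ \<rho>(1) circ])
        (use \<rho> in \<open>auto intro!: holomorphic_on_imp_continuous_on holomorphic_on_subset[OF h]\<close>)
    then show ?case using e by (simp add: dist_norm)
  qed
qed

text \<open>A term W = v w can vanish to a lower order than v only at points where w is singular.  The points of
  the hyperplane at which w has a limit are dense, so the terms can be divided by the equation as
  often as v, one factor at a time; the sum then vanishes on the hyperplane because each term does,
  and can be divided along with them.\<close>

lemma divide_series_hyperplane:
  fixes W w :: "'x \<Rightarrow> complex list \<Rightarrow> complex" and t :: "complex list" and R :: real and i j :: nat and c :: complex
  defines "P \<equiv> polydisc t R" and "L \<equiv> \<lambda>u. u ! i - u ! j - c"
  assumes ij: "i < length t" "j < length t" "i \<noteq> j"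
    and v: "holomorphic_Cn P v'" "\<And>u. u \<in> P \<Longrightarrow> v u = L u ^ m * v' u"
    and W: "\<And>x. x \<in> C \<Longrightarrow> holomorphic_Cn P (W x)"
      "\<And>x. x \<in> C \<Longrightarrow> generic_on (length t) P (\<lambda>u. W x u = v u * w x u)"
    and dense: "\<And>x u e. x \<in> C \<Longrightarrow> u \<in> P \<Longrightarrow> L u = 0 \<Longrightarrow> e > 0 \<Longrightarrow>
       \<exists>u'\<in>P. u' \<in> polydisc u e \<and> L u' = 0 \<and> (w x \<longlongrightarrow> w x u') (nhds_Cn u')"
    and S: "holomorphic_Cn P S" and lim: "uniform_limit P (\<lambda>X u. \<Sum>x\<in>X. W x u) S (finite_subsets_at_top C)"
  obtains W' S' where "\<And>x. x \<in> C \<Longrightarrow> holomorphic_Cn P (W' x)" "holomorphic_Cn P S'"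
    "\<And>u. u \<in> P \<Longrightarrow> S u = L u ^ m * S' u"
    "\<And>u. u \<in> P \<Longrightarrow> L u = 0 \<Longrightarrow> ((\<lambda>x. W' x u) has_sum S' u) C"
    "\<And>x u. x \<in> C \<Longrightarrow> u \<in> P \<Longrightarrow> L u = 0 \<Longrightarrow> (w x \<longlongrightarrow> w x u) (nhds_Cn u) \<Longrightarrow> W' x u = v' u * w x u"
proof -
  have P: "open_Cn (length t) P" unfolding P_def by (rule open_polydisc)
  have holL: "holomorphic_Cn P L" unfolding L_def by (rule holomorphic_Cn_coordinate_difference[OF P ij(1,2)])
  have genL: "generic_on (length t) P (\<lambda>u. L u \<noteq> 0)"
    unfolding L_def by (rule nonzero_holomorphic_generic_on[OF P nonzero_holomorphic_coordinate_difference[OF P ij]])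
  have factor_value: "Wk u = L u ^ (m - k) * v' u * w x u"
    if x: "x \<in> C" and k: "k \<le> m" and Wk: "holomorphic_Cn P Wk" "\<And>u. u \<in> P \<Longrightarrow> W x u = L u ^ k * Wk u"
      and u: "u \<in> P" "L u = 0" "(w x \<longlongrightarrow> w x u) (nhds_Cn u)" for x k Wk u
  proof (rule frequently_eq_limit)
    show "(Wk \<longlongrightarrow> Wk u) (nhds_Cn u)" by (rule holomorphic_Cn_tendsto[OF Wk(1) u(1)])
    show "((\<lambda>u. L u ^ (m - k) * v' u * w x u) \<longlongrightarrow> L u ^ (m - k) * v' u * w x u) (nhds_Cn u)"
      by (intro tendsto_intros holomorphic_Cn_tendsto[OF holL u(1)] holomorphic_Cn_tendsto[OF v(1) u(1)] u(3))
    have "generic_on (length t) P (\<lambda>u. Wk u = L u ^ (m - k) * v' u * w x u)"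
    proof (rule generic_on_mono[OF generic_on_conj[OF W(2)[OF x] genL]])
      fix u assume u: "u \<in> P" "W x u = v u * w x u \<and> L u \<noteq> 0"
      have "L u ^ k * Wk u = L u ^ k * (L u ^ (m - k) * v' u * w x u)"
        using u Wk(2)[OF u(1)] v(2)[OF u(1)] k by (simp add: power_add[symmetric] mult.assoc[symmetric])
      then show "Wk u = L u ^ (m - k) * v' u * w x u" using u by simp
    qed
    then show "\<exists>\<^sub>F u in nhds_Cn u. Wk u = L u ^ (m - k) * v' u * w x u"
      by (rule generic_on_frequently[OF _ P u(1)])
  qed
  have vanish: "Wk u = 0"
    if x: "x \<in> C" and k: "k < m" and Wk: "holomorphic_Cn P Wk" "\<And>u. u \<in> P \<Longrightarrow> W x u = L u ^ k * Wk u"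
      and u: "u \<in> P" "L u = 0" for x k Wk u
  proof (rule ccontr)
    assume "Wk u \<noteq> 0"
    then have "eventually (\<lambda>u. Wk u \<noteq> 0) (nhds_Cn u)"
      by (rule tendsto_imp_eventually_ne[OF holomorphic_Cn_tendsto[OF Wk(1) u(1)]])
    then obtain e where e: "e > 0" "\<forall>u'\<in>polydisc u e. Wk u' \<noteq> 0" unfolding eventually_nhds_Cn by blast
    obtain u' where u': "u' \<in> P" "u' \<in> polydisc u e" "L u' = 0" "(w x \<longlongrightarrow> w x u') (nhds_Cn u')"
      using dense[OF x u e(1)] by blast
    have "Wk u' = L u' ^ (m - k) * v' u' * w x u'"
      by (rule factor_value[OF x _ Wk u'(1,3,4)]) (use k in auto)
    moreover have "L u' ^ (m - k) = 0" using u'(3) k by simp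
    ultimately have "Wk u' = 0" by simp
    then show False using u'(2) e(2) by blast
  qed
  have "k \<le> m \<Longrightarrow> \<exists>W' S'. (\<forall>x\<in>C. holomorphic_Cn P (W' x) \<and> (\<forall>u\<in>P. W x u = L u ^ k * W' x u)) \<and>
     holomorphic_Cn P S' \<and> (\<forall>u\<in>P. S u = L u ^ k * S' u)" for k
  proof (induction k)
    case 0
    show ?case using W(1) S by (intro exI[of _ W] exI[of _ S]) auto
  next
    case (Suc k)
    then obtain W1 S1 where W1: "\<And>x. x \<in> C \<Longrightarrow> holomorphic_Cn P (W1 x)"
      "\<And>x u. x \<in> C \<Longrightarrow> u \<in> P \<Longrightarrow> W x u = L u ^ k * W1 x u"
      and S1: "holomorphic_Cn P S1" "\<And>u. u \<in> P \<Longrightarrow> S u = L u ^ k * S1 u" 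
      using Suc_leD by blast
    have W10: "W1 x u = 0" if "x \<in> C" "u \<in> P" "L u = 0" for x u
      by (rule vanish[OF that(1) _ W1(1) W1(2) that(2,3)]) (use Suc that in auto)
    have S10: "S1 u = 0" if u: "u \<in> P" "L u = 0" for u
    proof -
      have "((\<lambda>x. W1 x u) has_sum S1 u) C"
        by (rule has_sum_quotient_hyperplane[OF ij, of u R c C W1 S1 W k S])
          (use u W1 S1 lim in \<open>auto simp: P_def L_def diff_diff_eq\<close>)
      moreover have "((\<lambda>x. W1 x u) has_sum 0) C" using W10 u by (intro has_sum_0) auto
      ultimately show ?thesis using has_sum_unique by blast
    qed
    have "\<exists>g. holomorphic_Cn P g \<and> (\<forall>u\<in>P. W1 x u = L u * g u)" if x: "x \<in> C" for x
      using hyperplane_division[OF P W1(1)[OF x] ij, of c] W10[OF x] unfolding L_def by (metis add_diff_cancel_left' diff_self)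
    then obtain W2 where W2: "\<And>x. x \<in> C \<Longrightarrow> holomorphic_Cn P (W2 x) \<and> (\<forall>u\<in>P. W1 x u = L u * W2 x u)" by metis
    obtain S2 where S2: "holomorphic_Cn P S2" "\<And>u. u \<in> P \<Longrightarrow> S1 u = L u * S2 u"
      using hyperplane_division[OF P S1(1) ij, of c] S10 unfolding L_def by (metis add_diff_cancel_left' diff_self)
    show ?case using W1(2) W2 S1(2) S2 by (intro exI[of _ W2] exI[of _ S2]) (auto simp: mult_ac)
  qed
  from this[of m] obtain W' S' where W': "\<And>x. x \<in> C \<Longrightarrow> holomorphic_Cn P (W' x)"
      "\<And>x u. x \<in> C \<Longrightarrow> u \<in> P \<Longrightarrow> W x u = L u ^ m * W' x u"
    and S': "holomorphic_Cn P S'" "\<And>u. u \<in> P \<Longrightarrow> S u = L u ^ m * S' u" by blast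
  show thesis
  proof (rule that[OF W'(1) S'])
    show "((\<lambda>x. W' x u) has_sum S' u) C" if "u \<in> P" "L u = 0" for u
      by (rule has_sum_quotient_hyperplane[OF ij, of u R c C W' S' W m S])
          (use that W' S' lim in \<open>auto simp: P_def L_def diff_diff_eq\<close>)
    show "W' x u = v' u * w x u" if "x \<in> C" "u \<in> P" "L u = 0" "(w x \<longlongrightarrow> w x u) (nhds_Cn u)" for x u
      using factor_value[OF that(1) order_refl W'(1) W'(2) that(2-)] that by simp
  qed auto
qed

section \<open>Trigonometric identities behind the fusion of L-operators\<close>

definition A_coeff :: "complex \<Rightarrow> complex \<Rightarrow> complex \<Rightarrow> complex \<Rightarrow> complex" where
  "A_coeff \<eta> l x n = sinh (x + (3/2 + l - n) * \<eta>) / sinh (x + (1/2 + l) * \<eta>)"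

definition B_coeff :: "complex \<Rightarrow> complex \<Rightarrow> complex \<Rightarrow> complex \<Rightarrow> complex" where
  "B_coeff \<eta> l x n = sinh \<eta> * exp ((- l - 1/2 + n) * \<eta>) / sinh (x + (1/2 + l) * \<eta>)"

definition C_coeff :: "complex \<Rightarrow> complex \<Rightarrow> complex \<Rightarrow> complex \<Rightarrow> complex" where
  "C_coeff \<eta> l x n = sinh ((n - 1) * \<eta>) * sinh ((2 * l + 2 - n) * \<eta>) * exp ((l + 3/2 - n) * \<eta>)
     / (sinh \<eta> * sinh (x + (1/2 + l) * \<eta>))"

definition D_coeff :: "complex \<Rightarrow> complex \<Rightarrow> complex \<Rightarrow> complex \<Rightarrow> complex" where
  "D_coeff \<eta> l x n = sinh (x + (- 1/2 - l + n) * \<eta>) / sinh (x + (1/2 + l) * \<eta>)"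

text \<open>The two coefficients of the fusion map: the coefficient of $v_p\otimes v_b$ in the image of
  $v_{p+b-1}$, which is the only basis vector whose image contains it.\<close>

definition j_coeff :: "complex \<Rightarrow> complex \<Rightarrow> complex \<Rightarrow> nat \<Rightarrow> complex" where
  "j_coeff \<eta> k p b = (if b = 1 then exp (\<eta>/2 * (p - 1))
     else exp (- \<eta>/2 * (p - 1 - 2 * k)) * sinh (p * \<eta>) / sinh \<eta>)"

text \<open>After the products are turned into differences of hyperbolic cosines the six terms cancel in
  pairs.  All quadratic identities below are instances.\<close>

lemma three_term_sinh:
  fixes a b c d e f :: complex
  assumes "a + b = e + f" "b - a = c + d" "d - c = e - f"
  shows "sinh a * sinh b + sinh c * sinh d = sinh e * sinh f"
proof -
  have prod: "sinh u * sinh v = (cosh (u + v) - cosh (u - v)) / 2" for u v :: complex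
    by (simp add: cosh_add cosh_diff)
  have sym: "cosh (u - v) = cosh (v - u)" for u v :: complex
    by (metis cosh_minus minus_diff_eq)
  show ?thesis
    unfolding prod assms(1) sym[of a b] assms(2) sym[of c d] assms(3) by (simp add: diff_divide_distrib)
qed

text \<open>The inverse of the L-operator is the L-operator at the opposite spectral parameter; these are the
  four entries of the product on a basis vector.\<close>

lemma L_coeff_inverse:
  assumes "sinh \<eta> \<noteq> 0" "sinh (x + (1/2 + l) * \<eta>) \<noteq> 0" "sinh (- x + (1/2 + l) * \<eta>) \<noteq> 0"
  shows "A_coeff \<eta> l x n * A_coeff \<eta> l (- x) n + B_coeff \<eta> l x (n - 1) * C_coeff \<eta> l (- x) n = 1"
    and "A_coeff \<eta> l x n * B_coeff \<eta> l (- x) (n - 1) + B_coeff \<eta> l x (n - 1) * D_coeff \<eta> l (- x) (n - 1) = 0"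
    and "D_coeff \<eta> l x n * D_coeff \<eta> l (- x) n + C_coeff \<eta> l x (n + 1) * B_coeff \<eta> l (- x) n = 1"
    and "D_coeff \<eta> l x n * C_coeff \<eta> l (- x) (n + 1) + C_coeff \<eta> l x (n + 1) * A_coeff \<eta> l (- x) (n + 1) = 0"
proof -
  define S p m where "S = sinh \<eta>" and "p = sinh (x + (1/2 + l) * \<eta>)" and "m = sinh (- x + (1/2 + l) * \<eta>)"
  have nz: "S \<noteq> 0" "p \<noteq> 0" "m \<noteq> 0" using assms by (auto simp: S_def p_def m_def)
  have e1: "exp ((- l - 1/2 + (n - 1)) * \<eta>) * exp ((l + 3/2 - n) * \<eta>) = 1"
    by (simp add: exp_add[symmetric] algebra_simps)
  have e2: "exp ((l + 3/2 - (n + 1)) * \<eta>) * exp ((- l - 1/2 + n) * \<eta>) = 1"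
    by (simp add: exp_add[symmetric] algebra_simps)
  have s1: "sinh (x + (3/2 + l - n) * \<eta>) * sinh (- x + (3/2 + l - n) * \<eta>)
    + sinh ((n - 1) * \<eta>) * sinh ((2 * l + 2 - n) * \<eta>) = p * m"
    using three_term_sinh[of "(n - 1) * \<eta>" "(2 * l + 2 - n) * \<eta>" "x + (1/2 + l) * \<eta>" "- x + (1/2 + l) * \<eta>"
        "- x + (3/2 + l - n) * \<eta>" "x + (3/2 + l - n) * \<eta>"]
    by (simp add: p_def m_def algebra_simps)
  have s2: "sinh (- x + (- 1/2 - l + (n - 1)) * \<eta>) = - sinh (x + (3/2 + l - n) * \<eta>)"
    unfolding sinh_minus[symmetric] by (simp add: algebra_simps)
  have s3: "sinh (x + (- 1/2 - l + n) * \<eta>) * sinh (- x + (- 1/2 - l + n) * \<eta>)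
    + sinh (n * \<eta>) * sinh ((2 * l + 1 - n) * \<eta>) = p * m"
    using three_term_sinh[of "(2 * l + 1 - n) * \<eta>" "n * \<eta>" "x + (1/2 + l) * \<eta>" "- x + (1/2 + l) * \<eta>"
        "- x + (- 1/2 - l + n) * \<eta>" "x + (- 1/2 - l + n) * \<eta>"]
    by (simp add: p_def m_def algebra_simps)
  have s4: "sinh (- x + (3/2 + l - (n + 1)) * \<eta>) = - sinh (x + (- 1/2 - l + n) * \<eta>)"
    unfolding sinh_minus[symmetric] by (simp add: algebra_simps)
  note defs = A_coeff_def B_coeff_def C_coeff_def D_coeff_def S_def[symmetric] p_def[symmetric] m_def[symmetric]
  show "A_coeff \<eta> l x n * A_coeff \<eta> l (- x) n + B_coeff \<eta> l x (n - 1) * C_coeff \<eta> l (- x) n = 1"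
  proof -
    define a b c d e f where "a = sinh (x + (3/2 + l - n) * \<eta>)" and "b = sinh (- x + (3/2 + l - n) * \<eta>)"
      and "c = sinh ((n - 1) * \<eta>)" and "d = sinh ((2 * l + 2 - n) * \<eta>)"
      and "e = exp ((- l - 1/2 + (n - 1)) * \<eta>)" and "f = exp ((l + 3/2 - n) * \<eta>)"
    have "a * b + c * d = p * m" "e * f = 1" using s1 e1 by (simp_all add: a_def b_def c_def d_def e_def f_def)
    then have "a / p * (b / m) + S * e / p * (c * d * f / (S * m)) = 1"
      using nz by (simp add: divide_simps) algebra
    then show ?thesis unfolding defs a_def b_def c_def d_def e_def f_def .
  qed
  show "A_coeff \<eta> l x n * B_coeff \<eta> l (- x) (n - 1) + B_coeff \<eta> l x (n - 1) * D_coeff \<eta> l (- x) (n - 1) = 0"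
    unfolding defs s2 by (simp add: divide_simps)
  show "D_coeff \<eta> l x n * D_coeff \<eta> l (- x) n + C_coeff \<eta> l x (n + 1) * B_coeff \<eta> l (- x) n = 1"
  proof -
    define a b c d e f where "a = sinh (x + (- 1/2 - l + n) * \<eta>)" and "b = sinh (- x + (- 1/2 - l + n) * \<eta>)"
      and "c = sinh ((n + 1 - 1) * \<eta>)" and "d = sinh ((2 * l + 2 - (n + 1)) * \<eta>)"
      and "e = exp ((- l - 1/2 + n) * \<eta>)" and "f = exp ((l + 3/2 - (n + 1)) * \<eta>)"
    have "a * b + c * d = p * m" "e * f = 1" using s3 e2 
      by (simp_all add: a_def b_def c_def d_def e_def f_def algebra_simps)
    then have "a / p * (b / m) + c * d * f / (S * p) * (S * e / m) = 1"
      using nz by (simp add: divide_simps) algebra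
    then show ?thesis unfolding defs a_def b_def c_def d_def e_def f_def .
  qed
  show "D_coeff \<eta> l x n * C_coeff \<eta> l (- x) (n + 1) + C_coeff \<eta> l x (n + 1) * A_coeff \<eta> l (- x) (n + 1) = 0"
    unfolding defs s4 by (simp add: divide_simps)
qed



lemma exp_numeral_mult: "exp (numeral n * z) = exp (z::complex) ^ numeral n"
  using exp_of_nat_mult[of "numeral n" z] by simp

text \<open>Written as monomials in three exponentials, the exponential prefactors become a matter of polynomial
  arithmetic.\<close>

lemma coeff_monomials:
  fixes \<eta> k p :: complex
  defines "P \<equiv> exp (\<eta>/2 * p)" and "Q \<equiv> exp (\<eta>/2)" and "K \<equiv> exp (k * \<eta>)"
  shows "B_coeff \<eta> k x (p - 1) = sinh \<eta> * (P\<^sup>2 / (K * Q ^ 3)) / sinh (x + (1/2 + k) * \<eta>)"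
    "B_coeff \<eta> (k + 1/2) x (p - 1) = sinh \<eta> * (P\<^sup>2 / (K * Q ^ 4)) / sinh (x + (k + 1) * \<eta>)"
    "B_coeff \<eta> (k + 1/2) x p = sinh \<eta> * (P\<^sup>2 / (K * Q\<^sup>2)) / sinh (x + (k + 1) * \<eta>)"
    "C_coeff \<eta> k x (p + 1) = sinh (p * \<eta>) * sinh ((2 * k + 1 - p) * \<eta>) * (K * Q / P\<^sup>2)
       / (sinh \<eta> * sinh (x + (1/2 + k) * \<eta>))"
    "C_coeff \<eta> (k + 1/2) x (p + 1) = sinh (p * \<eta>) * sinh ((2 * k + 2 - p) * \<eta>) * (K * Q\<^sup>2 / P\<^sup>2)
       / (sinh \<eta> * sinh (x + (k + 1) * \<eta>))"
    "C_coeff \<eta> (k + 1/2) x (p + 2) = sinh ((p + 1) * \<eta>) * sinh ((2 * k + 1 - p) * \<eta>) * (K / P\<^sup>2)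
       / (sinh \<eta> * sinh (x + (k + 1) * \<eta>))"
    "j_coeff \<eta> k p 1 = P / Q" "j_coeff \<eta> k (p - 1) 1 = P / Q\<^sup>2" "j_coeff \<eta> k (p + 1) 1 = P"
    "j_coeff \<eta> k p 2 = K * Q / P * sinh (p * \<eta>) / sinh \<eta>"
    "j_coeff \<eta> k (p - 1) 2 = K * Q\<^sup>2 / P * sinh ((p - 1) * \<eta>) / sinh \<eta>"
    "j_coeff \<eta> k (p + 1) 2 = K / P * sinh ((p + 1) * \<eta>) / sinh \<eta>"
proof -
  note PQK = P_def Q_def K_def
  note merge = PQK exp_numeral_mult[symmetric] exp_add[symmetric] exp_diff[symmetric]
  have e: "exp ((- k - 1/2 + (p - 1)) * \<eta>) = P\<^sup>2 / (K * Q ^ 3)"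
    "exp ((- (k + 1/2) - 1/2 + (p - 1)) * \<eta>) = P\<^sup>2 / (K * Q ^ 4)"
    "exp ((- (k + 1/2) - 1/2 + p) * \<eta>) = P\<^sup>2 / (K * Q\<^sup>2)"
    "exp ((k + 3/2 - (p + 1)) * \<eta>) = K * Q / P\<^sup>2"
    "exp ((k + 1/2 + 3/2 - (p + 1)) * \<eta>) = K * Q\<^sup>2 / P\<^sup>2"
    "exp ((k + 1/2 + 3/2 - (p + 2)) * \<eta>) = K / P\<^sup>2"
    "exp (\<eta>/2 * (p - 1)) = P / Q" "exp (\<eta>/2 * (p - 1 - 1)) = P / Q\<^sup>2" "exp (\<eta>/2 * (p + 1 - 1)) = P"
    "exp (- \<eta>/2 * (p - 1 - 2 * k)) = K * Q / P"
    "exp (- \<eta>/2 * (p - 1 - 1 - 2 * k)) = K * Q\<^sup>2 / P"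
    "exp (- \<eta>/2 * (p + 1 - 1 - 2 * k)) = K / P"
    unfolding merge by (rule arg_cong[of _ _ exp], simp add: field_simps)+
  have a: "x + (1/2 + (k + 1/2)) * \<eta> = x + (k + 1) * \<eta>" "(p + 1 - 1) * \<eta> = p * \<eta>"
    "(2 * k + 2 - (p + 1)) * \<eta> = (2 * k + 1 - p) * \<eta>" "(2 * (k + 1/2) + 2 - (p + 1)) * \<eta> = (2 * k + 2 - p) * \<eta>"
    "(p + 2 - 1) * \<eta> = (p + 1) * \<eta>" "(2 * (k + 1/2) + 2 - (p + 2)) * \<eta> = (2 * k + 1 - p) * \<eta>" for x
    by (simp_all add: field_simps)
  show "B_coeff \<eta> k x (p - 1) = sinh \<eta> * (P\<^sup>2 / (K * Q ^ 3)) / sinh (x + (1/2 + k) * \<eta>)"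
    "B_coeff \<eta> (k + 1/2) x (p - 1) = sinh \<eta> * (P\<^sup>2 / (K * Q ^ 4)) / sinh (x + (k + 1) * \<eta>)"
    "B_coeff \<eta> (k + 1/2) x p = sinh \<eta> * (P\<^sup>2 / (K * Q\<^sup>2)) / sinh (x + (k + 1) * \<eta>)"
    "C_coeff \<eta> k x (p + 1) = sinh (p * \<eta>) * sinh ((2 * k + 1 - p) * \<eta>) * (K * Q / P\<^sup>2)
       / (sinh \<eta> * sinh (x + (1/2 + k) * \<eta>))"
    "C_coeff \<eta> (k + 1/2) x (p + 1) = sinh (p * \<eta>) * sinh ((2 * k + 2 - p) * \<eta>) * (K * Q\<^sup>2 / P\<^sup>2)
       / (sinh \<eta> * sinh (x + (k + 1) * \<eta>))"
    "C_coeff \<eta> (k + 1/2) x (p + 2) = sinh ((p + 1) * \<eta>) * sinh ((2 * k + 1 - p) * \<eta>) * (K / P\<^sup>2)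
       / (sinh \<eta> * sinh (x + (k + 1) * \<eta>))"
    unfolding B_coeff_def C_coeff_def e a by (rule refl)+
  show "j_coeff \<eta> k p 1 = P / Q" "j_coeff \<eta> k (p - 1) 1 = P / Q\<^sup>2" "j_coeff \<eta> k (p + 1) 1 = P"
    "j_coeff \<eta> k p 2 = K * Q / P * sinh (p * \<eta>) / sinh \<eta>"
    "j_coeff \<eta> k (p - 1) 2 = K * Q\<^sup>2 / P * sinh ((p - 1) * \<eta>) / sinh \<eta>"
    "j_coeff \<eta> k (p + 1) 2 = K / P * sinh ((p + 1) * \<eta>) / sinh \<eta>"
    unfolding j_coeff_def e by simp_all
qed

lemma spin_half_coeffs:
  assumes S: "sinh \<eta> \<noteq> 0" and d: "sinh (x + \<eta>) \<noteq> 0"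
  shows "A_coeff \<eta> (1/2) x 1 = 1" "A_coeff \<eta> (1/2) x 2 = sinh x / sinh (x + \<eta>)"
    "B_coeff \<eta> (1/2) x 1 = sinh \<eta> / sinh (x + \<eta>)" "C_coeff \<eta> (1/2) x 2 = sinh \<eta> / sinh (x + \<eta>)"
    "D_coeff \<eta> (1/2) x 1 = sinh x / sinh (x + \<eta>)" "D_coeff \<eta> (1/2) x 2 = 1"
  using assms by (simp_all add: A_coeff_def B_coeff_def C_coeff_def D_coeff_def)

text \<open>The matrix entries of the fusion relation: on the image of j, the product of the L-operators of spins
  k and 1/2 with the spectral parameters shifted by $-\eta/2$ and $k\eta$ acts as the L-operator of
  spin k + 1/2.\<close>

lemma fusion_coeffs:
  fixes \<eta> k p y :: complex
  assumes S: "sinh \<eta> \<noteq> 0" and D1: "sinh (y + k * \<eta>) \<noteq> 0" and D2: "sinh (y + (k + 1) * \<eta>) \<noteq> 0"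
  defines "y1 \<equiv> y - \<eta>/2" and "y2 \<equiv> y + k * \<eta>"
  shows "A_coeff \<eta> k y1 p * A_coeff \<eta> (1/2) y2 1 * j_coeff \<eta> k p 1
      + B_coeff \<eta> k y1 (p - 1) * C_coeff \<eta> (1/2) y2 2 * j_coeff \<eta> k (p - 1) 2
      = j_coeff \<eta> k p 1 * A_coeff \<eta> (k + 1/2) y p" (is ?c1)
    and "B_coeff \<eta> k y1 (p - 1) * D_coeff \<eta> (1/2) y2 1 * j_coeff \<eta> k (p - 1) 1
      = j_coeff \<eta> k p 1 * B_coeff \<eta> (k + 1/2) y (p - 1)" (is ?c2)
    and "A_coeff \<eta> k y1 p * A_coeff \<eta> (1/2) y2 2 * j_coeff \<eta> k p 2
      = j_coeff \<eta> k p 2 * A_coeff \<eta> (k + 1/2) y (p + 1)" (is ?c3)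
    and "A_coeff \<eta> k y1 p * B_coeff \<eta> (1/2) y2 1 * j_coeff \<eta> k p 1
      + B_coeff \<eta> k y1 (p - 1) * D_coeff \<eta> (1/2) y2 2 * j_coeff \<eta> k (p - 1) 2
      = j_coeff \<eta> k p 2 * B_coeff \<eta> (k + 1/2) y p" (is ?c4)
    and "C_coeff \<eta> k y1 (p + 1) * A_coeff \<eta> (1/2) y2 1 * j_coeff \<eta> k (p + 1) 1
      + D_coeff \<eta> k y1 p * C_coeff \<eta> (1/2) y2 2 * j_coeff \<eta> k p 2
      = j_coeff \<eta> k p 1 * C_coeff \<eta> (k + 1/2) y (p + 1)" (is ?c5)
    and "D_coeff \<eta> k y1 p * D_coeff \<eta> (1/2) y2 1 * j_coeff \<eta> k p 1
      = j_coeff \<eta> k p 1 * D_coeff \<eta> (k + 1/2) y p" (is ?c6)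
    and "C_coeff \<eta> k y1 (p + 1) * A_coeff \<eta> (1/2) y2 2 * j_coeff \<eta> k (p + 1) 2
      = j_coeff \<eta> k p 2 * C_coeff \<eta> (k + 1/2) y (p + 2)" (is ?c7)
    and "C_coeff \<eta> k y1 (p + 1) * B_coeff \<eta> (1/2) y2 1 * j_coeff \<eta> k (p + 1) 1
      + D_coeff \<eta> k y1 p * D_coeff \<eta> (1/2) y2 2 * j_coeff \<eta> k p 2
      = j_coeff \<eta> k p 2 * D_coeff \<eta> (k + 1/2) y (p + 1)" (is ?c8)
proof -
  define P Q K where "P = exp (\<eta>/2 * p)" and "Q = exp (\<eta>/2)" and "K = exp (k * \<eta>)"
  have nzP: "P \<noteq> 0" "Q \<noteq> 0" "K \<noteq> 0" by (simp_all add: P_def Q_def K_def)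
  note mon = coeff_monomials[where \<eta> = \<eta> and k = k and p = p, folded P_def Q_def K_def]
  define s d1 d2 where "s = sinh \<eta>" and "d1 = sinh (y + k * \<eta>)" and "d2 = sinh (y + (k + 1) * \<eta>)"
  define a0 a1 m0 m1 where "a0 = sinh (y + (1 + k - p) * \<eta>)" and "a1 = sinh (y + (2 + k - p) * \<eta>)"
    and "m0 = sinh (y + (p - k) * \<eta>)" and "m1 = sinh (y + (p - 1 - k) * \<eta>)"
  define q0 qm qp r1 r2 where "q0 = sinh (p * \<eta>)" and "qm = sinh ((p - 1) * \<eta>)" and "qp = sinh ((p + 1) * \<eta>)"
    and "r1 = sinh ((2 * k + 1 - p) * \<eta>)" and "r2 = sinh ((2 * k + 2 - p) * \<eta>)"
  note names = s_def d1_def d2_def a0_def a1_def m0_def m1_def q0_def qm_def qp_def r1_def r2_def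
  have nz: "s \<noteq> 0" "d1 \<noteq> 0" "d2 \<noteq> 0" using assms by (auto simp: names)
  have arg: "y1 + (1/2 + k) * \<eta> = y + k * \<eta>" "y2 + \<eta> = y + (k + 1) * \<eta>"
    "y + (1/2 + (k + 1/2)) * \<eta> = y + (k + 1) * \<eta>"
    "y1 + (3/2 + k - p) * \<eta> = y + (1 + k - p) * \<eta>" "y1 + (- 1/2 - k + p) * \<eta> = y + (p - 1 - k) * \<eta>"
    "y + (3/2 + (k + 1/2) - p) * \<eta> = y + (2 + k - p) * \<eta>"
    "y + (3/2 + (k + 1/2) - (p + 1)) * \<eta> = y + (1 + k - p) * \<eta>"
    "y + (- 1/2 - (k + 1/2) + p) * \<eta> = y + (p - 1 - k) * \<eta>"
    "y + (- 1/2 - (k + 1/2) + (p + 1)) * \<eta> = y + (p - k) * \<eta>"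
    by (simp_all add: y1_def y2_def field_simps)
  have half: "A_coeff \<eta> (1/2) y2 1 = 1" "A_coeff \<eta> (1/2) y2 2 = sinh y2 / sinh (y2 + \<eta>)"
    "B_coeff \<eta> (1/2) y2 1 = sinh \<eta> / sinh (y2 + \<eta>)" "C_coeff \<eta> (1/2) y2 2 = sinh \<eta> / sinh (y2 + \<eta>)"
    "D_coeff \<eta> (1/2) y2 1 = sinh y2 / sinh (y2 + \<eta>)" "D_coeff \<eta> (1/2) y2 2 = 1"
    by (rule spin_half_coeffs; use S D2 arg(2) in simp)+
  have t1: "a0 * d2 + qm * s = a1 * d1" unfolding names
    by (rule three_term_sinh) (simp_all add: algebra_simps)
  have t4: "qm * d2 + s * a0 = d1 * q0" unfolding names
    by (rule three_term_sinh) (simp_all add: algebra_simps)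
  have t5: "r1 * d2 + s * m1 = d1 * r2" unfolding names
    by (rule three_term_sinh) (simp_all add: algebra_simps)
  have t8: "m1 * d2 + s * r1 = d1 * m0" unfolding names
    by (rule three_term_sinh) (simp_all add: algebra_simps)
  note rw = mon half[unfolded arg, unfolded y2_def] arg A_coeff_def[of \<eta> k] A_coeff_def[of \<eta> "k + 1/2"] D_coeff_def[of \<eta> k] D_coeff_def[of \<eta> "k + 1/2"]
    y2_def names[symmetric]
  show ?c1 unfolding rw using t1 nz nzP by (simp add: divide_simps) algebra
  show ?c2 unfolding rw using nz nzP by (simp add: divide_simps) algebra
  show ?c3 unfolding rw using nz nzP by (simp add: divide_simps)
  show ?c4 unfolding rw using t4 nz nzP by (simp add: divide_simps) algebra
  show ?c5 unfolding rw using t5 nz nzP by (simp add: divide_simps) algebra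
  show ?c6 unfolding rw using nz nzP by (simp add: divide_simps)
  show ?c7 unfolding rw using nz nzP by (simp add: divide_simps)
  show ?c8 unfolding rw using t8 nz nzP by (simp add: divide_simps) algebra
qed


text \<open>The corresponding relation for the inverse operators, which are multiplied in the opposite order and
  have the opposite spectral parameters.\<close>

lemma fusion_coeffs_reversed:
  fixes \<eta> k p y :: complex
  assumes S: "sinh \<eta> \<noteq> 0" and D2: "sinh (y + (k + 1) * \<eta>) \<noteq> 0" and D3: "sinh (y + (1 - k) * \<eta>) \<noteq> 0"
  defines "y1 \<equiv> y + \<eta>/2" and "y2 \<equiv> y - k * \<eta>"
  shows "A_coeff \<eta> (1/2) y2 1 * A_coeff \<eta> k y1 p * j_coeff \<eta> k p 1
      = j_coeff \<eta> k p 1 * A_coeff \<eta> (k + 1/2) y p" (is ?c1)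
    and "A_coeff \<eta> (1/2) y2 1 * B_coeff \<eta> k y1 (p - 1) * j_coeff \<eta> k (p - 1) 1
      = j_coeff \<eta> k p 1 * B_coeff \<eta> (k + 1/2) y (p - 1)" (is ?c2)
    and "A_coeff \<eta> (1/2) y2 2 * A_coeff \<eta> k y1 p * j_coeff \<eta> k p 2
      + B_coeff \<eta> (1/2) y2 1 * C_coeff \<eta> k y1 (p + 1) * j_coeff \<eta> k (p + 1) 1
      = j_coeff \<eta> k p 2 * A_coeff \<eta> (k + 1/2) y (p + 1)" (is ?c3)
    and "A_coeff \<eta> (1/2) y2 2 * B_coeff \<eta> k y1 (p - 1) * j_coeff \<eta> k (p - 1) 2
      + B_coeff \<eta> (1/2) y2 1 * D_coeff \<eta> k y1 p * j_coeff \<eta> k p 1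
      = j_coeff \<eta> k p 2 * B_coeff \<eta> (k + 1/2) y p" (is ?c4)
    and "C_coeff \<eta> (1/2) y2 2 * A_coeff \<eta> k y1 p * j_coeff \<eta> k p 2
      + D_coeff \<eta> (1/2) y2 1 * C_coeff \<eta> k y1 (p + 1) * j_coeff \<eta> k (p + 1) 1
      = j_coeff \<eta> k p 1 * C_coeff \<eta> (k + 1/2) y (p + 1)" (is ?c5)
    and "C_coeff \<eta> (1/2) y2 2 * B_coeff \<eta> k y1 (p - 1) * j_coeff \<eta> k (p - 1) 2
      + D_coeff \<eta> (1/2) y2 1 * D_coeff \<eta> k y1 p * j_coeff \<eta> k p 1
      = j_coeff \<eta> k p 1 * D_coeff \<eta> (k + 1/2) y p" (is ?c6)
    and "D_coeff \<eta> (1/2) y2 2 * C_coeff \<eta> k y1 (p + 1) * j_coeff \<eta> k (p + 1) 2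
      = j_coeff \<eta> k p 2 * C_coeff \<eta> (k + 1/2) y (p + 2)" (is ?c7)
    and "D_coeff \<eta> (1/2) y2 2 * D_coeff \<eta> k y1 p * j_coeff \<eta> k p 2
      = j_coeff \<eta> k p 2 * D_coeff \<eta> (k + 1/2) y (p + 1)" (is ?c8)
proof -
  define P Q K where "P = exp (\<eta>/2 * p)" and "Q = exp (\<eta>/2)" and "K = exp (k * \<eta>)"
  have nzP: "P \<noteq> 0" "Q \<noteq> 0" "K \<noteq> 0" by (simp_all add: P_def Q_def K_def)
  note mon = coeff_monomials[where \<eta> = \<eta> and k = k and p = p, folded P_def Q_def K_def]
  define s d0 d2 d3 where "s = sinh \<eta>" and "d0 = sinh (y - k * \<eta>)" and "d2 = sinh (y + (k + 1) * \<eta>)"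
    and "d3 = sinh (y + (1 - k) * \<eta>)"
  define a0 a1 m0 m1 where "a0 = sinh (y + (1 + k - p) * \<eta>)" and "a1 = sinh (y + (2 + k - p) * \<eta>)"
    and "m0 = sinh (y + (p - k) * \<eta>)" and "m1 = sinh (y + (p - 1 - k) * \<eta>)"
  define q0 qm qp r1 r2 where "q0 = sinh (p * \<eta>)" and "qm = sinh ((p - 1) * \<eta>)" and "qp = sinh ((p + 1) * \<eta>)"
    and "r1 = sinh ((2 * k + 1 - p) * \<eta>)" and "r2 = sinh ((2 * k + 2 - p) * \<eta>)"
  note names = s_def d0_def d2_def d3_def a0_def a1_def m0_def m1_def q0_def qm_def qp_def r1_def r2_def
  have nz: "s \<noteq> 0" "d2 \<noteq> 0" "d3 \<noteq> 0" using assms by (auto simp: names)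
  have arg: "y1 + (1/2 + k) * \<eta> = y + (k + 1) * \<eta>" "y2 + \<eta> = y + (1 - k) * \<eta>"
    "y + (1/2 + (k + 1/2)) * \<eta> = y + (k + 1) * \<eta>"
    "y1 + (3/2 + k - p) * \<eta> = y + (2 + k - p) * \<eta>" "y1 + (- 1/2 - k + p) * \<eta> = y + (p - k) * \<eta>"
    "y + (3/2 + (k + 1/2) - p) * \<eta> = y + (2 + k - p) * \<eta>"
    "y + (3/2 + (k + 1/2) - (p + 1)) * \<eta> = y + (1 + k - p) * \<eta>"
    "y + (- 1/2 - (k + 1/2) + p) * \<eta> = y + (p - 1 - k) * \<eta>"
    "y + (- 1/2 - (k + 1/2) + (p + 1)) * \<eta> = y + (p - k) * \<eta>"
    by (simp_all add: y1_def y2_def field_simps)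
  have half: "A_coeff \<eta> (1/2) y2 1 = 1" "A_coeff \<eta> (1/2) y2 2 = sinh y2 / sinh (y2 + \<eta>)"
    "B_coeff \<eta> (1/2) y2 1 = sinh \<eta> / sinh (y2 + \<eta>)" "C_coeff \<eta> (1/2) y2 2 = sinh \<eta> / sinh (y2 + \<eta>)"
    "D_coeff \<eta> (1/2) y2 1 = sinh y2 / sinh (y2 + \<eta>)" "D_coeff \<eta> (1/2) y2 2 = 1"
    by (rule spin_half_coeffs; use S D3 arg(2) in simp)+
  have t3: "d0 * a1 + r1 * s = d3 * a0" unfolding names
    by (rule three_term_sinh) (simp_all add: algebra_simps)
  have t4: "s * m0 + qm * d0 = d3 * q0" unfolding names
    by (rule three_term_sinh) (simp_all add: algebra_simps)
  have t5: "s * a1 + r1 * d0 = d3 * r2" unfolding names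
    by (rule three_term_sinh) (simp_all add: algebra_simps)
  have t6: "d0 * m0 + qm * s = d3 * m1" unfolding names
    by (rule three_term_sinh) (simp_all add: algebra_simps)
  note rw = mon half[unfolded arg, unfolded y2_def] arg A_coeff_def[of \<eta> k] A_coeff_def[of \<eta> "k + 1/2"] D_coeff_def[of \<eta> k] D_coeff_def[of \<eta> "k + 1/2"]
    y2_def names[symmetric]
  show ?c1 unfolding rw by (simp add: mult_ac)
  show ?c2 unfolding rw using nz nzP by (simp add: divide_simps) algebra
  show ?c3 unfolding rw using t3 nz nzP by (simp add: divide_simps) algebra
  show ?c4 unfolding rw using t4 nz nzP by (simp add: divide_simps) algebra
  show ?c5 unfolding rw using t5 nz nzP by (simp add: divide_simps) algebra
  show ?c6 unfolding rw using t6 nz nzP by (simp add: divide_simps) algebra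
  show ?c7 unfolding rw using nz nzP by (simp add: divide_simps)
  show ?c8 unfolding rw by (simp add: mult_ac)
qed

section \<open>Coefficients of linear maps\<close>

lemma lookup_smult_vec [simp]: "Poly_Mapping.lookup (smult_vec c u) i = c * Poly_Mapping.lookup u i"
  by (simp add: smult_vec_def Poly_Mapping.map.rep_eq when_def)

lemma lookup_lin_ext:
  assumes "finite A" "Poly_Mapping.keys u \<subseteq> A"
  shows "Poly_Mapping.lookup (lin_ext b u) j = (\<Sum>i\<in>A. Poly_Mapping.lookup u i * Poly_Mapping.lookup (b i) j)"
proof -
  have "(\<Sum>i\<in>A. Poly_Mapping.lookup u i * Poly_Mapping.lookup (b i) j)
      = (\<Sum>i\<in>Poly_Mapping.keys u. Poly_Mapping.lookup u i * Poly_Mapping.lookup (b i) j)"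
    using assms by (intro sum.mono_neutral_right) (auto simp: in_keys_iff)
  then show ?thesis by (simp add: lin_ext_def lookup_sum)
qed

lemma lookup_lin_ext_one:
  assumes "\<And>i. i \<in> Poly_Mapping.keys u \<Longrightarrow> i \<noteq> k \<Longrightarrow> Poly_Mapping.lookup (b i) j = 0"
  shows "Poly_Mapping.lookup (lin_ext b u) j = Poly_Mapping.lookup u k * Poly_Mapping.lookup (b k) j"
proof -
  have "Poly_Mapping.lookup (lin_ext b u) j
      = (\<Sum>i\<in>insert k (Poly_Mapping.keys u). Poly_Mapping.lookup u i * Poly_Mapping.lookup (b i) j)"
    by (rule lookup_lin_ext) auto
  also have "\<dots> = (\<Sum>i\<in>{k}. Poly_Mapping.lookup u i * Poly_Mapping.lookup (b i) j)"
    using assms by (intro sum.mono_neutral_right) auto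
  finally show ?thesis by simp
qed

lemma lookup_lin_ext_two:
  assumes "\<And>i. i \<in> Poly_Mapping.keys u \<Longrightarrow> i \<noteq> k \<Longrightarrow> i \<noteq> k' \<Longrightarrow> Poly_Mapping.lookup (b i) j = 0" "k \<noteq> k'"
  shows "Poly_Mapping.lookup (lin_ext b u) j = Poly_Mapping.lookup u k * Poly_Mapping.lookup (b k) j
    + Poly_Mapping.lookup u k' * Poly_Mapping.lookup (b k') j"
proof -
  have "Poly_Mapping.lookup (lin_ext b u) j
      = (\<Sum>i\<in>insert k (insert k' (Poly_Mapping.keys u)). Poly_Mapping.lookup u i * Poly_Mapping.lookup (b i) j)"
    by (rule lookup_lin_ext) auto
  also have "\<dots> = (\<Sum>i\<in>{k, k'}. Poly_Mapping.lookup u i * Poly_Mapping.lookup (b i) j)"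
    using assms by (intro sum.mono_neutral_right) auto
  finally show ?thesis using assms(2) by simp
qed

lemma lookup_lin_ext_neq_0:
  assumes "Poly_Mapping.lookup (lin_ext b u) j \<noteq> 0"
  shows "\<exists>i\<in>Poly_Mapping.keys u. Poly_Mapping.lookup (b i) j \<noteq> 0"
proof (rule ccontr)
  assume "\<not> ?thesis"
  then have "Poly_Mapping.lookup (b i) j = 0" if "i \<in> Poly_Mapping.keys u" for i using that by blast
  then have "(\<Sum>i\<in>Poly_Mapping.keys u. Poly_Mapping.lookup u i * Poly_Mapping.lookup (b i) j) = 0" by simp
  then show False using assms(1) lookup_lin_ext[of "Poly_Mapping.keys u" u b j] by simp
qed

lemma lin_ext_single: "lin_ext b (Poly_Mapping.single i c) = smult_vec c (b i)"
proof (rule poly_mapping_eqI)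
  fix j
  have "Poly_Mapping.lookup (lin_ext b (Poly_Mapping.single i c)) j
      = Poly_Mapping.lookup (Poly_Mapping.single i c) i * Poly_Mapping.lookup (b i) j"
    by (rule lookup_lin_ext_one) (simp split: if_splits)
  then show "Poly_Mapping.lookup (lin_ext b (Poly_Mapping.single i c)) j = Poly_Mapping.lookup (smult_vec c (b i)) j"
    by simp
qed

lemma lookup_basis_vec: "Poly_Mapping.lookup (basis_vec i) j = (if i = j then 1 else 0)"
  by (simp add: lookup_single when_def)

lemma lookup_at_site:
  assumes "\<phi> (ns ! r) = smult_vec c (M_vec m)"
  shows "Poly_Mapping.lookup (at_site r \<phi> ns) ms = (if m \<noteq> 0 \<and> ms = ns[r := m] then c else 0)"
proof -
  have "smult_vec c (M_vec m) = Poly_Mapping.single m (if m = 0 then 0 else c)"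
    by (rule poly_mapping_eqI) (simp add: M_vec_def lookup_single when_def)
  then show ?thesis using assms by (auto simp: at_site_def lin_ext_single lookup_basis_vec)
qed

lemma lookup_aux_tensor:
  "Poly_Mapping.lookup (aux_tensor a u) js = (if js \<noteq> [] \<and> hd js = a then Poly_Mapping.lookup u (tl js) else 0)"
proof -
  have "Poly_Mapping.lookup (aux_tensor a u) js
      = Poly_Mapping.lookup u (tl js) * Poly_Mapping.lookup (basis_vec (a # tl js)) js"
    unfolding aux_tensor_def by (rule lookup_lin_ext_one) (auto simp: lookup_basis_vec)
  then show ?thesis by (cases js) (auto simp: lookup_basis_vec)
qed

lemma in_listset_iff:
  "ns \<in> listset Is \<longleftrightarrow> length ns = length Is \<and> (\<forall>i<length Is. ns ! i \<in> Is ! i)"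
proof (induction Is arbitrary: ns)
  case (Cons I Is)
  show ?case
  proof (cases ns)
    case (Cons n ms)
    then show ?thesis using Cons.IH[of ms] by (auto simp: set_Cons_def nth_Cons split: nat.splits)
  qed (auto simp: set_Cons_def)
qed simp

lemma aux_space_iff:
  "u \<in> aux_space N \<longleftrightarrow> (\<forall>js. Poly_Mapping.lookup u js \<noteq> 0 \<longrightarrow>
     (\<exists>a ns. js = a # ns \<and> (a = 1 \<or> a = 2) \<and> length ns = N \<and> (\<forall>i<N. 1 \<le> ns ! i)))"
proof -
  have "js \<in> listset (V_idx 1 # replicate N M_idx) \<longleftrightarrow>
     (\<exists>a ns. js = a # ns \<and> (a = 1 \<or> a = 2) \<and> length ns = N \<and> (\<forall>i<N. 1 \<le> ns ! i))" for js
  proof (cases js)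
    case (Cons a ns)
    have "a \<in> V_idx 1 \<longleftrightarrow> a = 1 \<or> a = 2" by (auto simp: V_idx_def)
    then show ?thesis using Cons in_listset_iff[of ns "replicate N M_idx"] by (auto simp: set_Cons_def)
  qed (auto simp: set_Cons_def)
  then show ?thesis unfolding aux_space_def tensor_space_def by (auto simp: in_keys_iff subset_iff)
qed

lemma aux_spaceD:
  assumes "u \<in> aux_space N" "Poly_Mapping.lookup u (a # ns) \<noteq> 0"
  shows "a = 1 \<or> a = 2" "length ns = N" "\<And>i. i < N \<Longrightarrow> 1 \<le> ns ! i"
  using assms unfolding aux_space_iff by blast+

lemma lookup_aux_coeff:
  assumes "u \<in> aux_space N"
  shows "Poly_Mapping.lookup (aux_coeff a u) ns = Poly_Mapping.lookup u (a # ns)"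
proof -
  have "Poly_Mapping.lookup (aux_coeff a u) ns = Poly_Mapping.lookup u (a # ns) *
      Poly_Mapping.lookup (if hd (a # ns) = a then basis_vec (tl (a # ns)) else 0) ns"
    unfolding aux_coeff_def
  proof (rule lookup_lin_ext_one)
    fix js assume "js \<in> Poly_Mapping.keys u" "js \<noteq> a # ns"
    moreover from this obtain b ms where "js = b # ms" using assms unfolding aux_space_iff by (auto simp: in_keys_iff)
    ultimately show "Poly_Mapping.lookup (if hd js = a then basis_vec (tl js) else 0) ns = 0"
      by (auto simp: lookup_basis_vec)
  qed
  then show ?thesis by (simp add: lookup_basis_vec)
qed

section \<open>The L-operators\<close>

lemma lookup_L_op_basis:
  fixes \<eta> l x r js
  defines "b \<equiv> if hd js = 1
     then aux_tensor 1 (at_site r (A_op \<eta> l x) (tl js)) + aux_tensor 2 (at_site r (C_op \<eta> l x) (tl js))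
     else aux_tensor 1 (at_site r (B_op \<eta> l x) (tl js)) + aux_tensor 2 (at_site r (D_op \<eta> l x) (tl js))"
  shows "Poly_Mapping.lookup b js' = (if js' = [] then 0 else let ns = tl js; n = ns ! r; ms = tl js' in
     if hd js = 1
     then (if hd js' = 1 then (if n \<noteq> 0 \<and> ms = ns then A_coeff \<eta> l x (of_nat n) else 0)
       else if hd js' = 2 then (if n - 1 \<noteq> 0 \<and> ms = ns[r := n - 1] then C_coeff \<eta> l x (of_nat n) else 0) else 0)
     else (if hd js' = 1 then (if ms = ns[r := n + 1] then B_coeff \<eta> l x (of_nat n) else 0)
       else if hd js' = 2 then (if n \<noteq> 0 \<and> ms = ns then D_coeff \<eta> l x (of_nat n) else 0) else 0))"
proof -
  have site:
    "Poly_Mapping.lookup (at_site r (A_op \<eta> l x) ns) ms = (if ns ! r \<noteq> 0 \<and> ms = ns then A_coeff \<eta> l x (of_nat (ns ! r)) else 0)"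
    "Poly_Mapping.lookup (at_site r (B_op \<eta> l x) ns) ms = (if ms = ns[r := ns ! r + 1] then B_coeff \<eta> l x (of_nat (ns ! r)) else 0)"
    "Poly_Mapping.lookup (at_site r (C_op \<eta> l x) ns) ms = (if ns ! r - 1 \<noteq> 0 \<and> ms = ns[r := ns ! r - 1] then C_coeff \<eta> l x (of_nat (ns ! r)) else 0)"
    "Poly_Mapping.lookup (at_site r (D_op \<eta> l x) ns) ms = (if ns ! r \<noteq> 0 \<and> ms = ns then D_coeff \<eta> l x (of_nat (ns ! r)) else 0)"
    for ns ms
    unfolding A_coeff_def B_coeff_def C_coeff_def D_coeff_def
    using lookup_at_site[where \<phi> = "A_op \<eta> l x" and ns = ns and r = r and ms = ms, OF A_op_def]
      lookup_at_site[where \<phi> = "B_op \<eta> l x" and ns = ns and r = r and ms = ms, OF B_op_def]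
      lookup_at_site[where \<phi> = "C_op \<eta> l x" and ns = ns and r = r and ms = ms, OF C_op_def]
      lookup_at_site[where \<phi> = "D_op \<eta> l x" and ns = ns and r = r and ms = ms, OF D_op_def]
    by (simp_all only: list_update_id add_is_0 one_neq_zero simp_thms)
  show ?thesis
    unfolding b_def Let_def
    by (cases "hd js = 1"; cases "js' = []"; cases "hd js' = 1"; cases "hd js' = 2")
      (simp_all only: lookup_add lookup_aux_tensor site if_True if_False simp_thms add_0 add_0_right one_eq_numeral_iff numeral_eq_one_iff num.distinct lookup_zero)
qed

lemma L_op_in_aux_space:
  assumes u: "u \<in> aux_space N" and r: "r < N" shows "L_op \<eta> l x r u \<in> aux_space N"
  unfolding aux_space_iff
proof (intro allI impI)
  fix js' assume "Poly_Mapping.lookup (L_op \<eta> l x r u) js' \<noteq> 0"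
  note lookup_lin_ext_neq_0[OF this[unfolded L_op_def]]
  then obtain js where js: "js \<in> Poly_Mapping.keys u" and nz: "Poly_Mapping.lookup (if hd js = 1
     then aux_tensor 1 (at_site r (A_op \<eta> l x) (tl js)) + aux_tensor 2 (at_site r (C_op \<eta> l x) (tl js))
     else aux_tensor 1 (at_site r (B_op \<eta> l x) (tl js)) + aux_tensor 2 (at_site r (D_op \<eta> l x) (tl js))) js' \<noteq> 0"
    by (elim bexE)
  obtain a ns where an: "js = a # ns" "a = 1 \<or> a = 2" "length ns = N" "\<forall>i<N. 1 \<le> ns ! i"
    using js u unfolding aux_space_iff in_keys_iff by blast
  show "\<exists>a ns. js' = a # ns \<and> (a = 1 \<or> a = 2) \<and> length ns = N \<and> (\<forall>i<N. 1 \<le> ns ! i)"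
    using nz an r unfolding lookup_L_op_basis
    by (cases js') (auto simp: Let_def nth_list_update split: if_splits)
qed

text \<open>The L-operator in terms of coefficient functions.  A label that would drop below 1 causes no exception,
  because the coefficient there is zero.\<close>

lemma lookup_L_op:
  assumes u: "u \<in> aux_space N" and r: "r < N" and ns: "length ns = N" "1 \<le> ns ! r"
  shows "Poly_Mapping.lookup (L_op \<eta> l x r u) (1 # ns) =
      A_coeff \<eta> l x (of_nat (ns ! r)) * Poly_Mapping.lookup u (1 # ns)
      + B_coeff \<eta> l x (of_nat (ns ! r) - 1) * Poly_Mapping.lookup u (2 # ns[r := ns ! r - 1])"
    and "Poly_Mapping.lookup (L_op \<eta> l x r u) (2 # ns) =
      C_coeff \<eta> l x (of_nat (ns ! r) + 1) * Poly_Mapping.lookup u (1 # ns[r := ns ! r + 1])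
      + D_coeff \<eta> l x (of_nat (ns ! r)) * Poly_Mapping.lookup u (2 # ns)"
proof -
  let ?b = "\<lambda>js. if hd js = 1
     then aux_tensor 1 (at_site r (A_op \<eta> l x) (tl js)) + aux_tensor 2 (at_site r (C_op \<eta> l x) (tl js))
     else aux_tensor 1 (at_site r (B_op \<eta> l x) (tl js)) + aux_tensor 2 (at_site r (D_op \<eta> l x) (tl js))"
  have keys: "\<exists>a ms. js = a # ms \<and> (a = 1 \<or> a = 2) \<and> length ms = N \<and> (\<forall>i<N. 1 \<le> ms ! i)" if "js \<in> Poly_Mapping.keys u" for js
    using u that unfolding aux_space_iff in_keys_iff by blast
  have "Poly_Mapping.lookup (L_op \<eta> l x r u) (1 # ns) =
     Poly_Mapping.lookup u (1 # ns) * Poly_Mapping.lookup (?b (1 # ns)) (1 # ns) +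
     Poly_Mapping.lookup u (2 # ns[r := ns ! r - 1]) * Poly_Mapping.lookup (?b (2 # ns[r := ns ! r - 1])) (1 # ns)"
    unfolding L_op_def
  proof (rule lookup_lin_ext_two)
    fix js assume js: "js \<in> Poly_Mapping.keys u" "js \<noteq> 1 # ns" "js \<noteq> 2 # ns[r := ns ! r - 1]"
    obtain a ms where am: "js = a # ms" "a = 1 \<or> a = 2" "length ms = N" using keys[OF js(1)] by blast
    have "ns \<noteq> ms[r := ms ! r + 1]" if "a = 2" using js(3) am that r by auto
    then show "Poly_Mapping.lookup (?b js) (1 # ns) = 0"
      unfolding lookup_L_op_basis using am js(2) by (auto simp: Let_def)
  qed simp
  then show "Poly_Mapping.lookup (L_op \<eta> l x r u) (1 # ns) =
      A_coeff \<eta> l x (of_nat (ns ! r)) * Poly_Mapping.lookup u (1 # ns)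
      + B_coeff \<eta> l x (of_nat (ns ! r) - 1) * Poly_Mapping.lookup u (2 # ns[r := ns ! r - 1])"
    unfolding lookup_L_op_basis using r ns by (simp add: Let_def of_nat_diff)
  have "Poly_Mapping.lookup (L_op \<eta> l x r u) (2 # ns) =
     Poly_Mapping.lookup u (1 # ns[r := ns ! r + 1]) * Poly_Mapping.lookup (?b (1 # ns[r := ns ! r + 1])) (2 # ns) +
     Poly_Mapping.lookup u (2 # ns) * Poly_Mapping.lookup (?b (2 # ns)) (2 # ns)"
    unfolding L_op_def
  proof (rule lookup_lin_ext_two)
    fix js assume js: "js \<in> Poly_Mapping.keys u" "js \<noteq> 1 # ns[r := ns ! r + 1]" "js \<noteq> 2 # ns"
    obtain a ms where am: "js = a # ms" "a = 1 \<or> a = 2" "length ms = N" using keys[OF js(1)] by blast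
    have "\<not> (ms ! r - 1 \<noteq> 0 \<and> ns = ms[r := ms ! r - 1])" if "a = 1" using js(2) am that r by auto
    then show "Poly_Mapping.lookup (?b js) (2 # ns) = 0"
      unfolding lookup_L_op_basis using am js(3) by (auto simp: Let_def)
  qed simp
  then show "Poly_Mapping.lookup (L_op \<eta> l x r u) (2 # ns) =
      C_coeff \<eta> l x (of_nat (ns ! r) + 1) * Poly_Mapping.lookup u (1 # ns[r := ns ! r + 1])
      + D_coeff \<eta> l x (of_nat (ns ! r)) * Poly_Mapping.lookup u (2 # ns)"
    unfolding lookup_L_op_basis using r ns by (simp add: Let_def add.commute)
qed

lemma aux_space_eqI:
  assumes "u \<in> aux_space N" "v \<in> aux_space N"
    and "\<And>a ns. a = 1 \<or> a = 2 \<Longrightarrow> length ns = N \<Longrightarrow> (\<And>i. i < N \<Longrightarrow> 1 \<le> ns ! i) \<Longrightarrow>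
      Poly_Mapping.lookup u (a # ns) = Poly_Mapping.lookup v (a # ns)"
  shows "u = v"
proof (rule poly_mapping_eqI)
  fix js
  show "Poly_Mapping.lookup u js = Poly_Mapping.lookup v js"
  proof (cases "\<exists>a ns. js = a # ns \<and> (a = 1 \<or> a = 2) \<and> length ns = N \<and> (\<forall>i<N. 1 \<le> ns ! i)")
    case True then show ?thesis using assms(3) by blast
  next
    case False then show ?thesis using assms(1,2) unfolding aux_space_iff by metis
  qed
qed

lemma L_op_inverse:
  assumes u: "u \<in> aux_space N" and r: "r < N" and \<eta>: "sinh \<eta> \<noteq> 0"
    and d: "sinh (x + (1/2 + l) * \<eta>) \<noteq> 0" "sinh (- x + (1/2 + l) * \<eta>) \<noteq> 0"
  shows "L_op \<eta> l x r (L_op \<eta> l (- x) r u) = u"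
proof (rule aux_space_eqI[OF _ u])
  let ?v = "L_op \<eta> l (- x) r u"
  have v: "?v \<in> aux_space N" by (rule L_op_in_aux_space[OF u r])
  then show "L_op \<eta> l x r ?v \<in> aux_space N" by (rule L_op_in_aux_space[OF _ r])
  fix a :: nat and ns :: "nat list" assume a: "a = 1 \<or> a = 2" and ns: "length ns = N" "\<And>i. i < N \<Longrightarrow> 1 \<le> ns ! i"
  let ?n = "of_nat (ns ! r) :: complex"
  note inv = L_coeff_inverse[OF \<eta> d, of ?n]
  have nr: "1 \<le> ns ! r" using ns r by blast
  show "Poly_Mapping.lookup (L_op \<eta> l x r ?v) (a # ns) = Poly_Mapping.lookup u (a # ns)"
  proof (cases "a = 1")
    case True
    have low: "Poly_Mapping.lookup ?v (2 # ns[r := ns ! r - 1]) =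
      C_coeff \<eta> l (- x) ?n * Poly_Mapping.lookup u (1 # ns) + D_coeff \<eta> l (- x) (?n - 1) * Poly_Mapping.lookup u (2 # ns[r := ns ! r - 1])"
    proof (cases "ns ! r = 1")
      case True
      have "Poly_Mapping.lookup w (2 # ns[r := ns ! r - 1]) = 0" if "w \<in> aux_space N" for w
        using aux_spaceD(3)[OF that _ r] True r ns by fastforce
      moreover have "C_coeff \<eta> l (- x) ?n = 0" using True by (simp add: C_coeff_def)
      ultimately show ?thesis using u v by simp
    next
      case False
      then have "1 \<le> ns[r := ns ! r - 1] ! r" "of_nat (ns ! r - 1) = ?n - 1" "Suc (ns ! r - 1) = ns ! r"
        using nr r ns(1) by (auto simp: of_nat_diff)
      then show ?thesis using lookup_L_op(2)[OF u r, of "ns[r := ns ! r - 1]" \<eta> l "- x"] ns r by simp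
    qed
    have "Poly_Mapping.lookup (L_op \<eta> l x r ?v) (1 # ns) =
      (A_coeff \<eta> l x ?n * A_coeff \<eta> l (- x) ?n + B_coeff \<eta> l x (?n - 1) * C_coeff \<eta> l (- x) ?n) * Poly_Mapping.lookup u (1 # ns)
      + (A_coeff \<eta> l x ?n * B_coeff \<eta> l (- x) (?n - 1) + B_coeff \<eta> l x (?n - 1) * D_coeff \<eta> l (- x) (?n - 1))
        * Poly_Mapping.lookup u (2 # ns[r := ns ! r - 1])"
      unfolding lookup_L_op(1)[OF v r ns(1) nr] lookup_L_op(1)[OF u r ns(1) nr] low by (simp add: algebra_simps)
    then show ?thesis using True inv(1,2) by simp
  next
    case False
    have high: "Poly_Mapping.lookup ?v (1 # ns[r := ns ! r + 1]) =
      A_coeff \<eta> l (- x) (?n + 1) * Poly_Mapping.lookup u (1 # ns[r := ns ! r + 1]) + B_coeff \<eta> l (- x) ?n * Poly_Mapping.lookup u (2 # ns)"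
      using lookup_L_op(1)[OF u r, of "ns[r := ns ! r + 1]" \<eta> l "- x"] ns r by (simp add: add.commute)
    have "Poly_Mapping.lookup (L_op \<eta> l x r ?v) (2 # ns) =
      (D_coeff \<eta> l x ?n * D_coeff \<eta> l (- x) ?n + C_coeff \<eta> l x (?n + 1) * B_coeff \<eta> l (- x) ?n) * Poly_Mapping.lookup u (2 # ns)
      + (D_coeff \<eta> l x ?n * C_coeff \<eta> l (- x) (?n + 1) + C_coeff \<eta> l x (?n + 1) * A_coeff \<eta> l (- x) (?n + 1))
        * Poly_Mapping.lookup u (1 # ns[r := ns ! r + 1])"
      unfolding lookup_L_op(2)[OF v r ns(1) nr] lookup_L_op(2)[OF u r ns(1) nr] high by (simp add: algebra_simps)
    then show ?thesis using False a inv(3,4) by simp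
  qed
qed

section \<open>Fusion of the monodromy\<close>

text \<open>The relation $j_s\,(\mathrm{pr}\,u) = \mathrm{pr}'\,u'$ read off on coefficients, with m = s - 1.
  It constrains only the coefficients of u' at labels of the tensor product of the two
  finite-dimensional modules.  The label of the auxiliary space, when there is one, counts as a part of
  the first list and moves the position to Suc m.\<close>

definition fused :: "complex \<Rightarrow> nat \<Rightarrow> nat \<Rightarrow> (nat list \<Rightarrow>\<^sub>0 complex) \<Rightarrow> (nat list \<Rightarrow>\<^sub>0 complex) \<Rightarrow> bool" where
  "fused \<eta> d m u u' \<longleftrightarrow> (\<forall>pre post p b. length pre = m \<and> 1 \<le> p \<and> p \<le> d + 1 \<and> (b = 1 \<or> b = 2) \<longrightarrow>
     Poly_Mapping.lookup u' (pre @ p # b # post)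
       = j_coeff \<eta> (of_nat d / 2) (of_nat p) b * Poly_Mapping.lookup u (pre @ (p + b - 1) # post))"

lemma fusedD:
  assumes "fused \<eta> d m u u'" "length pre = m" "1 \<le> p" "p \<le> d + 1" "b = 1 \<or> b = 2"
  shows "Poly_Mapping.lookup u' (pre @ p # b # post)
       = j_coeff \<eta> (of_nat d / 2) (of_nat p) b * Poly_Mapping.lookup u (pre @ (p + b - 1) # post)"
  using assms unfolding fused_def by blast

text \<open>At labels outside the auxiliary tensor product both sides are zero, so only the labels inside have to
  be checked.\<close>

lemma fused_auxI:
  assumes u: "u \<in> aux_space N" "u' \<in> aux_space (N + 1)" and m: "m < N"
    and eq: "\<And>a pre post p b. a = 1 \<or> a = 2 \<Longrightarrow> length pre = m \<Longrightarrow> length post = N - m - 1 \<Longrightarrow>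
      (\<And>n. n \<in> set pre \<union> set post \<Longrightarrow> 1 \<le> n) \<Longrightarrow> 1 \<le> p \<Longrightarrow> p \<le> d + 1 \<Longrightarrow> b = 1 \<or> b = 2 \<Longrightarrow>
      Poly_Mapping.lookup u' (a # pre @ p # b # post)
       = j_coeff \<eta> (of_nat d / 2) (of_nat p) b * Poly_Mapping.lookup u (a # pre @ (p + b - 1) # post)"
  shows "fused \<eta> d (Suc m) u u'"
  unfolding fused_def
proof (intro allI impI)
  fix qs post :: "nat list" and p b :: nat
  assume "length qs = Suc m \<and> 1 \<le> p \<and> p \<le> d + 1 \<and> (b = 1 \<or> b = 2)"
  then obtain a pre where qs: "qs = a # pre" "length pre = m" and p: "1 \<le> p" "p \<le> d + 1" "b = 1 \<or> b = 2"
    by (cases qs) auto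
  show "Poly_Mapping.lookup u' (qs @ p # b # post)
       = j_coeff \<eta> (of_nat d / 2) (of_nat p) b * Poly_Mapping.lookup u (qs @ (p + b - 1) # post)"
  proof (cases "(a = 1 \<or> a = 2) \<and> length post = N - m - 1 \<and> (\<forall>n \<in> set pre \<union> set post. 1 \<le> n)")
    case True
    then show ?thesis using eq[of a pre post p b] qs p by simp
  next
    case False
    have "Poly_Mapping.lookup w (a # pre @ ms @ post) = 0"
      if w: "w \<in> aux_space N'" and len: "N' = m + length ms + (N - m - 1)" for w N' and ms :: "nat list"
    proof (rule ccontr)
      assume nz: "Poly_Mapping.lookup w (a # pre @ ms @ post) \<noteq> 0"
      note D = aux_spaceD[OF w nz]
      have "1 \<le> n" if "n \<in> set pre \<union> set post" for n
      proof -
        from that obtain i where "i < length (pre @ ms @ post)" "n = (pre @ ms @ post) ! i"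
          by (metis Un_iff in_set_conv_nth set_append)
        then show ?thesis using D(2,3) by metis
      qed
      then show False using False D(1,2) len qs(2) by auto
    qed
    from this[OF u(1), of "[p + b - 1]"] this[OF u(2), of "[p, b]"] show ?thesis using qs m by simp
  qed
qed

lemma aux_lookup_0:
  assumes "u \<in> aux_space N" "0 \<in> set ns" shows "Poly_Mapping.lookup u (a # ns) = 0"
  using aux_spaceD(2,3)[OF assms(1), of a ns] assms(2) by (fastforce simp: in_set_conv_nth)

text \<open>The operator changes a label that the fusion map does not see; only the numbering of the sites to the
  right of the split site is shifted.\<close>

lemma fused_L_op_other:
  assumes u: "u \<in> aux_space N" "u' \<in> aux_space (N + 1)" and m: "m < N" and r: "r < N" "r \<noteq> m"
    and f: "fused \<eta> d (Suc m) u u'"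
  shows "fused \<eta> d (Suc m) (L_op \<eta> l x r u) (L_op \<eta> l x (if r < m then r else Suc r) u')"
proof (rule fused_auxI[OF _ _ m])
  let ?r = "if r < m then r else Suc r"
  have r': "?r < N + 1" using r m by auto
  show "L_op \<eta> l x r u \<in> aux_space N" "L_op \<eta> l x ?r u' \<in> aux_space (N + 1)"
    using L_op_in_aux_space u r r' by blast+
  fix a :: nat and pre post :: "nat list" and p b :: nat
  assume a: "a = 1 \<or> a = 2" and len: "length pre = m" "length post = N - m - 1"
    and ge: "\<And>n. n \<in> set pre \<union> set post \<Longrightarrow> 1 \<le> n" and p: "1 \<le> p" "p \<le> d + 1" "b = 1 \<or> b = 2"
  let ?J = "j_coeff \<eta> (of_nat d / 2) (of_nat p) b"
  let ?ns = "pre @ (p + b - 1) # post" and ?ns' = "pre @ p # b # post"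
  have same: "?ns' ! ?r = ?ns ! r"
  proof (cases "r < m")
    case True then show ?thesis using len by (simp add: nth_append)
  next
    case False
    then obtain i where "r = Suc (m + i)" using r by (metis less_imp_Suc_add nat_neq_iff)
    then show ?thesis using len by (simp add: nth_append)
  qed
  have upd: "\<exists>pre' post'. length pre' = m \<and> ?ns[r := z] = pre' @ (p + b - 1) # post' \<and> ?ns'[?r := z] = pre' @ p # b # post'" for z
  proof (cases "r < m")
    case True
    then show ?thesis using len by (intro exI[of _ "pre[r := z]"] exI[of _ post]) (simp add: list_update_append1)
  next
    case False
    then obtain i where "r = Suc (m + i)" using r by (metis less_imp_Suc_add nat_neq_iff)
    then show ?thesis using len by (intro exI[of _ pre] exI[of _ "post[i := z]"]) (simp add: list_update_append)
  qed
  have rel: "Poly_Mapping.lookup u' (c # ?ns'[?r := z]) = ?J * Poly_Mapping.lookup u (c # ?ns[r := z])" for c z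
  proof -
    obtain pre' post' where e: "length pre' = m" "?ns[r := z] = pre' @ (p + b - 1) # post'" "?ns'[?r := z] = pre' @ p # b # post'"
      using upd by blast
    show ?thesis using fusedD[OF f, of "c # pre'" p b post'] e p by simp
  qed
  have rel0: "Poly_Mapping.lookup u' (c # ?ns') = ?J * Poly_Mapping.lookup u (c # ?ns)" for c
    using fusedD[OF f, of "c # pre" p b post] len p by simp
  have l1: "length ?ns = N" "length ?ns' = N + 1" using len m by auto
  have "?ns ! r \<in> set pre \<union> set post"
  proof (cases "r < m")
    case True then show ?thesis using len by (simp add: nth_append)
  next
    case False
    then obtain i where "r = Suc (m + i)" using r by (metis less_imp_Suc_add nat_neq_iff)
    then show ?thesis using len r by (simp add: nth_append)
  qed
  then have l2: "1 \<le> ?ns ! r" by (rule ge)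
  then have l2': "1 \<le> ?ns' ! ?r" unfolding same .
  show "Poly_Mapping.lookup (L_op \<eta> l x ?r u') (a # ?ns') = ?J * Poly_Mapping.lookup (L_op \<eta> l x r u) (a # ?ns)"
    using a lookup_L_op[OF u(1) r(1) l1(1) l2] lookup_L_op[OF u(2) r' l1(2) l2']
    unfolding same rel rel0 by (auto simp: algebra_simps)
qed

text \<open>At the label 0 both sides are zero, since sinh 0 = 0 in the coefficient of the fusion map.  At the label
  d + 2, one above the last label of the quotient, nothing is known about u', but the matrix element of
  the lowering operator out of this label is zero.\<close>

lemma fused_extended:
  assumes u: "u \<in> aux_space N" "u' \<in> aux_space (N + 1)" and f: "fused \<eta> d (Suc m) u u'"
    and len: "length pre = m" and b: "b = 1 \<or> b = 2"
  shows "p \<le> d + 1 \<Longrightarrow> Poly_Mapping.lookup u' (a # pre @ p # b # post)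
       = j_coeff \<eta> (of_nat d / 2) (of_nat p) b * Poly_Mapping.lookup u (a # pre @ (p + b - 1) # post)"
    and "p \<le> d + 1 \<Longrightarrow> C_coeff \<eta> (of_nat d / 2) x (of_nat p + 1) * Poly_Mapping.lookup u' (a # pre @ (p + 1) # b # post)
       = C_coeff \<eta> (of_nat d / 2) x (of_nat p + 1)
         * (j_coeff \<eta> (of_nat d / 2) (of_nat p + 1) b * Poly_Mapping.lookup u (a # pre @ (p + b) # post))"
proof -
  show "Poly_Mapping.lookup u' (a # pre @ p # b # post)
       = j_coeff \<eta> (of_nat d / 2) (of_nat p) b * Poly_Mapping.lookup u (a # pre @ (p + b - 1) # post)" if p: "p \<le> d + 1" for p
  proof (cases "p = 0")
    case True
    have "Poly_Mapping.lookup u' (a # pre @ p # b # post) = 0" using True by (intro aux_lookup_0[OF u(2)]) auto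
    moreover have "j_coeff \<eta> (of_nat d / 2) (of_nat p) b = 0 \<or> Poly_Mapping.lookup u (a # pre @ (p + b - 1) # post) = 0"
      using b
    proof
      assume "b = 1" then show ?thesis using True by (intro disjI2 aux_lookup_0[OF u(1)]) auto
    next
      assume "b = 2" then show ?thesis using True by (simp add: j_coeff_def)
    qed
    ultimately show ?thesis by auto
  next
    case False
    then show ?thesis using fusedD[OF f, of "a # pre" p b post] len b p by simp
  qed
  from this[of "p + 1"] show "C_coeff \<eta> (of_nat d / 2) x (of_nat p + 1) * Poly_Mapping.lookup u' (a # pre @ (p + 1) # b # post)
       = C_coeff \<eta> (of_nat d / 2) x (of_nat p + 1)
         * (j_coeff \<eta> (of_nat d / 2) (of_nat p + 1) b * Poly_Mapping.lookup u (a # pre @ (p + b) # post))"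
    if "p \<le> d + 1"
  proof (cases "p = d + 1")
    case True
    then show ?thesis by (simp add: C_coeff_def)
  next
    case False
    then have "p + 1 \<le> d + 1" using that by simp
    then show ?thesis using \<open>p + 1 \<le> d + 1 \<Longrightarrow> _\<close> by (simp add: add.commute)
  qed
qed

text \<open>Each coefficient of the right hand side is a combination of coefficients of u' at admissible labels;
  expressed through u it involves two coefficients, and their factors are the eight identities.\<close>

lemma fused_L_op:
  fixes y :: complex and d :: nat
  defines "k \<equiv> of_nat d / 2 :: complex"
  assumes u: "u \<in> aux_space N" "u' \<in> aux_space (N + 1)" and m: "m < N" and f: "fused \<eta> d (Suc m) u u'"
    and nz: "sinh \<eta> \<noteq> 0" "sinh (y + k * \<eta>) \<noteq> 0" "sinh (y + (k + 1) * \<eta>) \<noteq> 0"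
  shows "fused \<eta> d (Suc m) (L_op \<eta> (k + 1/2) y m u)
     (L_op \<eta> k (y - \<eta>/2) m (L_op \<eta> (1/2) (y + k * \<eta>) (Suc m) u'))"
proof (rule fused_auxI[OF _ _ m])
  have mN: "Suc m < N + 1" "m < N + 1" using m by auto
  let ?v = "L_op \<eta> (1/2) (y + k * \<eta>) (Suc m) u'"
  have v: "?v \<in> aux_space (N + 1)" by (rule L_op_in_aux_space[OF u(2) mN(1)])
  show "L_op \<eta> (k + 1/2) y m u \<in> aux_space N" "L_op \<eta> k (y - \<eta>/2) m ?v \<in> aux_space (N + 1)"
    using L_op_in_aux_space u v m mN by blast+
  fix a :: nat and pre post :: "nat list" and p b :: nat
  assume a: "a = 1 \<or> a = 2" and len: "length pre = m" "length post = N - m - 1"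
    and p: "1 \<le> p" "p \<le> d + 1" "b = 1 \<or> b = 2"
  define U where "U c n = Poly_Mapping.lookup u (c # pre @ n # post)" for c n :: nat
  define U' where "U' c q e = Poly_Mapping.lookup u' (c # pre @ q # e # post)" for c q e :: nat
  define V where "V c q e = Poly_Mapping.lookup ?v (c # pre @ q # e # post)" for c q e :: nat
  define J where "J q e = j_coeff \<eta> k q e" for q e
  define A1 B1 C1 D1 where "A1 = A_coeff \<eta> k (y - \<eta>/2)" and "B1 = B_coeff \<eta> k (y - \<eta>/2)"
    and "C1 = C_coeff \<eta> k (y - \<eta>/2)" and "D1 = D_coeff \<eta> k (y - \<eta>/2)"
  define A2 B2 C2 D2 where "A2 = A_coeff \<eta> (1/2) (y + k * \<eta>)" and "B2 = B_coeff \<eta> (1/2) (y + k * \<eta>)"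
    and "C2 = C_coeff \<eta> (1/2) (y + k * \<eta>)" and "D2 = D_coeff \<eta> (1/2) (y + k * \<eta>)"
  define A3 B3 C3 D3 where "A3 = A_coeff \<eta> (k + 1/2) y" and "B3 = B_coeff \<eta> (k + 1/2) y"
    and "C3 = C_coeff \<eta> (k + 1/2) y" and "D3 = D_coeff \<eta> (k + 1/2) y"
  note names = J_def A1_def B1_def C1_def D1_def A2_def B2_def C2_def D2_def A3_def B3_def C3_def D3_def
  have U': "U' c q e = J (of_nat q) e * U c (q + e - 1)" if "q \<le> d + 1" "e = 1 \<or> e = 2" for c q e
    unfolding U'_def J_def U_def k_def using fused_extended(1)[OF u f len(1) that(2,1)] .
  have CU': "C1 (of_nat q + 1) * U' c (q + 1) e = C1 (of_nat q + 1) * (J (of_nat q + 1) e * U c (q + e))"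
    if "q \<le> d + 1" "e = 1 \<or> e = 2" for c q e
    unfolding U'_def J_def U_def k_def C1_def using fused_extended(2)[OF u f len(1) that(2,1)] .
  have U'0: "U' c q 0 = 0" for c q unfolding U'_def by (intro aux_lookup_0[OF u(2)]) auto
  have V: "V 1 q 1 = A2 1 * U' 1 q 1" "V 1 q 2 = A2 2 * U' 1 q 2 + B2 1 * U' 2 q 1"
      "V 2 q 1 = C2 2 * U' 1 q 2 + D2 1 * U' 2 q 1" "V 2 q 2 = D2 2 * U' 2 q 2" for q
  proof -
    have "C2 3 = 0" by (simp add: C2_def C_coeff_def)
    then show "V 1 q 1 = A2 1 * U' 1 q 1" "V 1 q 2 = A2 2 * U' 1 q 2 + B2 1 * U' 2 q 1"
      "V 2 q 1 = C2 2 * U' 1 q 2 + D2 1 * U' 2 q 1" "V 2 q 2 = D2 2 * U' 2 q 2"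
      using lookup_L_op[OF u(2) mN(1), of "pre @ q # 1 # post" \<eta> "1/2" "y + k * \<eta>"]
        lookup_L_op[OF u(2) mN(1), of "pre @ q # 2 # post" \<eta> "1/2" "y + k * \<eta>"] len m U'0[of 2 q]
      unfolding V_def U'_def A2_def B2_def C2_def D2_def
      by (simp_all add: nth_append list_update_append numeral_2_eq_2)
  qed
  have R: "Poly_Mapping.lookup (L_op \<eta> k (y - \<eta>/2) m ?v) (1 # pre @ p # b # post)
       = A1 (of_nat p) * V 1 p b + B1 (of_nat p - 1) * V 2 (p - 1) b"
     "Poly_Mapping.lookup (L_op \<eta> k (y - \<eta>/2) m ?v) (2 # pre @ p # b # post)
       = C1 (of_nat p + 1) * V 1 (p + 1) b + D1 (of_nat p) * V 2 p b"
    using lookup_L_op[OF v mN(2), of "pre @ p # b # post" \<eta> k "y - \<eta>/2"] len m p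
    unfolding V_def A1_def B1_def C1_def D1_def by (simp_all add: nth_append list_update_append)
  have Q: "Poly_Mapping.lookup (L_op \<eta> (k + 1/2) y m u) (1 # pre @ n # post)
       = A3 (of_nat n) * U 1 n + B3 (of_nat n - 1) * U 2 (n - 1)"
     "Poly_Mapping.lookup (L_op \<eta> (k + 1/2) y m u) (2 # pre @ n # post)
       = C3 (of_nat n + 1) * U 1 (n + 1) + D3 (of_nat n) * U 2 n" if "1 \<le> n" for n
    using lookup_L_op[OF u(1) m, of "pre @ n # post" \<eta> "k + 1/2" y] len m that
    unfolding U_def A3_def B3_def C3_def D3_def by (simp_all add: nth_append list_update_append)
  note fc = fusion_coeffs[OF nz, of "of_nat p", folded names]
  have p1: "of_nat (p - 1) = (of_nat p - 1 :: complex)" using p by (simp add: of_nat_diff)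
  have "Poly_Mapping.lookup (L_op \<eta> k (y - \<eta>/2) m ?v) (a # pre @ p # b # post)
     = J (of_nat p) b * Poly_Mapping.lookup (L_op \<eta> (k + 1/2) y m u) (a # pre @ (p + b - 1) # post)"
  proof -
    consider "a = 1" "b = 1" | "a = 1" "b = 2" | "a = 2" "b = 1" | "a = 2" "b = 2" using a p by blast
    then show ?thesis
    proof cases
      case 1
      have "A1 (of_nat p) * V 1 p 1 + B1 (of_nat p - 1) * V 2 (p - 1) 1
        = (A1 (of_nat p) * A2 1 * J (of_nat p) 1 + B1 (of_nat p - 1) * C2 2 * J (of_nat p - 1) 2) * U 1 p
          + (B1 (of_nat p - 1) * D2 1 * J (of_nat p - 1) 1) * U 2 (p - 1)"
        using U'[of p 1 1] U'[of "p - 1" 2 1] U'[of "p - 1" 1 2] p p1 unfolding V by (simp add: algebra_simps)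
      then show ?thesis unfolding 1 R[unfolded 1] fc using Q(1)[of p] p by (simp add: algebra_simps)
    next
      case 2
      have "A1 (of_nat p) * V 1 p 2 + B1 (of_nat p - 1) * V 2 (p - 1) 2
        = (A1 (of_nat p) * A2 2 * J (of_nat p) 2) * U 1 (p + 1)
          + (A1 (of_nat p) * B2 1 * J (of_nat p) 1 + B1 (of_nat p - 1) * D2 2 * J (of_nat p - 1) 2) * U 2 p"
        using U'[of p 2 1] U'[of p 1 2] U'[of "p - 1" 2 2] p p1 unfolding V by (simp add: algebra_simps)
      then show ?thesis unfolding 2 R[unfolded 2] fc using Q(1)[of "p + 1"] p by (simp add: algebra_simps)
    next
      case 3
      have "C1 (of_nat p + 1) * V 1 (p + 1) 1 + D1 (of_nat p) * V 2 p 1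
        = A2 1 * (C1 (of_nat p + 1) * U' 1 (p + 1) 1) + D1 (of_nat p) * (C2 2 * U' 1 p 2 + D2 1 * U' 2 p 1)"
        unfolding V by (simp add: algebra_simps)
      also have "\<dots> = (C1 (of_nat p + 1) * A2 1 * J (of_nat p + 1) 1 + D1 (of_nat p) * C2 2 * J (of_nat p) 2) * U 1 (p + 1)
          + (D1 (of_nat p) * D2 1 * J (of_nat p) 1) * U 2 p"
        using CU'[of p 1 1] U'[of p 2 1] U'[of p 1 2] p by (simp add: algebra_simps)
      finally show ?thesis unfolding 3 R[unfolded 3] fc using Q(2)[of p] p by (simp add: algebra_simps)
    next
      case 4
      have "C1 (of_nat p + 1) * V 1 (p + 1) 2 + D1 (of_nat p) * V 2 p 2
        = A2 2 * (C1 (of_nat p + 1) * U' 1 (p + 1) 2) + B2 1 * (C1 (of_nat p + 1) * U' 2 (p + 1) 1)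
          + D1 (of_nat p) * (D2 2 * U' 2 p 2)"
        unfolding V by (simp add: algebra_simps)
      also have "\<dots> = (C1 (of_nat p + 1) * A2 2 * J (of_nat p + 1) 2) * U 1 (p + 2)
          + (C1 (of_nat p + 1) * B2 1 * J (of_nat p + 1) 1 + D1 (of_nat p) * D2 2 * J (of_nat p) 2) * U 2 (p + 1)"
      proof -
        have "p + 2 - 1 = p + 1" by simp
        then show ?thesis using p CU'[of p 2 1, OF p(2)] CU'[of p 1 2, OF p(2)] U'[of p 2 2, OF p(2)]
          by (simp only: simp_thms) (simp add: distrib_left distrib_right mult_ac)
      qed
      finally show ?thesis unfolding 4 R[unfolded 4] fc using Q(2)[of "p + 1"] p by (simp add: algebra_simps)
    qed
  qed
  then show "Poly_Mapping.lookup (L_op \<eta> k (y - \<eta>/2) m ?v) (a # pre @ p # b # post)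
     = j_coeff \<eta> (of_nat d / 2) (of_nat p) b * Poly_Mapping.lookup (L_op \<eta> (k + 1/2) y m u) (a # pre @ (p + b - 1) # post)"
    unfolding J_def k_def .
qed

lemma fused_L_op_reversed:
  fixes y :: complex and d :: nat
  defines "k \<equiv> of_nat d / 2 :: complex"
  assumes u: "u \<in> aux_space N" "u' \<in> aux_space (N + 1)" and m: "m < N" and f: "fused \<eta> d (Suc m) u u'"
    and nz: "sinh \<eta> \<noteq> 0" "sinh (y + (k + 1) * \<eta>) \<noteq> 0" "sinh (y + (1 - k) * \<eta>) \<noteq> 0"
  shows "fused \<eta> d (Suc m) (L_op \<eta> (k + 1/2) y m u)
     (L_op \<eta> (1/2) (y - k * \<eta>) (Suc m) (L_op \<eta> k (y + \<eta>/2) m u'))"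
proof (rule fused_auxI[OF _ _ m])
  have mN: "Suc m < N + 1" "m < N + 1" using m by auto
  let ?v = "L_op \<eta> k (y + \<eta>/2) m u'"
  have v: "?v \<in> aux_space (N + 1)" by (rule L_op_in_aux_space[OF u(2) mN(2)])
  show "L_op \<eta> (k + 1/2) y m u \<in> aux_space N" "L_op \<eta> (1/2) (y - k * \<eta>) (Suc m) ?v \<in> aux_space (N + 1)"
    using L_op_in_aux_space u v m mN by blast+
  fix a :: nat and pre post :: "nat list" and p b :: nat
  assume a: "a = 1 \<or> a = 2" and len: "length pre = m" "length post = N - m - 1"
    and p: "1 \<le> p" "p \<le> d + 1" "b = 1 \<or> b = 2"
  define U where "U c n = Poly_Mapping.lookup u (c # pre @ n # post)" for c n :: nat
  define U' where "U' c q e = Poly_Mapping.lookup u' (c # pre @ q # e # post)" for c q e :: nat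
  define V where "V c q e = Poly_Mapping.lookup ?v (c # pre @ q # e # post)" for c q e :: nat
  define J where "J q e = j_coeff \<eta> k q e" for q e
  define A1 B1 C1 D1 where "A1 = A_coeff \<eta> k (y + \<eta>/2)" and "B1 = B_coeff \<eta> k (y + \<eta>/2)"
    and "C1 = C_coeff \<eta> k (y + \<eta>/2)" and "D1 = D_coeff \<eta> k (y + \<eta>/2)"
  define A2 B2 C2 D2 where "A2 = A_coeff \<eta> (1/2) (y - k * \<eta>)" and "B2 = B_coeff \<eta> (1/2) (y - k * \<eta>)"
    and "C2 = C_coeff \<eta> (1/2) (y - k * \<eta>)" and "D2 = D_coeff \<eta> (1/2) (y - k * \<eta>)"
  define A3 B3 C3 D3 where "A3 = A_coeff \<eta> (k + 1/2) y" and "B3 = B_coeff \<eta> (k + 1/2) y"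
    and "C3 = C_coeff \<eta> (k + 1/2) y" and "D3 = D_coeff \<eta> (k + 1/2) y"
  note names = J_def A1_def B1_def C1_def D1_def A2_def B2_def C2_def D2_def A3_def B3_def C3_def D3_def
  have U': "U' c q e = J (of_nat q) e * U c (q + e - 1)" if "q \<le> d + 1" "e = 1 \<or> e = 2" for c q e
    unfolding U'_def J_def U_def k_def using fused_extended(1)[OF u f len(1) that(2,1)] .
  have CU': "C1 (of_nat q + 1) * U' c (q + 1) e = C1 (of_nat q + 1) * (J (of_nat q + 1) e * U c (q + e))"
    if "q \<le> d + 1" "e = 1 \<or> e = 2" for c q e
    unfolding U'_def J_def U_def k_def C1_def using fused_extended(2)[OF u f len(1) that(2,1)] .
  have U'0: "U' c q 0 = 0" for c q unfolding U'_def by (intro aux_lookup_0[OF u(2)]) auto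
  have V: "V 1 q b = A1 (of_nat q) * U' 1 q b + B1 (of_nat q - 1) * U' 2 (q - 1) b"
      "V 2 q b = C1 (of_nat q + 1) * U' 1 (q + 1) b + D1 (of_nat q) * U' 2 q b" if "1 \<le> q" for q b
    using lookup_L_op[OF u(2) mN(2), of "pre @ q # b # post" \<eta> k "y + \<eta>/2"] len m that
    unfolding V_def U'_def A1_def B1_def C1_def D1_def by (simp_all add: nth_append list_update_append)
  have V0: "V c q 0 = 0" for c q unfolding V_def by (intro aux_lookup_0[OF v]) auto
  have R: "Poly_Mapping.lookup (L_op \<eta> (1/2) (y - k * \<eta>) (Suc m) ?v) (1 # pre @ p # 1 # post) = A2 1 * V 1 p 1"
     "Poly_Mapping.lookup (L_op \<eta> (1/2) (y - k * \<eta>) (Suc m) ?v) (1 # pre @ p # 2 # post) = A2 2 * V 1 p 2 + B2 1 * V 2 p 1"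
     "Poly_Mapping.lookup (L_op \<eta> (1/2) (y - k * \<eta>) (Suc m) ?v) (2 # pre @ p # 1 # post) = C2 2 * V 1 p 2 + D2 1 * V 2 p 1"
     "Poly_Mapping.lookup (L_op \<eta> (1/2) (y - k * \<eta>) (Suc m) ?v) (2 # pre @ p # 2 # post) = D2 2 * V 2 p 2"
  proof -
    have "C2 3 = 0" by (simp add: C2_def C_coeff_def)
    then show "Poly_Mapping.lookup (L_op \<eta> (1/2) (y - k * \<eta>) (Suc m) ?v) (1 # pre @ p # 1 # post) = A2 1 * V 1 p 1"
     "Poly_Mapping.lookup (L_op \<eta> (1/2) (y - k * \<eta>) (Suc m) ?v) (1 # pre @ p # 2 # post) = A2 2 * V 1 p 2 + B2 1 * V 2 p 1"
     "Poly_Mapping.lookup (L_op \<eta> (1/2) (y - k * \<eta>) (Suc m) ?v) (2 # pre @ p # 1 # post) = C2 2 * V 1 p 2 + D2 1 * V 2 p 1"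
     "Poly_Mapping.lookup (L_op \<eta> (1/2) (y - k * \<eta>) (Suc m) ?v) (2 # pre @ p # 2 # post) = D2 2 * V 2 p 2"
      using lookup_L_op[OF v mN(1), of "pre @ p # 1 # post" \<eta> "1/2" "y - k * \<eta>"]
        lookup_L_op[OF v mN(1), of "pre @ p # 2 # post" \<eta> "1/2" "y - k * \<eta>"] len m V0[of 2 p]
      unfolding V_def A2_def B2_def C2_def D2_def
      by (simp_all add: nth_append list_update_append numeral_2_eq_2)
  qed
  have Q: "Poly_Mapping.lookup (L_op \<eta> (k + 1/2) y m u) (1 # pre @ n # post)
       = A3 (of_nat n) * U 1 n + B3 (of_nat n - 1) * U 2 (n - 1)"
     "Poly_Mapping.lookup (L_op \<eta> (k + 1/2) y m u) (2 # pre @ n # post)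
       = C3 (of_nat n + 1) * U 1 (n + 1) + D3 (of_nat n) * U 2 n" if "1 \<le> n" for n
    using lookup_L_op[OF u(1) m, of "pre @ n # post" \<eta> "k + 1/2" y] len m that
    unfolding U_def A3_def B3_def C3_def D3_def by (simp_all add: nth_append list_update_append)
  note fc = fusion_coeffs_reversed[OF nz, of "of_nat p", folded names]
  have p1: "of_nat (p - 1) = (of_nat p - 1 :: complex)" using p by (simp add: of_nat_diff)
  have "Poly_Mapping.lookup (L_op \<eta> (1/2) (y - k * \<eta>) (Suc m) ?v) (a # pre @ p # b # post)
     = J (of_nat p) b * Poly_Mapping.lookup (L_op \<eta> (k + 1/2) y m u) (a # pre @ (p + b - 1) # post)"
  proof -
    consider "a = 1" "b = 1" | "a = 1" "b = 2" | "a = 2" "b = 1" | "a = 2" "b = 2" using a p by blast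
    then show ?thesis
    proof cases
      case 1
      have "A2 1 * V 1 p 1 = (A2 1 * A1 (of_nat p) * J (of_nat p) 1) * U 1 p
          + (A2 1 * B1 (of_nat p - 1) * J (of_nat p - 1) 1) * U 2 (p - 1)"
        using U'[of p 1 1] U'[of "p - 1" 1 2] p p1 V(1)[of p 1] by (simp add: algebra_simps)
      then show ?thesis unfolding 1 R fc using Q(1)[of p] p by (simp add: algebra_simps)
    next
      case 2
      have "A2 2 * V 1 p 2 + B2 1 * V 2 p 1
        = A2 2 * (A1 (of_nat p) * U' 1 p 2 + B1 (of_nat p - 1) * U' 2 (p - 1) 2)
          + B2 1 * (C1 (of_nat p + 1) * U' 1 (p + 1) 1) + B2 1 * (D1 (of_nat p) * U' 2 p 1)"
        using V(1)[of p 2] V(2)[of p 1] p(1) by (simp add: distrib_left)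
      also have "\<dots> = (A2 2 * A1 (of_nat p) * J (of_nat p) 2 + B2 1 * C1 (of_nat p + 1) * J (of_nat p + 1) 1) * U 1 (p + 1)
          + (A2 2 * B1 (of_nat p - 1) * J (of_nat p - 1) 2 + B2 1 * D1 (of_nat p) * J (of_nat p) 1) * U 2 p"
        unfolding CU'[of p 1 1, OF p(2) disjI1[OF refl]] using U'[of p 2 1] U'[of p 1 2] U'[of "p - 1" 2 2] p p1
        by (simp add: algebra_simps)
      finally show ?thesis unfolding 2 R fc using Q(1)[of "p + 1"] p by (simp add: algebra_simps)
    next
      case 3
      have "C2 2 * V 1 p 2 + D2 1 * V 2 p 1
        = C2 2 * (A1 (of_nat p) * U' 1 p 2 + B1 (of_nat p - 1) * U' 2 (p - 1) 2)
          + D2 1 * (C1 (of_nat p + 1) * U' 1 (p + 1) 1) + D2 1 * (D1 (of_nat p) * U' 2 p 1)"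
        using V(1)[of p 2] V(2)[of p 1] p(1) by (simp add: distrib_left)
      also have "\<dots> = (C2 2 * A1 (of_nat p) * J (of_nat p) 2 + D2 1 * C1 (of_nat p + 1) * J (of_nat p + 1) 1) * U 1 (p + 1)
          + (C2 2 * B1 (of_nat p - 1) * J (of_nat p - 1) 2 + D2 1 * D1 (of_nat p) * J (of_nat p) 1) * U 2 p"
        unfolding CU'[of p 1 1, OF p(2) disjI1[OF refl]] using U'[of p 2 1] U'[of p 1 2] U'[of "p - 1" 2 2] p p1
        by (simp add: algebra_simps)
      finally show ?thesis unfolding 3 R fc using Q(2)[of p] p by (simp add: algebra_simps)
    next
      case 4
      have "D2 2 * V 2 p 2 = D2 2 * (C1 (of_nat p + 1) * U' 1 (p + 1) 2) + D2 2 * (D1 (of_nat p) * U' 2 p 2)"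
        using V(2)[of p 2] p(1) by (simp add: distrib_left)
      also have "\<dots> = (D2 2 * C1 (of_nat p + 1) * J (of_nat p + 1) 2) * U 1 (p + 2)
          + (D2 2 * D1 (of_nat p) * J (of_nat p) 2) * U 2 (p + 1)"
        unfolding CU'[of p 2 1, OF p(2) disjI2[OF refl]] using U'[of p 2 2] p
        by (simp add: algebra_simps)
      finally show ?thesis unfolding 4 R fc using Q(2)[of "p + 1"] p by (simp add: algebra_simps)
    qed
  qed
  then show "Poly_Mapping.lookup (L_op \<eta> (1/2) (y - k * \<eta>) (Suc m) ?v) (a # pre @ p # b # post)
     = j_coeff \<eta> (of_nat d / 2) (of_nat p) b * Poly_Mapping.lookup (L_op \<eta> (k + 1/2) y m u) (a # pre @ (p + b - 1) # post)"
    unfolding J_def k_def .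
qed

definition compose_ops :: "('r \<Rightarrow> 'a \<Rightarrow> 'a) \<Rightarrow> 'r list \<Rightarrow> 'a \<Rightarrow> 'a" where
  "compose_ops f rs = foldr (\<lambda>r R. f r \<circ> R) rs id"

lemma compose_ops_simps [simp]:
  "compose_ops f [] u = u" "compose_ops f (r # rs) u = f r (compose_ops f rs u)"
  by (simp_all add: compose_ops_def)

lemma compose_ops_append: "compose_ops f (rs @ ss) u = compose_ops f rs (compose_ops f ss u)"
  by (induction rs) auto

lemma compose_ops_mem:
  assumes "\<And>r u. r \<in> set rs \<Longrightarrow> u \<in> A \<Longrightarrow> f r u \<in> A" "u \<in> A" shows "compose_ops f rs u \<in> A"
  using assms by (induction rs) auto

lemma compose_ops_inverse:
  assumes "\<And>r u. r \<in> set rs \<Longrightarrow> u \<in> A \<Longrightarrow> g r u \<in> A" 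
    and "\<And>r u. r \<in> set rs \<Longrightarrow> u \<in> A \<Longrightarrow> f r (g r u) = u" and "u \<in> A"
  shows "compose_ops f rs (compose_ops g (rev rs) u) = u"
  using assms
proof (induction rs arbitrary: u)
  case (Cons r rs)
  have "compose_ops f rs (compose_ops g (rev rs) (g r u)) = g r u" using Cons by (intro Cons.IH) (use Cons.prems in auto)
  then show ?case using Cons.prems by (simp add: compose_ops_append)
qed simp

lemma inv_into_eq_of_inverse:
  assumes "\<And>u. u \<in> A \<Longrightarrow> f u \<in> A" "\<And>u. u \<in> A \<Longrightarrow> g u \<in> A" "\<And>u. u \<in> A \<Longrightarrow> f (g u) = u" "\<And>u. u \<in> A \<Longrightarrow> g (f u) = u"
    and "v \<in> A"
  shows "inv_into A f v = g v"
proof (rule inv_into_f_eq)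
  show "inj_on f A" by (rule inj_on_inverseI[of A g]) (rule assms(4))
qed (use assms in auto)

text \<open>The L-operators at the spectral parameters $\pm(x - t_r)$ have no pole, so that they are inverse to
  each other.\<close>

definition nonsingular :: "complex \<Rightarrow> complex list \<Rightarrow> complex \<Rightarrow> complex list \<Rightarrow> bool" where
  "nonsingular \<eta> ls x t \<longleftrightarrow> (\<forall>r<length ls. sinh ((x - t ! r) + (1/2 + ls ! r) * \<eta>) \<noteq> 0 \<and>
     sinh (- (x - t ! r) + (1/2 + ls ! r) * \<eta>) \<noteq> 0)"

text \<open>The inverse monodromy made explicit, so that no inverse has to be taken in the infinite-dimensional
  module.\<close>

definition T_inv :: "complex \<Rightarrow> complex list \<Rightarrow> complex \<Rightarrow> complex list \<Rightarrow> (nat list \<Rightarrow>\<^sub>0 complex) \<Rightarrow> nat list \<Rightarrow>\<^sub>0 complex" where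
  "T_inv \<eta> ls x t = compose_ops (\<lambda>r. L_op \<eta> (ls ! r) (- (x - t ! r)) r) (rev [0..<length ls])"

lemma T_op_eq: "T_op \<eta> ls x t = compose_ops (\<lambda>r. L_op \<eta> (ls ! r) (x - t ! r) r) [0..<length ls]"
  by (simp add: T_op_def compose_ops_def)

lemma T_op_in_aux_space: "u \<in> aux_space (length ls) \<Longrightarrow> T_op \<eta> ls x t u \<in> aux_space (length ls)"
  unfolding T_op_eq by (rule compose_ops_mem) (auto intro: L_op_in_aux_space)

lemma T_inv_in_aux_space: "u \<in> aux_space (length ls) \<Longrightarrow> T_inv \<eta> ls x t u \<in> aux_space (length ls)"
  unfolding T_inv_def by (rule compose_ops_mem) (auto intro: L_op_in_aux_space)

lemma inv_T_op:
  assumes \<eta>: "sinh \<eta> \<noteq> 0" and ns: "nonsingular \<eta> ls x t" and u: "u \<in> aux_space (length ls)"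
  shows "inv_into (aux_space (length ls)) (T_op \<eta> ls x t) u = T_inv \<eta> ls x t u"
proof (rule inv_into_eq_of_inverse[OF T_op_in_aux_space T_inv_in_aux_space _ _ u])
  fix u assume u: "u \<in> aux_space (length ls)"
  show "T_op \<eta> ls x t (T_inv \<eta> ls x t u) = u"
    unfolding T_op_eq T_inv_def
  proof (rule compose_ops_inverse[OF _ _ u])
    fix r v assume r: "r \<in> set [0..<length ls]" and v: "v \<in> aux_space (length ls)"
    then show "L_op \<eta> (ls ! r) (- (x - t ! r)) r v \<in> aux_space (length ls)" by (auto intro: L_op_in_aux_space)
    show "L_op \<eta> (ls ! r) (x - t ! r) r (L_op \<eta> (ls ! r) (- (x - t ! r)) r v) = v"
      by (rule L_op_inverse[OF v _ \<eta>]) (use r ns in \<open>auto simp: nonsingular_def\<close>)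
  qed
  have "compose_ops (\<lambda>r. L_op \<eta> (ls ! r) (- (x - t ! r)) r) (rev [0..<length ls])
      (compose_ops (\<lambda>r. L_op \<eta> (ls ! r) (x - t ! r) r) (rev (rev [0..<length ls])) u) = u"
  proof (rule compose_ops_inverse[OF _ _ u])
    fix r v assume r: "r \<in> set (rev [0..<length ls])" and v: "v \<in> aux_space (length ls)"
    then show "L_op \<eta> (ls ! r) (x - t ! r) r v \<in> aux_space (length ls)" by (auto intro: L_op_in_aux_space)
    have "L_op \<eta> (ls ! r) (- (x - t ! r)) r (L_op \<eta> (ls ! r) (- (- (x - t ! r))) r v) = v"
      by (rule L_op_inverse[OF v _ \<eta>]) (use r ns in \<open>auto simp: nonsingular_def\<close>)
    then show "L_op \<eta> (ls ! r) (- (x - t ! r)) r (L_op \<eta> (ls ! r) (x - t ! r) r v) = v" by simp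
  qed
  then show "T_inv \<eta> ls x t (T_op \<eta> ls x t u) = u" unfolding T_op_eq T_inv_def by simp
qed auto

lemma lookup_K_op:
  assumes "u \<in> aux_space N"
  shows "Poly_Mapping.lookup (K_op \<xi> x u) js
    = (if hd js = 1 then 1 else sinh (\<xi> - x) / sinh (\<xi> + x)) * Poly_Mapping.lookup u js"
proof -
  have "Poly_Mapping.lookup (K_op \<xi> x u) js = Poly_Mapping.lookup u js * Poly_Mapping.lookup
     (if hd js = 1 then basis_vec js else smult_vec (sinh (\<xi> - x) / sinh (\<xi> + x)) (basis_vec js)) js"
    unfolding K_op_def by (rule lookup_lin_ext_one) (auto simp: lookup_basis_vec)
  then show ?thesis by (simp add: lookup_basis_vec)
qed

lemma K_op_in_aux_space: "u \<in> aux_space N \<Longrightarrow> K_op \<xi> x u \<in> aux_space N"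
  using lookup_K_op[of u N \<xi> x] unfolding aux_space_iff by auto

lemma inv_K_op:
  assumes "sinh (\<xi> - x) \<noteq> 0" "sinh (\<xi> + x) \<noteq> 0" and u: "u \<in> aux_space N"
  shows "inv_into (aux_space N) (K_op \<xi> x) u = K_op \<xi> (- x) u"
proof (rule inv_into_eq_of_inverse[OF K_op_in_aux_space K_op_in_aux_space _ _ u])
  fix u assume u: "u \<in> aux_space N"
  show "K_op \<xi> x (K_op \<xi> (- x) u) = u" "K_op \<xi> (- x) (K_op \<xi> x u) = u"
    using assms by (auto intro!: poly_mapping_eqI simp: lookup_K_op[OF K_op_in_aux_space[OF u]] lookup_K_op[OF u])
qed

definition state_space :: "nat \<Rightarrow> (nat list \<Rightarrow>\<^sub>0 complex) set" where
  "state_space N = tensor_space (replicate N M_idx)"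

lemma state_space_iff:
  "u \<in> state_space N \<longleftrightarrow> (\<forall>ns. Poly_Mapping.lookup u ns \<noteq> 0 \<longrightarrow> length ns = N \<and> (\<forall>i<N. 1 \<le> ns ! i))"
  unfolding state_space_def tensor_space_def by (auto simp: in_keys_iff in_listset_iff subset_iff)

lemma aux_tensor_in_aux_space:
  assumes u: "u \<in> state_space N" and a: "a = 1 \<or> a = 2" shows "aux_tensor a u \<in> aux_space N"
  unfolding aux_space_iff
proof (intro allI impI)
  fix js assume "Poly_Mapping.lookup (aux_tensor a u) js \<noteq> 0"
  then have js: "js \<noteq> []" "hd js = a" "Poly_Mapping.lookup u (tl js) \<noteq> 0"
    unfolding lookup_aux_tensor by (metis (full_types))+
  then show "\<exists>a ns. js = a # ns \<and> (a = 1 \<or> a = 2) \<and> length ns = N \<and> (\<forall>i<N. 1 \<le> ns ! i)"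
    using u a unfolding state_space_iff by (intro exI[of _ a] exI[of _ "tl js"]) (cases js; simp)
qed

lemma aux_coeff_in_state_space:
  assumes u: "u \<in> aux_space N" shows "aux_coeff a u \<in> state_space N"
  unfolding state_space_iff lookup_aux_coeff[OF u] using aux_spaceD(2,3)[OF u] by blast

lemma B_bdry_eq:
  assumes \<eta>: "sinh \<eta> \<noteq> 0" and ns: "nonsingular \<eta> ls x t" and K: "sinh (\<xi> - x) \<noteq> 0" "sinh (\<xi> + x) \<noteq> 0"
    and u: "u \<in> state_space (length ls)"
  shows "B_bdry \<eta> \<xi> ls x t u = aux_coeff 1 (T_inv \<eta> ls x t (K_op \<xi> (- x) (T_op \<eta> ls (- x) t (aux_tensor 2 u))))"
proof -
  have "aux_tensor 2 u \<in> aux_space (length ls)" using u by (rule aux_tensor_in_aux_space) simp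
  then have T: "T_op \<eta> ls (- x) t (aux_tensor 2 u) \<in> aux_space (length ls)" by (rule T_op_in_aux_space)
  then have KT: "K_op \<xi> (- x) (T_op \<eta> ls (- x) t (aux_tensor 2 u)) \<in> aux_space (length ls)" by (rule K_op_in_aux_space)
  show ?thesis
    by (simp only: B_bdry_def U_op_def o_apply inv_K_op[OF K T] inv_T_op[OF \<eta> ns KT])
qed

lemma B_bdry_in_state_space:
  assumes "sinh \<eta> \<noteq> 0" "nonsingular \<eta> ls x t" "sinh (\<xi> - x) \<noteq> 0" "sinh (\<xi> + x) \<noteq> 0" "u \<in> state_space (length ls)"
  shows "B_bdry \<eta> \<xi> ls x t u \<in> state_space (length ls)"
  unfolding B_bdry_eq[OF assms]
  by (intro aux_coeff_in_state_space T_inv_in_aux_space K_op_in_aux_space T_op_in_aux_space aux_tensor_in_aux_space assms) simp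

section \<open>Fusion of Bethe vectors\<close>

lemma nth_split_at:
  assumes "m < length xs"
  shows "split_at (Suc m) a b xs ! r = (if r < m then xs ! r else if r = m then a else if r = Suc m then b else xs ! (r - 1))"
proof -
  consider "r < m" | "r = m" | "r = Suc m" | i where "r = Suc (Suc (m + i))"
    using le_Suc_ex[of "Suc (Suc m)" r] by fastforce
  then show ?thesis
    using assms by cases (auto simp: split_at_def nth_append nth_Cons)
qed

lemma length_split_at: "m < length xs \<Longrightarrow> length (split_at (Suc m) a b xs) = Suc (length xs)"
  by (simp add: split_at_def)

lemma fused_compose_ops:
  assumes m: "m < N" and u: "u \<in> aux_space N" "u' \<in> aux_space (N + 1)"
    and f: "fused \<eta> d (Suc m) u u'"
    and rs: "set rs \<subseteq> {..<N} - {m}"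
    and eq: "\<And>r. r < N \<Longrightarrow> r \<noteq> m \<Longrightarrow> X' (if r < m then r else Suc r) = X r \<and> l' (if r < m then r else Suc r) = l r"
  shows "fused \<eta> d (Suc m) (compose_ops (\<lambda>r. L_op \<eta> (l r) (X r) r) rs u)
    (compose_ops (\<lambda>r. L_op \<eta> (l' r) (X' r) r) (map (\<lambda>r. if r < m then r else Suc r) rs) u')"
    and "compose_ops (\<lambda>r. L_op \<eta> (l r) (X r) r) rs u \<in> aux_space N"
    and "compose_ops (\<lambda>r. L_op \<eta> (l' r) (X' r) r) (map (\<lambda>r. if r < m then r else Suc r) rs) u' \<in> aux_space (N + 1)"
proof -
  have 1: "compose_ops (\<lambda>r. L_op \<eta> (l r) (X r) r) ss u \<in> aux_space N" if "set ss \<subseteq> {..<N} - {m}" for ss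
    by (rule compose_ops_mem[OF _ u(1)]) (use that in \<open>auto intro: L_op_in_aux_space\<close>)
  have 2: "compose_ops (\<lambda>r. L_op \<eta> (l' r) (X' r) r) (map (\<lambda>r. if r < m then r else Suc r) ss) u' \<in> aux_space (N + 1)"
    if "set ss \<subseteq> {..<N} - {m}" for ss
    by (rule compose_ops_mem[OF _ u(2)]) (use that m in \<open>auto intro!: L_op_in_aux_space split: if_splits\<close>)
  show "fused \<eta> d (Suc m) (compose_ops (\<lambda>r. L_op \<eta> (l r) (X r) r) rs u)
    (compose_ops (\<lambda>r. L_op \<eta> (l' r) (X' r) r) (map (\<lambda>r. if r < m then r else Suc r) rs) u')"
    using rs
  proof (induction rs)
    case (Cons r rs)
    then have r: "r < N" "r \<noteq> m" and rs: "set rs \<subseteq> {..<N} - {m}" by auto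
    show ?case
      using fused_L_op_other[OF 1[OF rs] 2[OF rs] m r Cons.IH[OF rs], of "l r" "X r"] eq[OF r] by simp
  qed (use f in simp)
  show "compose_ops (\<lambda>r. L_op \<eta> (l r) (X r) r) rs u \<in> aux_space N"
    "compose_ops (\<lambda>r. L_op \<eta> (l' r) (X' r) r) (map (\<lambda>r. if r < m then r else Suc r) rs) u' \<in> aux_space (N + 1)"
    by (rule 1[OF rs], rule 2[OF rs])
qed

lemma upt_split: "m < N \<Longrightarrow> [0..<N] = [0..<m] @ m # [Suc m..<N]"
  using upt_add_eq_append[of 0 m "N - m"] upt_conv_Cons[of m N] by simp

lemma upt_split_Suc:
  assumes "m < N"
  shows "[0..<Suc N] = map (\<lambda>r. if r < m then r else Suc r) [0..<m] @ m # Suc m # map (\<lambda>r. if r < m then r else Suc r) [Suc m..<N]"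
proof -
  have "map (\<lambda>r. if r < m then r else Suc r) [0..<m] = [0..<m]" by (rule map_idI) auto
  moreover have "map (\<lambda>r. if r < m then r else Suc r) [Suc m..<N] = map Suc [Suc m..<N]" by (rule map_cong) auto
  moreover have "[0..<Suc N] = [0..<m] @ m # Suc m # [Suc (Suc m)..<Suc N]"
    using upt_split[of m "Suc N"] upt_conv_Cons[of "Suc m" "Suc N"] assms by simp
  ultimately show ?thesis by (simp add: map_Suc_upt)
qed

context
  fixes \<eta> :: complex and d m N :: nat and ls t :: "complex list"
  assumes m: "m < N" and ls: "length ls = N" "ls ! m = of_nat d / 2 + 1/2" and t: "length t = N" and \<eta>: "sinh \<eta> \<noteq> 0"
begin

abbreviation "ls_split \<equiv> split_at (Suc m) (of_nat d / 2) (1/2) ls"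
abbreviation "t_split \<equiv> unfused_pt \<eta> (Suc m) d t"

lemma length_splits: "length ls_split = N + 1" "length t_split = N + 1"
  using m ls t by (simp_all add: length_split_at unfused_pt_def)

lemma nth_splits:
  "ls_split ! m = of_nat d / 2" "ls_split ! Suc m = 1/2"
  "t_split ! m = t ! m + \<eta>/2" "t_split ! Suc m = t ! m - of_nat d / 2 * \<eta>"
  "r < N \<Longrightarrow> r \<noteq> m \<Longrightarrow> ls_split ! (if r < m then r else Suc r) = ls ! r"
  "r < N \<Longrightarrow> r \<noteq> m \<Longrightarrow> t_split ! (if r < m then r else Suc r) = t ! r"
  using m ls t by (auto simp: nth_split_at unfused_pt_def)

lemma nonsingular_splitD:
  assumes "nonsingular \<eta> ls_split x t_split"
  shows "sinh (x - t ! m + of_nat d / 2 * \<eta>) \<noteq> 0" "sinh (x - t ! m + (of_nat d / 2 + 1) * \<eta>) \<noteq> 0"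
    "sinh (- (x - t ! m) + (of_nat d / 2 + 1) * \<eta>) \<noteq> 0" "sinh (- (x - t ! m) + (1 - of_nat d / 2) * \<eta>) \<noteq> 0"
proof -
  let ?k = "of_nat d / 2 :: complex"
  have e: "(x - (t ! m + \<eta>/2)) + (1/2 + ?k) * \<eta> = x - t ! m + ?k * \<eta>"
    "- (x - (t ! m + \<eta>/2)) + (1/2 + ?k) * \<eta> = - (x - t ! m) + (?k + 1) * \<eta>"
    "(x - (t ! m - ?k * \<eta>)) + (1/2 + 1/2) * \<eta> = x - t ! m + (?k + 1) * \<eta>"
    "- (x - (t ! m - ?k * \<eta>)) + (1/2 + 1/2) * \<eta> = - (x - t ! m) + (1 - ?k) * \<eta>"
    by (simp_all add: field_simps)
  have "m < length ls_split" "Suc m < length ls_split" using length_splits m by auto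
  from this[THEN assms[unfolded nonsingular_def, rule_format], unfolded nth_splits(1-4) e]
  show "sinh (x - t ! m + of_nat d / 2 * \<eta>) \<noteq> 0" "sinh (x - t ! m + (of_nat d / 2 + 1) * \<eta>) \<noteq> 0"
    "sinh (- (x - t ! m) + (of_nat d / 2 + 1) * \<eta>) \<noteq> 0" "sinh (- (x - t ! m) + (1 - of_nat d / 2) * \<eta>) \<noteq> 0"
    by blast+
qed

lemma fused_T_op:
  assumes u: "u \<in> aux_space N" "u' \<in> aux_space (N + 1)" and f: "fused \<eta> d (Suc m) u u'"
    and ns: "nonsingular \<eta> ls_split x t_split"
  shows "fused \<eta> d (Suc m) (T_op \<eta> ls x t u) (T_op \<eta> ls_split x t_split u')"
proof -
  let ?k = "of_nat d / 2 :: complex" and ?y = "x - t ! m" and ?s = "\<lambda>r. if r < m then r else Suc r"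
  let ?f = "\<lambda>r. L_op \<eta> (ls ! r) (x - t ! r) r" and ?f' = "\<lambda>r. L_op \<eta> (ls_split ! r) (x - t_split ! r) r"
  have eq: "x - t_split ! ?s r = x - t ! r \<and> ls_split ! ?s r = ls ! r" if "r < N" "r \<noteq> m" for r
    using nth_splits(5,6)[OF that] by simp
  have hi: "set [Suc m..<N] \<subseteq> {..<N} - {m}" and lo: "set [0..<m] \<subseteq> {..<N} - {m}" using m by auto
  define v v' where "v = compose_ops ?f [Suc m..<N] u" and "v' = compose_ops ?f' (map ?s [Suc m..<N]) u'"
  have v: "fused \<eta> d (Suc m) v v'" "v \<in> aux_space N" "v' \<in> aux_space (N + 1)"
    unfolding v_def v'_def
    by (rule fused_compose_ops[OF m u f hi, where X' = "\<lambda>r. x - t_split ! r" and l' = "\<lambda>r. ls_split ! r"]; rule eq; assumption)+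
  define w w' where "w = ?f m v" and "w' = ?f' m (?f' (Suc m) v')"
  have y: "x - t_split ! m = ?y - \<eta>/2" "x - t_split ! Suc m = ?y + ?k * \<eta>" by (simp_all add: nth_splits(3,4))
  have w: "fused \<eta> d (Suc m) w w'"
    unfolding w_def w'_def nth_splits(1,2) y ls(2)
    by (rule fused_L_op[OF v(2,3) m v(1) \<eta> nonsingular_splitD(1,2)[OF ns]])
  have w_mem: "w \<in> aux_space N" "w' \<in> aux_space (N + 1)"
    unfolding w_def w'_def by (intro L_op_in_aux_space v; use m in simp)+
  have "T_op \<eta> ls x t u = compose_ops ?f [0..<m] w"
    unfolding T_op_eq ls(1) upt_split[OF m] w_def v_def by (simp add: compose_ops_append)
  moreover have "T_op \<eta> ls_split x t_split u' = compose_ops ?f' (map ?s [0..<m]) w'"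
    unfolding T_op_eq length_splits Suc_eq_plus1[symmetric] upt_split_Suc[OF m] w'_def v'_def
    by (simp add: compose_ops_append)
  ultimately show ?thesis
    using fused_compose_ops(1)[OF m w_mem w lo, where X' = "\<lambda>r. x - t_split ! r" and l' = "\<lambda>r. ls_split ! r"
        and X = "\<lambda>r. x - t ! r" and l = "\<lambda>r. ls ! r"] eq by simp
qed

lemma fused_T_inv:
  assumes u: "u \<in> aux_space N" "u' \<in> aux_space (N + 1)" and f: "fused \<eta> d (Suc m) u u'"
    and ns: "nonsingular \<eta> ls_split x t_split"
  shows "fused \<eta> d (Suc m) (T_inv \<eta> ls x t u) (T_inv \<eta> ls_split x t_split u')"
proof -
  let ?k = "of_nat d / 2 :: complex" and ?y = "- (x - t ! m)" and ?s = "\<lambda>r. if r < m then r else Suc r"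
  let ?f = "\<lambda>r. L_op \<eta> (ls ! r) (- (x - t ! r)) r" and ?f' = "\<lambda>r. L_op \<eta> (ls_split ! r) (- (x - t_split ! r)) r"
  have eq: "- (x - t_split ! ?s r) = - (x - t ! r) \<and> ls_split ! ?s r = ls ! r" if "r < N" "r \<noteq> m" for r
    using nth_splits(5,6)[OF that] by simp
  have hi: "set (rev [Suc m..<N]) \<subseteq> {..<N} - {m}" and lo: "set (rev [0..<m]) \<subseteq> {..<N} - {m}" using m by auto
  define v v' where "v = compose_ops ?f (rev [0..<m]) u" and "v' = compose_ops ?f' (map ?s (rev [0..<m])) u'"
  have v: "fused \<eta> d (Suc m) v v'" "v \<in> aux_space N" "v' \<in> aux_space (N + 1)"
    unfolding v_def v'_def
    by (rule fused_compose_ops[OF m u f lo, where X' = "\<lambda>r. - (x - t_split ! r)" and l' = "\<lambda>r. ls_split ! r"]; rule eq; assumption)+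
  define w w' where "w = ?f m v" and "w' = ?f' (Suc m) (?f' m v')"
  have y: "- (x - t_split ! m) = ?y + \<eta>/2" "- (x - t_split ! Suc m) = ?y - ?k * \<eta>" by (simp_all add: nth_splits(3,4))
  have w: "fused \<eta> d (Suc m) w w'"
    unfolding w_def w'_def nth_splits(1,2) y ls(2)
    by (rule fused_L_op_reversed[OF v(2,3) m v(1) \<eta> nonsingular_splitD(3,4)[OF ns]])
  have w_mem: "w \<in> aux_space N" "w' \<in> aux_space (N + 1)"
    unfolding w_def w'_def by (intro L_op_in_aux_space v; use m in simp)+
  have "T_inv \<eta> ls x t u = compose_ops ?f (rev [Suc m..<N]) w"
    unfolding T_inv_def ls(1) upt_split[OF m] w_def v_def by (simp add: compose_ops_append)
  moreover have "T_inv \<eta> ls_split x t_split u' = compose_ops ?f' (map ?s (rev [Suc m..<N])) w'"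
    unfolding T_inv_def length_splits Suc_eq_plus1[symmetric] upt_split_Suc[OF m] w'_def v'_def
    by (simp add: compose_ops_append rev_map)
  ultimately show ?thesis
    using fused_compose_ops(1)[OF m w_mem w hi, where X' = "\<lambda>r. - (x - t_split ! r)" and l' = "\<lambda>r. ls_split ! r"
        and X = "\<lambda>r. - (x - t ! r)" and l = "\<lambda>r. ls ! r"] eq by simp
qed

lemma fused_K_op:
  assumes u: "u \<in> aux_space N" "u' \<in> aux_space (N + 1)" and f: "fused \<eta> d (Suc m) u u'"
  shows "fused \<eta> d (Suc m) (K_op \<xi> x u) (K_op \<xi> x u')"
  unfolding fused_def lookup_K_op[OF u(1)] lookup_K_op[OF u(2)]
proof (intro allI impI)
  fix qs post :: "nat list" and p b :: nat
  assume a: "length qs = Suc m \<and> 1 \<le> p \<and> p \<le> d + 1 \<and> (b = 1 \<or> b = 2)"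
  then have "hd (qs @ p # b # post) = hd qs" "hd (qs @ (p + b - 1) # post) = hd qs" by (auto simp: hd_append)
  then show "(if hd (qs @ p # b # post) = 1 then 1 else sinh (\<xi> - x) / sinh (\<xi> + x)) * Poly_Mapping.lookup u' (qs @ p # b # post)
    = j_coeff \<eta> (of_nat d / 2) (of_nat p) b
      * ((if hd (qs @ (p + b - 1) # post) = 1 then 1 else sinh (\<xi> - x) / sinh (\<xi> + x)) * Poly_Mapping.lookup u (qs @ (p + b - 1) # post))"
    using fusedD[OF f, of qs p b post] a by simp
qed

lemma fused_aux_tensor:
  assumes "fused \<eta> d m u u'" shows "fused \<eta> d (Suc m) (aux_tensor a u) (aux_tensor a u')"
  unfolding fused_def lookup_aux_tensor
proof (intro allI impI)
  fix qs post :: "nat list" and p b :: nat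
  assume a: "length qs = Suc m \<and> 1 \<le> p \<and> p \<le> d + 1 \<and> (b = 1 \<or> b = 2)"
  then obtain c pre where "qs = c # pre" "length pre = m" by (cases qs) auto
  then show "(if qs @ p # b # post \<noteq> [] \<and> hd (qs @ p # b # post) = a then Poly_Mapping.lookup u' (tl (qs @ p # b # post)) else 0)
    = j_coeff \<eta> (of_nat d / 2) (of_nat p) b * (if qs @ (p + b - 1) # post \<noteq> [] \<and> hd (qs @ (p + b - 1) # post) = a
       then Poly_Mapping.lookup u (tl (qs @ (p + b - 1) # post)) else 0)"
    using fusedD[OF assms, of pre p b post] a by simp
qed

lemma fused_aux_coeff:
  assumes u: "u \<in> aux_space N" "u' \<in> aux_space (N + 1)" and f: "fused \<eta> d (Suc m) u u'"
  shows "fused \<eta> d m (aux_coeff a u) (aux_coeff a u')"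
  unfolding fused_def lookup_aux_coeff[OF u(1)] lookup_aux_coeff[OF u(2)]
  using fusedD[OF f, of "a # _"] by simp

lemma fused_B_bdry:
  assumes u: "u \<in> state_space N" "u' \<in> state_space (N + 1)" and f: "fused \<eta> d m u u'"
    and ns: "nonsingular \<eta> ls x t" "nonsingular \<eta> ls_split x t_split" "nonsingular \<eta> ls_split (- x) t_split"
    and K: "sinh (\<xi> - x) \<noteq> 0" "sinh (\<xi> + x) \<noteq> 0"
  shows "fused \<eta> d m (B_bdry \<eta> \<xi> ls x t u) (B_bdry \<eta> \<xi> ls_split x t_split u')"
proof -
  let ?w = "aux_tensor 2 u" and ?w' = "aux_tensor 2 u'"
  have w: "?w \<in> aux_space N" "?w' \<in> aux_space (N + 1)" using u by (auto intro: aux_tensor_in_aux_space)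
  have Tw: "T_op \<eta> ls (- x) t ?w \<in> aux_space N" "T_op \<eta> ls_split (- x) t_split ?w' \<in> aux_space (N + 1)"
    using T_op_in_aux_space[of ?w ls] T_op_in_aux_space[of ?w' ls_split] w ls length_splits by auto
  let ?v = "K_op \<xi> (- x) (T_op \<eta> ls (- x) t ?w)" and ?v' = "K_op \<xi> (- x) (T_op \<eta> ls_split (- x) t_split ?w')"
  have v: "?v \<in> aux_space N" "?v' \<in> aux_space (N + 1)" using Tw by (auto intro: K_op_in_aux_space)
  have Tv: "T_inv \<eta> ls x t ?v \<in> aux_space N" "T_inv \<eta> ls_split x t_split ?v' \<in> aux_space (N + 1)"
    using T_inv_in_aux_space[of ?v ls] T_inv_in_aux_space[of ?v' ls_split] v ls length_splits by auto
  have "fused \<eta> d (Suc m) ?v ?v'"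
    by (intro fused_K_op[OF Tw] fused_T_op[OF w] fused_aux_tensor f ns)
  then have "fused \<eta> d m (aux_coeff 1 (T_inv \<eta> ls x t ?v)) (aux_coeff 1 (T_inv \<eta> ls_split x t_split ?v'))"
    by (intro fused_aux_coeff[OF Tv] fused_T_inv[OF v] ns)
  then show ?thesis
    using B_bdry_eq[OF \<eta> ns(1) K, of u] B_bdry_eq[OF \<eta> ns(2) K, of u'] u ls length_splits by simp
qed

text \<open>The scalar prefactors of the operators and of the summand are products over the sites, and fusion
  multiplies the factors at the two new sites.\<close>

lemma prod_splits:
  fixes g :: "complex \<Rightarrow> complex \<Rightarrow> complex"
  assumes "g (of_nat d / 2) (t ! m + \<eta>/2) * g (1/2) (t ! m - of_nat d / 2 * \<eta>) = g' (ls ! m) (t ! m)"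
    and "\<And>r. r < N \<Longrightarrow> r \<noteq> m \<Longrightarrow> g (ls ! r) (t ! r) = g' (ls ! r) (t ! r)"
  shows "(\<Prod>r<length ls_split. g (ls_split ! r) (t_split ! r)) = (\<Prod>r<length ls. g' (ls ! r) (t ! r))"
proof -
  let ?s = "\<lambda>r. if r < m then r else Suc r" and ?h = "\<lambda>r. g (ls_split ! r) (t_split ! r)"
  have "r \<in> insert m (insert (Suc m) (?s ` ({..<N} - {m})))" if r: "r < Suc N" for r
  proof -
    consider "r < m" | "r = m" | "r = Suc m" | "r > Suc m" by linarith
    then show ?thesis
    proof cases
      case 1
      then have "r = ?s r" "r \<in> {..<N} - {m}" using m by auto
      then show ?thesis by blast
    next
      case 4
      then have "r = ?s (r - 1)" "r - 1 \<in> {..<N} - {m}" using r by auto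
      then show ?thesis by blast
    qed auto
  qed
  then have "{..<Suc N} \<subseteq> insert m (insert (Suc m) (?s ` ({..<N} - {m})))"
    by (intro subsetI) (simp only: lessThan_iff)
  moreover have "insert m (insert (Suc m) (?s ` ({..<N} - {m}))) \<subseteq> {..<Suc N}"
    using m by (auto split: if_splits)
  ultimately have set: "{..<Suc N} = insert m (insert (Suc m) (?s ` ({..<N} - {m})))" by (rule equalityI)
  have inj: "inj_on ?s ({..<N} - {m})" by (auto simp: inj_on_def split: if_splits)
  have "(\<Prod>r<Suc N. ?h r) = ?h m * (?h (Suc m) * (\<Prod>r\<in>?s ` ({..<N} - {m}). ?h r))"
  proof -
    have A: "m \<notin> insert (Suc m) (?s ` ({..<N} - {m}))" "Suc m \<notin> ?s ` ({..<N} - {m})" by (auto split: if_splits)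
    have fin: "finite (?s ` ({..<N} - {m}))" by simp
    show ?thesis unfolding set prod.insert[OF finite.insertI[OF fin] A(1)] prod.insert[OF fin A(2)] ..
  qed
  also have "(\<Prod>r\<in>?s ` ({..<N} - {m}). ?h r) = (\<Prod>r\<in>{..<N} - {m}. ?h (?s r))"
    using prod.reindex[OF inj, of ?h] by simp
  also have "\<dots> = (\<Prod>r\<in>{..<N} - {m}. g' (ls ! r) (t ! r))"
  proof (rule prod.cong)
    fix r assume "r \<in> {..<N} - {m}"
    then have r: "r < N" "r \<noteq> m" by auto
    show "?h (?s r) = g' (ls ! r) (t ! r)" unfolding nth_splits(5,6)[OF r] by (rule assms(2)[OF r])
  qed simp
  also have "?h m * (?h (Suc m) * (\<Prod>r\<in>{..<N} - {m}. g' (ls ! r) (t ! r)))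
      = g' (ls ! m) (t ! m) * (\<Prod>r\<in>{..<N} - {m}. g' (ls ! r) (t ! r))"
    unfolding nth_splits(1-4) assms(1)[symmetric] by (simp add: mult.assoc)
  also have "\<dots> = (\<Prod>r<N. g' (ls ! r) (t ! r))" by (rule prod.remove[symmetric]) (use m in auto)
  finally show ?thesis using length_splits ls by simp
qed

lemma fused_smult_vec: "fused \<eta> d m u u' \<Longrightarrow> fused \<eta> d m (smult_vec c u) (smult_vec c u')"
  unfolding fused_def by simp

text \<open>At the split site the two scalar factors telescope to the factor of spin k + 1/2.  The factor that
  cancels is nonzero because its zeros are poles of the inverse monodromy.\<close>

lemma fused_B_bar:
  assumes u: "u \<in> state_space N" "u' \<in> state_space (N + 1)" and f: "fused \<eta> d m u u'"
    and ns: "nonsingular \<eta> ls (z + \<eta>/2) t" "nonsingular \<eta> ls_split (z + \<eta>/2) t_split" "nonsingular \<eta> ls_split (- (z + \<eta>/2)) t_split"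
    and K: "sinh (\<xi> - z - \<eta>/2) \<noteq> 0" "sinh (\<xi> + z + \<eta>/2) \<noteq> 0"
  shows "fused \<eta> d m (B_bar \<eta> \<xi> ls z t u) (B_bar \<eta> \<xi> ls_split z t_split u')"
proof -
  have "(\<Prod>r<length ls_split. sinh (z - t_split ! r - ls_split ! r * \<eta>) / sinh (z - t_split ! r + ls_split ! r * \<eta>))
    = (\<Prod>r<length ls. sinh (z - t ! r - ls ! r * \<eta>) / sinh (z - t ! r + ls ! r * \<eta>))"
  proof (rule prod_splits)
    have "- (z + \<eta>/2 - t ! m) + (1 - of_nat d / 2) * \<eta> = - (z - (t ! m + \<eta>/2) + of_nat d / 2 * \<eta>)"
      by (simp add: field_simps)
    then have nz: "sinh (z - (t ! m + \<eta>/2) + of_nat d / 2 * \<eta>) \<noteq> 0"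
      using nonsingular_splitD(4)[OF ns(2)] by (metis neg_equal_0_iff_equal sinh_minus)
    have e: "z - (t ! m - of_nat d / 2 * \<eta>) - 1/2 * \<eta> = z - (t ! m + \<eta>/2) + of_nat d / 2 * \<eta>"
      "z - (t ! m + \<eta>/2) - of_nat d / 2 * \<eta> = z - t ! m - (of_nat d / 2 + 1/2) * \<eta>"
      "z - (t ! m - of_nat d / 2 * \<eta>) + 1/2 * \<eta> = z - t ! m + (of_nat d / 2 + 1/2) * \<eta>"
      by (simp_all add: field_simps)
    show "sinh (z - (t ! m + \<eta>/2) - of_nat d / 2 * \<eta>) / sinh (z - (t ! m + \<eta>/2) + of_nat d / 2 * \<eta>)
      * (sinh (z - (t ! m - of_nat d / 2 * \<eta>) - 1/2 * \<eta>) / sinh (z - (t ! m - of_nat d / 2 * \<eta>) + 1/2 * \<eta>))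
      = sinh (z - t ! m - ls ! m * \<eta>) / sinh (z - t ! m + ls ! m * \<eta>)"
      unfolding ls(2) e using nz by simp
  qed simp
  then show ?thesis
    unfolding B_bar_def
    using fused_smult_vec[OF fused_B_bdry[OF u f ns]] K by (simp add: algebra_simps)
qed

end

section \<open>Regularity of the summand\<close>

text \<open>The conditions on $t_r$ under which a summand is regular: at both spectral parameters of the boundary
  monodromy the L-operators and their inverses have no pole, and neither do the scalar prefactor and
  the weight factors.  Each condition concerns a single coordinate and excludes a discrete set of values.\<close>

definition regular_coordinate :: "complex \<Rightarrow> complex \<Rightarrow> (complex \<Rightarrow> complex) \<Rightarrow> complex list \<Rightarrow> complex \<Rightarrow> bool" where
  "regular_coordinate \<eta> l f x z \<longleftrightarrow> (\<forall>w\<in>set x. \<forall>y\<in>{w + \<eta>/2, - (w + \<eta>/2)}.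
     sinh (y - z + (1/2 + l) * \<eta>) \<noteq> 0 \<and> sinh (- (y - z) + (1/2 + l) * \<eta>) \<noteq> 0) \<and>
     (\<forall>w\<in>set x. sinh (w - z + l * \<eta>) \<noteq> 0 \<and> isCont f (z + w) \<and> isCont f (z - w))"

definition regular_point :: "complex \<Rightarrow> (complex \<Rightarrow> complex \<Rightarrow> complex) \<Rightarrow> complex list \<Rightarrow> complex list \<Rightarrow> complex list \<Rightarrow> bool" where
  "regular_point \<eta> F ls x t \<longleftrightarrow> (\<forall>r<length ls. regular_coordinate \<eta> (ls ! r) (F (ls ! r)) x (t ! r))"

definition K_regular :: "complex \<Rightarrow> complex \<Rightarrow> complex list \<Rightarrow> bool" where
  "K_regular \<eta> \<xi> x \<longleftrightarrow> (\<forall>z\<in>set x. sinh (\<xi> - z - \<eta>/2) \<noteq> 0 \<and> sinh (\<xi> + z + \<eta>/2) \<noteq> 0)"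

lemma regular_point_nonsingular:
  assumes "regular_point \<eta> F ls x t" "z \<in> set x"
  shows "nonsingular \<eta> ls (z + \<eta>/2) t" "nonsingular \<eta> ls (- (z + \<eta>/2)) t"
    "r < length ls \<Longrightarrow> sinh (z - t ! r + ls ! r * \<eta>) \<noteq> 0"
  using assms unfolding regular_point_def regular_coordinate_def nonsingular_def by blast+

lemma eventually_at_shift:
  fixes z c :: complex
  assumes "\<And>z. eventually Q (at z)" shows "eventually (\<lambda>z. Q (z + c)) (at z)"
proof -
  obtain d where "d > 0" "\<And>x. x \<noteq> z + c \<Longrightarrow> dist x (z + c) < d \<Longrightarrow> Q x"
    using assms[of "z + c"] unfolding eventually_at by auto
  then show ?thesis unfolding eventually_at by (intro exI[of _ d]) auto
qed

lemma eventually_sinh_neq_0: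
  assumes s: "s \<noteq> 0" shows "eventually (\<lambda>z::complex. sinh (c + s * z) \<noteq> 0) (at z0)"
proof (cases "sinh (c + s * z0) = 0")
  case True
  have "((\<lambda>z. sinh (c + s * z)) has_field_derivative cosh (c + s * z0) * s) (at z0)"
    by (auto intro!: derivative_eq_intros)
  then have "((\<lambda>z. (sinh (c + s * z) - sinh (c + s * z0)) / (z - z0)) \<longlongrightarrow> cosh (c + s * z0) * s) (at z0)"
    by (simp add: has_field_derivative_iff)
  moreover have "cosh (c + s * z0) * s \<noteq> 0"
    using s True cosh_square_eq[of "c + s * z0"] by auto
  ultimately have "eventually (\<lambda>z. (sinh (c + s * z) - sinh (c + s * z0)) / (z - z0) \<noteq> 0) (at z0)"
    by (rule tendsto_imp_eventually_ne)
  then show ?thesis by eventually_elim (use True in auto)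
next
  case False
  have "((\<lambda>z. sinh (c + s * z)) \<longlongrightarrow> sinh (c + s * z0)) (at z0)" by (intro tendsto_intros)
  then show ?thesis using False by (rule tendsto_imp_eventually_ne)
qed

lemma eventually_regular_coordinate:
  assumes f: "f meromorphic_on UNIV" shows "eventually (regular_coordinate \<eta> l f x) (at z)"
proof -
  have cont: "eventually (isCont f) (at z)" for z
  proof -
    have "\<forall>\<^sub>\<approx>z\<in>UNIV. f analytic_on {z}" by (rule meromorphic_on_imp_analytic_cosparse[OF f])
    then have "eventually (\<lambda>z. f analytic_on {z}) (at z)" by (simp add: eventually_cosparse_open_eq)
    then show ?thesis by eventually_elim (rule analytic_at_imp_isCont)
  qed
  have c: "eventually (\<lambda>z. sinh (w - z + l * \<eta>) \<noteq> 0 \<and> isCont f (z + w) \<and> isCont f (z - w)) (at z)" for w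
  proof -
    have "eventually (\<lambda>z. sinh (w + l * \<eta> + (-1) * z) \<noteq> 0) (at z)" by (rule eventually_sinh_neq_0) simp
    then show ?thesis
      using eventually_at_shift[OF cont, of w z] eventually_at_shift[OF cont, of "- w" z]
      by eventually_elim (simp add: algebra_simps)
  qed
  have s: "eventually (\<lambda>z. sinh (y - z + (1/2 + l) * \<eta>) \<noteq> 0 \<and> sinh (- (y - z) + (1/2 + l) * \<eta>) \<noteq> 0) (at z)" for y
  proof -
    have "eventually (\<lambda>z. sinh (y + (1/2 + l) * \<eta> + (-1) * z) \<noteq> 0) (at z)"
      "eventually (\<lambda>z. sinh (- y + (1/2 + l) * \<eta> + 1 * z) \<noteq> 0) (at z)"
      by (rule eventually_sinh_neq_0; simp)+
    then show ?thesis by eventually_elim (simp add: algebra_simps)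
  qed
  have "eventually (\<lambda>z. \<forall>w\<in>set x. \<forall>y\<in>{w + \<eta>/2, - (w + \<eta>/2)}.
     sinh (y - z + (1/2 + l) * \<eta>) \<noteq> 0 \<and> sinh (- (y - z) + (1/2 + l) * \<eta>) \<noteq> 0) (at z)"
    by (intro eventually_ball_finite ballI s) auto
  moreover have "eventually (\<lambda>z. \<forall>w\<in>set x. sinh (w - z + l * \<eta>) \<noteq> 0 \<and> isCont f (z + w) \<and> isCont f (z - w)) (at z)"
    by (intro eventually_ball_finite ballI c) auto
  ultimately show ?thesis unfolding regular_coordinate_def by (rule eventually_conj)
qed

definition continuous_vec :: "complex list \<Rightarrow> (complex list \<Rightarrow> 'i \<Rightarrow>\<^sub>0 complex) \<Rightarrow> bool" where
  "continuous_vec t w \<longleftrightarrow> (\<forall>i. ((\<lambda>u. Poly_Mapping.lookup (w u) i) \<longlongrightarrow> Poly_Mapping.lookup (w t) i) (nhds_Cn t))"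

lemma continuous_vec_eventually:
  assumes "continuous_vec t w" "eventually (\<lambda>u. w u = v u) (nhds_Cn t)" shows "continuous_vec t v"
  unfolding continuous_vec_def
proof
  fix i
  have "w t = v t" using assms(2) by (rule eventually_nhds_Cn_at)
  moreover have "eventually (\<lambda>u. Poly_Mapping.lookup (w u) i = Poly_Mapping.lookup (v u) i) (nhds_Cn t)"
    using assms(2) by eventually_elim simp
  ultimately show "((\<lambda>u. Poly_Mapping.lookup (v u) i) \<longlongrightarrow> Poly_Mapping.lookup (v t) i) (nhds_Cn t)"
    using assms(1)[unfolded continuous_vec_def, rule_format, of i] by (simp add: Lim_transform_eventually)
qed

lemma continuous_L_op:
  assumes w: "continuous_vec t w" "eventually (\<lambda>u. w u \<in> aux_space N) (nhds_Cn t)" and r: "r < N"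
    and X: "(X \<longlongrightarrow> X t) (nhds_Cn t)" and nz: "sinh (X t + (1/2 + l) * \<eta>) \<noteq> 0" "sinh \<eta> \<noteq> 0"
  shows "continuous_vec t (\<lambda>u. L_op \<eta> l (X u) r (w u))"
  unfolding continuous_vec_def
proof
  fix js
  note w1 = w(1)[unfolded continuous_vec_def, rule_format]
  show "((\<lambda>u. Poly_Mapping.lookup (L_op \<eta> l (X u) r (w u)) js) \<longlongrightarrow> Poly_Mapping.lookup (L_op \<eta> l (X t) r (w t)) js) (nhds_Cn t)"
  proof (cases "\<exists>a ns. js = a # ns \<and> (a = 1 \<or> a = 2) \<and> length ns = N \<and> (\<forall>i<N. 1 \<le> ns ! i)")
    case True
    then obtain a ns where js: "js = a # ns" "a = 1 \<or> a = 2" "length ns = N" "1 \<le> ns ! r" using r by auto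
    define p q k where "p y = (if a = 1 then A_coeff \<eta> l y (of_nat (ns ! r)) else C_coeff \<eta> l y (of_nat (ns ! r) + 1))"
      and "q y = (if a = 1 then B_coeff \<eta> l y (of_nat (ns ! r) - 1) else D_coeff \<eta> l y (of_nat (ns ! r)))"
      and "k = (if a = 1 then (1 # ns, 2 # ns[r := ns ! r - 1]) else (1 # ns[r := ns ! r + 1], 2 # ns))" for y
    have eq: "eventually (\<lambda>u. p (X u) * Poly_Mapping.lookup (w u) (fst k) + q (X u) * Poly_Mapping.lookup (w u) (snd k)
        = Poly_Mapping.lookup (L_op \<eta> l (X u) r (w u)) js) (nhds_Cn t)"
      using w(2)
    proof eventually_elim
      case (elim u)
      then show ?case using lookup_L_op[OF elim r js(3,4), of \<eta> l "X u"] js(1,2)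
        by (auto simp: p_def q_def k_def)
    qed
    have "((\<lambda>u. p (X u)) \<longlongrightarrow> p (X t)) (nhds_Cn t)" "((\<lambda>u. q (X u)) \<longlongrightarrow> q (X t)) (nhds_Cn t)"
      unfolding p_def q_def A_coeff_def B_coeff_def C_coeff_def D_coeff_def
      using nz by (auto intro!: tendsto_intros X)
    then have "((\<lambda>u. p (X u) * Poly_Mapping.lookup (w u) (fst k) + q (X u) * Poly_Mapping.lookup (w u) (snd k))
        \<longlongrightarrow> p (X t) * Poly_Mapping.lookup (w t) (fst k) + q (X t) * Poly_Mapping.lookup (w t) (snd k)) (nhds_Cn t)"
      by (intro tendsto_intros w1)
    then show ?thesis
      using Lim_transform_eventually[OF _ eq] eventually_nhds_Cn_at[OF eq] by simp
  next
    case False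
    have "eventually (\<lambda>u. 0 = Poly_Mapping.lookup (L_op \<eta> l (X u) r (w u)) js) (nhds_Cn t)"
      using w(2)
    proof eventually_elim
      case (elim u)
      then show ?case using L_op_in_aux_space[OF elim r, of \<eta> l "X u"] False unfolding aux_space_iff by metis
    qed
    then show ?thesis using eventually_nhds_Cn_at by (fastforce intro: Lim_transform_eventually[OF tendsto_const])
  qed
qed

lemma continuous_compose_L_ops:
  assumes w: "continuous_vec t w" "eventually (\<lambda>u. w u \<in> aux_space N) (nhds_Cn t)"
    and rs: "\<And>r. r \<in> set rs \<Longrightarrow> r < N" "\<And>r. r \<in> set rs \<Longrightarrow> ((\<lambda>u. X u r) \<longlongrightarrow> X t r) (nhds_Cn t)"
      "\<And>r. r \<in> set rs \<Longrightarrow> sinh (X t r + (1/2 + l r) * \<eta>) \<noteq> 0" and \<eta>: "sinh \<eta> \<noteq> 0"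
  shows "continuous_vec t (\<lambda>u. compose_ops (\<lambda>r. L_op \<eta> (l r) (X u r) r) rs (w u))"
  using rs
proof (induction rs)
  case Nil show ?case using w(1) by simp
next
  case (Cons r rs)
  have "eventually (\<lambda>u. compose_ops (\<lambda>r. L_op \<eta> (l r) (X u r) r) rs (w u) \<in> aux_space N) (nhds_Cn t)"
    using w(2)
  proof eventually_elim
    case (elim u)
    show ?case by (rule compose_ops_mem[OF L_op_in_aux_space elim]) (use Cons.prems in auto)
  qed
  moreover have "continuous_vec t (\<lambda>u. compose_ops (\<lambda>r. L_op \<eta> (l r) (X u r) r) rs (w u))"
    by (rule Cons.IH) (use Cons.prems in auto)
  ultimately show ?case
    using continuous_L_op[where X = "\<lambda>u. X u r" and l = "l r" and \<eta> = \<eta> and r = r] Cons.prems \<eta> by simp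
qed

lemma eventually_nonsingular:
  assumes "nonsingular \<eta> ls x t" "length t = length ls"
  shows "eventually (\<lambda>u. nonsingular \<eta> ls x u) (nhds_Cn t)"
proof -
  have "eventually (\<lambda>u. sinh ((x - u ! r) + (1/2 + ls ! r) * \<eta>) \<noteq> 0 \<and> sinh (- (x - u ! r) + (1/2 + ls ! r) * \<eta>) \<noteq> 0) (nhds_Cn t)"
    if r: "r < length ls" for r
  proof (intro eventually_conj)
    have "((\<lambda>u. sinh ((x - u ! r) + (1/2 + ls ! r) * \<eta>)) \<longlongrightarrow> sinh ((x - t ! r) + (1/2 + ls ! r) * \<eta>)) (nhds_Cn t)"
      using r assms(2) by (intro tendsto_intros tendsto_nth_Cn) auto
    then show "eventually (\<lambda>u. sinh ((x - u ! r) + (1/2 + ls ! r) * \<eta>) \<noteq> 0) (nhds_Cn t)"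
      by (rule tendsto_imp_eventually_ne) (use assms r in \<open>simp add: nonsingular_def\<close>)
    have "((\<lambda>u. sinh (- (x - u ! r) + (1/2 + ls ! r) * \<eta>)) \<longlongrightarrow> sinh (- (x - t ! r) + (1/2 + ls ! r) * \<eta>)) (nhds_Cn t)"
      using r assms(2) by (intro tendsto_intros tendsto_nth_Cn) auto
    then show "eventually (\<lambda>u. sinh (- (x - u ! r) + (1/2 + ls ! r) * \<eta>) \<noteq> 0) (nhds_Cn t)"
      by (rule tendsto_imp_eventually_ne) (use assms(1)[unfolded nonsingular_def] r in blast)
  qed
  then have "eventually (\<lambda>u. \<forall>r\<in>{..<length ls}. sinh ((x - u ! r) + (1/2 + ls ! r) * \<eta>) \<noteq> 0 \<and>
      sinh (- (x - u ! r) + (1/2 + ls ! r) * \<eta>) \<noteq> 0) (nhds_Cn t)"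
    by (intro eventually_ball_finite) auto
  then show ?thesis unfolding nonsingular_def by (simp only: Ball_def lessThan_iff)
qed

lemma continuous_B_bdry:
  assumes w: "continuous_vec t w" "eventually (\<lambda>u. w u \<in> state_space (length ls)) (nhds_Cn t)"
    and \<eta>: "sinh \<eta> \<noteq> 0" and ns: "nonsingular \<eta> ls x t" "nonsingular \<eta> ls (- x) t" and len: "length t = length ls"
    and K: "sinh (\<xi> - x) \<noteq> 0" "sinh (\<xi> + x) \<noteq> 0"
  shows "continuous_vec t (\<lambda>u. B_bdry \<eta> \<xi> ls x u (w u))"
proof -
  let ?N = "length ls"
  have 1: "continuous_vec t (\<lambda>u. aux_tensor 2 (w u))"
    using w(1) unfolding continuous_vec_def lookup_aux_tensor by auto
  have mem1: "eventually (\<lambda>u. aux_tensor 2 (w u) \<in> aux_space ?N) (nhds_Cn t)"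
    using w(2) by eventually_elim (simp add: aux_tensor_in_aux_space)
  have 2: "continuous_vec t (\<lambda>u. T_op \<eta> ls (- x) u (aux_tensor 2 (w u)))"
    unfolding T_op_eq
    by (rule continuous_compose_L_ops[OF 1 mem1, where X = "\<lambda>u r. - x - u ! r"])
      (use ns(2) \<eta> len in \<open>auto simp: nonsingular_def intro!: tendsto_intros tendsto_nth_Cn\<close>)
  have mem2: "eventually (\<lambda>u. T_op \<eta> ls (- x) u (aux_tensor 2 (w u)) \<in> aux_space ?N) (nhds_Cn t)"
    using mem1 by eventually_elim (rule T_op_in_aux_space)
  let ?v = "\<lambda>u. K_op \<xi> (- x) (T_op \<eta> ls (- x) u (aux_tensor 2 (w u)))"
  have mem3: "eventually (\<lambda>u. ?v u \<in> aux_space ?N) (nhds_Cn t)"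
    using mem2 by eventually_elim (rule K_op_in_aux_space)
  have 3: "continuous_vec t ?v"
    unfolding continuous_vec_def
  proof
    fix js :: "nat list"
    let ?c = "if hd js = 1 then 1 else sinh (\<xi> - (- x)) / sinh (\<xi> + (- x))"
    have eq: "eventually (\<lambda>u. ?c * Poly_Mapping.lookup (T_op \<eta> ls (- x) u (aux_tensor 2 (w u))) js = Poly_Mapping.lookup (?v u) js) (nhds_Cn t)"
      using mem2 by eventually_elim (simp only: lookup_K_op)
    have "((\<lambda>u. ?c * Poly_Mapping.lookup (T_op \<eta> ls (- x) u (aux_tensor 2 (w u))) js)
       \<longlongrightarrow> ?c * Poly_Mapping.lookup (T_op \<eta> ls (- x) t (aux_tensor 2 (w t))) js) (nhds_Cn t)"
      by (rule tendsto_mult_left) (rule 2[unfolded continuous_vec_def, rule_format])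
    then show "((\<lambda>u. Poly_Mapping.lookup (?v u) js) \<longlongrightarrow> Poly_Mapping.lookup (?v t) js) (nhds_Cn t)"
      unfolding eventually_nhds_Cn_at[OF eq] by (rule Lim_transform_eventually[OF _ eq])
  qed
  have 4: "continuous_vec t (\<lambda>u. T_inv \<eta> ls x u (?v u))"
    unfolding T_inv_def
    by (rule continuous_compose_L_ops[OF 3 mem3, where X = "\<lambda>u r. - (x - u ! r)"])
      (use ns(1) \<eta> len in \<open>auto simp: nonsingular_def intro!: tendsto_intros tendsto_nth_Cn\<close>)
  have mem4: "eventually (\<lambda>u. T_inv \<eta> ls x u (?v u) \<in> aux_space ?N) (nhds_Cn t)"
    using mem3 by eventually_elim (rule T_inv_in_aux_space)
  have 5: "continuous_vec t (\<lambda>u. aux_coeff 1 (T_inv \<eta> ls x u (?v u)))"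
    unfolding continuous_vec_def
  proof
    fix js :: "nat list"
    have eq: "eventually (\<lambda>u. Poly_Mapping.lookup (T_inv \<eta> ls x u (?v u)) (1 # js) = Poly_Mapping.lookup (aux_coeff 1 (T_inv \<eta> ls x u (?v u))) js) (nhds_Cn t)"
      using mem4 by eventually_elim (simp only: lookup_aux_coeff)
    show "((\<lambda>u. Poly_Mapping.lookup (aux_coeff 1 (T_inv \<eta> ls x u (?v u))) js) \<longlongrightarrow> Poly_Mapping.lookup (aux_coeff 1 (T_inv \<eta> ls x t (?v t))) js) (nhds_Cn t)"
      using Lim_transform_eventually[OF 4[unfolded continuous_vec_def, rule_format, of "1 # js"] eq]
      unfolding eventually_nhds_Cn_at[OF eq] .
  qed
  have "eventually (\<lambda>u. aux_coeff 1 (T_inv \<eta> ls x u (?v u)) = B_bdry \<eta> \<xi> ls x u (w u)) (nhds_Cn t)"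
    using eventually_nonsingular[OF ns(1) len] w(2)
  proof eventually_elim
    case (elim u)
    then show ?case by (rule B_bdry_eq[OF \<eta> _ K, symmetric])
  qed
  then show ?thesis by (rule continuous_vec_eventually[OF 5])
qed


lemma continuous_smult_vec:
  assumes "continuous_vec t w" "(c \<longlongrightarrow> c t) (nhds_Cn t)"
  shows "continuous_vec t (\<lambda>u. smult_vec (c u) (w u))"
  using assms unfolding continuous_vec_def by (auto intro: tendsto_mult)

lemma bethe_vec_Cons: "bethe_vec \<eta> \<xi> ls (z # x) t = B_bar \<eta> \<xi> ls z t (bethe_vec \<eta> \<xi> ls x t)"
  by (simp add: bethe_vec_def)

lemma smult_vec_in_state_space: "u \<in> state_space N \<Longrightarrow> smult_vec c u \<in> state_space N"
  unfolding state_space_iff by simp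

lemma bethe_vec_in_state_space:
  assumes \<eta>: "sinh \<eta> \<noteq> 0"
  shows "(\<And>z. z \<in> set x \<Longrightarrow> nonsingular \<eta> ls (z + \<eta>/2) t) \<Longrightarrow> K_regular \<eta> \<xi> x \<Longrightarrow>
    bethe_vec \<eta> \<xi> ls x t \<in> state_space (length ls)"
proof (induction x)
  case Nil
  show ?case by (simp add: bethe_vec_def state_space_iff lookup_basis_vec)
next
  case (Cons z x)
  have "sinh (\<xi> - (z + \<eta>/2)) \<noteq> 0" "sinh (\<xi> + (z + \<eta>/2)) \<noteq> 0"
    using Cons.prems(2) by (simp_all add: K_regular_def algebra_simps)
  moreover have "bethe_vec \<eta> \<xi> ls x t \<in> state_space (length ls)"
    using Cons by (simp add: K_regular_def)
  moreover have "nonsingular \<eta> ls (z + \<eta>/2) t" using Cons.prems(1) by simp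
  ultimately show ?case
    unfolding bethe_vec_Cons B_bar_def by (intro smult_vec_in_state_space B_bdry_in_state_space \<eta>)
qed

lemma continuous_bethe_vec:
  assumes \<eta>: "sinh \<eta> \<noteq> 0" and len: "length t = length ls"
  shows "(\<And>z. z \<in> set x \<Longrightarrow> nonsingular \<eta> ls (z + \<eta>/2) t \<and> nonsingular \<eta> ls (- (z + \<eta>/2)) t \<and>
      (\<forall>r<length ls. sinh (z - t ! r + ls ! r * \<eta>) \<noteq> 0)) \<Longrightarrow>
    K_regular \<eta> \<xi> x \<Longrightarrow> continuous_vec t (bethe_vec \<eta> \<xi> ls x)"
proof (induction x)
  case Nil
  show ?case by (simp add: bethe_vec_def continuous_vec_def)
next
  case (Cons z x)
  have IH: "continuous_vec t (bethe_vec \<eta> \<xi> ls x)" using Cons by (simp add: K_regular_def)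
  have "eventually (\<lambda>u. \<forall>y\<in>set x. nonsingular \<eta> ls (y + \<eta>/2) u) (nhds_Cn t)"
    by (intro eventually_ball_finite ballI eventually_nonsingular len) (use Cons.prems in auto)
  then have mem: "eventually (\<lambda>u. bethe_vec \<eta> \<xi> ls x u \<in> state_space (length ls)) (nhds_Cn t)"
    by eventually_elim (use Cons.prems in \<open>auto intro!: bethe_vec_in_state_space[OF \<eta>] simp: K_regular_def\<close>)
  have K: "sinh (\<xi> - (z + \<eta>/2)) \<noteq> 0" "sinh (\<xi> + (z + \<eta>/2)) \<noteq> 0"
    using Cons.prems(2) by (simp_all add: K_regular_def algebra_simps)
  have ns: "nonsingular \<eta> ls (z + \<eta>/2) t" "nonsingular \<eta> ls (- (z + \<eta>/2)) t" using Cons.prems(1) by simp_all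
  have nz: "sinh (z - t ! r + ls ! r * \<eta>) \<noteq> 0" if "r < length ls" for r
    using Cons.prems(1)[of z] that by simp
  show ?case
    unfolding bethe_vec_Cons B_bar_def
  proof (rule continuous_smult_vec[OF continuous_B_bdry[OF IH mem \<eta> ns len K]])
    have "((\<lambda>u. \<Prod>r<length ls. sinh (z - u ! r - ls ! r * \<eta>) / sinh (z - u ! r + ls ! r * \<eta>))
      \<longlongrightarrow> (\<Prod>r<length ls. sinh (z - t ! r - ls ! r * \<eta>) / sinh (z - t ! r + ls ! r * \<eta>))) (nhds_Cn t)"
      using nz len by (intro tendsto_intros tendsto_nth_Cn) auto
    then show "((\<lambda>u. (\<Prod>r<length ls. sinh (z - u ! r - ls ! r * \<eta>) / sinh (z - u ! r + ls ! r * \<eta>)) *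
        (sinh (\<xi> - z - \<eta> / 2) * sinh (2 * z) / sinh (2 * z + \<eta>)))
      \<longlongrightarrow> (\<Prod>r<length ls. sinh (z - t ! r - ls ! r * \<eta>) / sinh (z - t ! r + ls ! r * \<eta>)) *
        (sinh (\<xi> - z - \<eta> / 2) * sinh (2 * z) / sinh (2 * z + \<eta>))) (nhds_Cn t)"
      by (rule tendsto_mult_right)
  qed
qed

text \<open>At regular points, including those of the hyperplane of the points $\mathbf{t}'$, continuity
  recovers the value of the summand from the holomorphic functions that mero-uniform convergence
  provides.\<close>

lemma continuous_jackson_summand:
  assumes \<eta>: "sinh \<eta> \<noteq> 0" and len: "length t = length ls" and reg: "regular_point \<eta> F ls x t" and K: "K_regular \<eta> \<xi> x"
  shows "continuous_vec t (jackson_summand \<eta> \<xi> g h F ls x)"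
  unfolding jackson_summand_def
proof (rule continuous_smult_vec)
  show "continuous_vec t (bethe_vec \<eta> \<xi> ls x)"
    by (rule continuous_bethe_vec[OF \<eta> len _ K]) (use regular_point_nonsingular[OF reg] in blast)
  have "((\<lambda>u. F (ls ! r) (u ! r + x ! i) * F (ls ! r) (u ! r - x ! i))
      \<longlongrightarrow> F (ls ! r) (t ! r + x ! i) * F (ls ! r) (t ! r - x ! i)) (nhds_Cn t)" if r: "r < length ls" and i: "i < length x" for r i
  proof -
    have c: "isCont (F (ls ! r)) (t ! r + x ! i)" "isCont (F (ls ! r)) (t ! r - x ! i)"
      using reg r nth_mem[OF i] unfolding regular_point_def regular_coordinate_def by blast+
    have "((\<lambda>u. u ! r) \<longlongrightarrow> t ! r) (nhds_Cn t)" using r len by (intro tendsto_nth_Cn) simp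
    then have l: "((\<lambda>u. u ! r + x ! i) \<longlongrightarrow> t ! r + x ! i) (nhds_Cn t)" "((\<lambda>u. u ! r - x ! i) \<longlongrightarrow> t ! r - x ! i) (nhds_Cn t)"
      by (intro tendsto_intros; assumption)+
    show ?thesis by (rule tendsto_mult[OF isCont_tendsto_compose[OF c(1) l(1)] isCont_tendsto_compose[OF c(2) l(2)]])
  qed
  then show "((\<lambda>u. (\<Prod>i<length x. g (x ! i)) * (\<Prod>j<length x. \<Prod>i<j. h (x ! i + x ! j) * h (x ! i - x ! j)) *
      (\<Prod>r<length ls. \<Prod>i<length x. F (ls ! r) (u ! r + x ! i) * F (ls ! r) (u ! r - x ! i)))
    \<longlongrightarrow> (\<Prod>i<length x. g (x ! i)) * (\<Prod>j<length x. \<Prod>i<j. h (x ! i + x ! j) * h (x ! i - x ! j)) *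
      (\<Prod>r<length ls. \<Prod>i<length x. F (ls ! r) (t ! r + x ! i) * F (ls ! r) (t ! r - x ! i))) (nhds_Cn t)"
    by (intro tendsto_mult_left tendsto_prod) auto
qed

text \<open>The map p stands for the identity or for the substitution $\mathbf{t}\mapsto\mathbf{t}'$; in both
  cases every coordinate of the image is a translate of a single coordinate of t.\<close>

lemma generic_on_regular_point:
  assumes F: "\<And>l. l \<in> set ls \<Longrightarrow> F l meromorphic_on UNIV"
    and p: "\<And>r. r < length ls \<Longrightarrow> \<exists>i<N. \<exists>c. \<forall>t. length t = N \<longrightarrow> p t ! r = t ! i + c"
  shows "generic_on N {t. length t = N} (\<lambda>t. regular_point \<eta> F ls x (p t))"
proof -
  have "generic_on N {t. length t = N} (\<lambda>t. \<forall>r\<in>{..<length ls}. regular_coordinate \<eta> (ls ! r) (F (ls ! r)) x (p t ! r))"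
  proof (rule generic_on_ball_finite)
    fix r assume r: "r \<in> {..<length ls}"
    then obtain i c where i: "i < N" "\<And>t. length t = N \<Longrightarrow> p t ! r = t ! i + c" using p[of r] by auto
    have ev: "eventually (regular_coordinate \<eta> (ls ! r) (F (ls ! r)) x) (at z)" for z
      by (rule eventually_regular_coordinate) (use F r in auto)
    have "generic_on N {t. length t = N} (\<lambda>t. regular_coordinate \<eta> (ls ! r) (F (ls ! r)) x (t ! i + c))"
      by (rule generic_on_coordinate[OF eventually_at_shift[OF ev] i(1)])
    then show "generic_on N {t. length t = N} (\<lambda>t. regular_coordinate \<eta> (ls ! r) (F (ls ! r)) x (p t ! r))"
      by (rule generic_on_mono) (use i(2) in auto)
  qed simp
  then show ?thesis by (rule generic_on_mono) (simp add: regular_point_def)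
qed

section \<open>Fusion of the summand\<close>

text \<open>The label p + b - 1 is 1 only for p = b = 1, where the fusion map has coefficient 1.\<close>

lemma fused_reference_state:
  assumes "m < N"
  shows "fused \<eta> d m (basis_vec (replicate N 1)) (basis_vec (replicate (N + 1) 1))"
  unfolding fused_def lookup_basis_vec
proof (intro allI impI)
  fix pre post :: "nat list" and p b :: nat
  assume a: "length pre = m \<and> 1 \<le> p \<and> p \<le> d + 1 \<and> (b = 1 \<or> b = 2)"
  have rep: "ns = replicate n 1 \<longleftrightarrow> length ns = n \<and> (\<forall>k\<in>set ns. k = 1)" for ns :: "nat list" and n
    by (metis in_set_replicate length_replicate replicate_eqI)
  have "replicate N 1 = pre @ (p + b - 1) # post \<longleftrightarrow> replicate (N + 1) 1 = pre @ p # b # post"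
    unfolding eq_commute[of "replicate _ _"] rep using a by auto
  moreover have "j_coeff \<eta> (of_nat d / 2) (of_nat p) b = 1" if "replicate (N + 1) 1 = pre @ p # b # post"
  proof -
    have "p = 1" "b = 1" using that unfolding eq_commute[of "replicate _ _"] rep by auto
    then show ?thesis by (simp add: j_coeff_def)
  qed
  ultimately show "(if replicate (N + 1) 1 = pre @ p # b # post then 1 else 0)
    = j_coeff \<eta> (of_nat d / 2) (of_nat p) b * (if replicate N 1 = pre @ (p + b - 1) # post then 1 else 0)" by auto
qed

lemma fused_jackson_summand:
  assumes m: "m < N" and ls: "length ls = N" "ls ! m = of_nat d / 2 + 1/2" and t: "length t = N" and \<eta>: "sinh \<eta> \<noteq> 0"
    and K: "K_regular \<eta> \<xi> x"
    and reg: "regular_point \<eta> F ls x t"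
      "regular_point \<eta> F' (split_at (Suc m) (of_nat d / 2) (1/2) ls) x (unfused_pt \<eta> (Suc m) d t)"
    and F: "\<And>r. r < N \<Longrightarrow> r \<noteq> m \<Longrightarrow> F' (ls ! r) = F (ls ! r)"
      "\<And>w. w \<in> set x \<Longrightarrow> \<forall>z\<in>{t ! m + w, t ! m - w}.
         F (of_nat d / 2 + 1/2) z = F' (of_nat d / 2) (z + \<eta>/2) * F' (1/2) (z - of_nat d / 2 * \<eta>)"
  shows "fused \<eta> d m (jackson_summand \<eta> \<xi> g h F ls x t)
    (jackson_summand \<eta> \<xi> g h F' (split_at (Suc m) (of_nat d / 2) (1/2) ls) x (unfused_pt \<eta> (Suc m) d t))"
proof -
  let ?ls' = "split_at (Suc m) (of_nat d / 2) (1/2) ls" and ?t' = "unfused_pt \<eta> (Suc m) d t"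
  note ns = regular_point_nonsingular(1)[OF reg(1)] regular_point_nonsingular(1,2)[OF reg(2)]
  have len: "length ?ls' = N + 1" using length_splits(1)[OF m ls t \<eta>] .
  have "fused \<eta> d m (bethe_vec \<eta> \<xi> ls y t) (bethe_vec \<eta> \<xi> ?ls' y ?t')" if "set y \<subseteq> set x" for y
    using that
  proof (induction y)
    case Nil
    show ?case using fused_reference_state[OF m] ls(1) len by (simp add: bethe_vec_def)
  next
    case (Cons z y)
    then have z: "z \<in> set x" and y: "set y \<subseteq> set x" by auto
    have Ky: "K_regular \<eta> \<xi> y" using K y unfolding K_regular_def by blast
    have "bethe_vec \<eta> \<xi> ls y t \<in> state_space N"
      using bethe_vec_in_state_space[OF \<eta> _ Ky, of ls t] ns(1) y ls(1) by auto
    moreover have "bethe_vec \<eta> \<xi> ?ls' y ?t' \<in> state_space (N + 1)"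
      using bethe_vec_in_state_space[OF \<eta> _ Ky, of ?ls' ?t'] ns(2) y len by auto
    ultimately show ?case
      unfolding bethe_vec_Cons
      using fused_B_bar[OF m ls t \<eta> _ _ Cons.IH[OF y] ns(1)[OF z] ns(2)[OF z] ns(3)[OF z]] K z
      unfolding K_regular_def by blast
  qed
  then have B: "fused \<eta> d m (bethe_vec \<eta> \<xi> ls x t) (bethe_vec \<eta> \<xi> ?ls' x ?t')" by blast
  have "(\<Prod>r<length ?ls'. \<Prod>i<length x. F' (?ls' ! r) (?t' ! r + x ! i) * F' (?ls' ! r) (?t' ! r - x ! i))
     = (\<Prod>r<length ls. \<Prod>i<length x. F (ls ! r) (t ! r + x ! i) * F (ls ! r) (t ! r - x ! i))"
  proof (rule prod_splits[OF m ls t \<eta>])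
    have "F' (of_nat d / 2) (t ! m + \<eta>/2 + x ! i) * F' (of_nat d / 2) (t ! m + \<eta>/2 - x ! i)
        * (F' (1/2) (t ! m - of_nat d / 2 * \<eta> + x ! i) * F' (1/2) (t ! m - of_nat d / 2 * \<eta> - x ! i))
       = F (ls ! m) (t ! m + x ! i) * F (ls ! m) (t ! m - x ! i)" if "i < length x" for i
      using F(2)[of "x ! i"] that unfolding ls(2) by (simp add: algebra_simps)
    then show "(\<Prod>i<length x. F' (of_nat d / 2) (t ! m + \<eta>/2 + x ! i) * F' (of_nat d / 2) (t ! m + \<eta>/2 - x ! i))
      * (\<Prod>i<length x. F' (1/2) (t ! m - of_nat d / 2 * \<eta> + x ! i) * F' (1/2) (t ! m - of_nat d / 2 * \<eta> - x ! i))
      = (\<Prod>i<length x. F (ls ! m) (t ! m + x ! i) * F (ls ! m) (t ! m - x ! i))"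
      unfolding prod.distrib[symmetric] by (intro prod.cong) auto
  qed (simp add: F(1))
  then show ?thesis unfolding jackson_summand_def by (simp only: fused_smult_vec[OF m ls t \<eta> B])
qed

section \<open>The fusion map on coefficients\<close>

lemma lookup_pr: "Poly_Mapping.lookup (pr Is u) i = (if i \<in> listset Is then Poly_Mapping.lookup u i else 0)"
proof -
  have "Poly_Mapping.lookup (pr Is u) i = Poly_Mapping.lookup u i * Poly_Mapping.lookup (if i \<in> listset Is then basis_vec i else 0) i"
    unfolding pr_def by (rule lookup_lin_ext_one) (auto simp: lookup_basis_vec)
  then show ?thesis by (simp add: lookup_basis_vec)
qed

lemma pr_in_tensor_space: "pr Is u \<in> tensor_space Is"
  unfolding tensor_space_def by (auto simp: in_keys_iff lookup_pr split: if_splits)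

lemma in_fused_idx:
  assumes "m < N"
  shows "ns \<in> listset (fused_idx N (Suc m) d) \<longleftrightarrow> length ns = N \<and> (\<forall>i<N. 1 \<le> ns ! i) \<and> ns ! m \<le> d + 2"
proof -
  have nth: "(replicate N M_idx)[m := V_idx (d + 1)] ! i = (if i = m then V_idx (d + 1) else M_idx)" if "i < N" for i
    using that by (simp add: nth_list_update)
  have "(\<forall>i<N. ns ! i \<in> (replicate N M_idx)[m := V_idx (d + 1)] ! i) \<longleftrightarrow> (\<forall>i<N. 1 \<le> ns ! i) \<and> ns ! m \<le> d + 2"
  proof (intro iffI conjI allI impI)
    fix i assume a: "\<forall>i<N. ns ! i \<in> (replicate N M_idx)[m := V_idx (d + 1)] ! i" "i < N"
    then have "ns ! i \<in> (if i = m then V_idx (d + 1) else M_idx)" using nth by metis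
    then show "1 \<le> ns ! i" by (cases "i = m") (simp_all add: V_idx_def)
  next
    assume "\<forall>i<N. ns ! i \<in> (replicate N M_idx)[m := V_idx (d + 1)] ! i"
    then have "ns ! m \<in> V_idx (d + 1)" using nth[OF assms] assms by metis
    then show "ns ! m \<le> d + 2" by (simp add: V_idx_def)
  next
    fix i assume "(\<forall>i<N. 1 \<le> ns ! i) \<and> ns ! m \<le> d + 2" "i < N"
    then show "ns ! i \<in> (replicate N M_idx)[m := V_idx (d + 1)] ! i"
      unfolding nth[OF \<open>i < N\<close>] by (cases "i = m") (simp_all add: V_idx_def)
  qed
  then show ?thesis by (simp only: in_listset_iff fused_idx_def diff_Suc_1 length_list_update length_replicate)
qed

lemma in_unfused_idx:
  assumes m: "m < N"
  shows "js \<in> listset (unfused_idx N (Suc m) d) \<longleftrightarrow> (\<exists>pre p b post. js = pre @ p # b # post \<and> length pre = m \<and>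
    length post = N - m - 1 \<and> 1 \<le> p \<and> p \<le> d + 1 \<and> (b = 1 \<or> b = 2) \<and> (\<forall>n\<in>set pre \<union> set post. 1 \<le> n))"
    (is "?L \<longleftrightarrow> ?R")
proof -
  have L: "?L \<longleftrightarrow> length js = N + 1 \<and> (\<forall>i<N + 1. js ! i \<in> (if i = m then V_idx d else if i = Suc m then V_idx 1 else M_idx))"
  proof -
    have len: "length (unfused_idx N (Suc m) d) = N + 1" using m by (simp add: unfused_idx_def length_split_at)
    have nth: "unfused_idx N (Suc m) d ! i = (if i = m then V_idx d else if i = Suc m then V_idx 1 else M_idx)"
      if "i < N + 1" for i
      using m that nth_split_at[of m "replicate N M_idx" "V_idx d" "V_idx 1" i]
      by (cases "i < m"; cases "i = m"; cases "i = Suc m") (simp_all add: unfused_idx_def)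
    have "(\<forall>i<N + 1. js ! i \<in> unfused_idx N (Suc m) d ! i)
        \<longleftrightarrow> (\<forall>i<N + 1. js ! i \<in> (if i = m then V_idx d else if i = Suc m then V_idx 1 else M_idx))"
      by (rule all_cong) (simp only: nth)
    then show ?thesis by (simp only: in_listset_iff len)
  qed
  show ?thesis
  proof
    assume ?L
    then have len: "length js = N + 1" and nth: "\<And>i. i < N + 1 \<Longrightarrow> js ! i \<in> (if i = m then V_idx d else if i = Suc m then V_idx 1 else M_idx)"
      using L by auto
    have drop: "drop (Suc m) js = js ! Suc m # drop (Suc (Suc m)) js"
      using Cons_nth_drop_Suc[of "Suc m" js] m len by simp
    have "js = take m js @ js ! m # drop (Suc m) js" by (rule id_take_nth_drop) (use m len in simp)
    then have "js = take m js @ js ! m # js ! Suc m # drop (Suc (Suc m)) js" unfolding drop .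
    moreover have "\<forall>n\<in>set (take m js) \<union> set (drop (Suc (Suc m)) js). 1 \<le> n"
    proof
      fix n assume "n \<in> set (take m js) \<union> set (drop (Suc (Suc m)) js)"
      then obtain i where "i < N + 1" "i \<noteq> m" "i \<noteq> Suc m" "n = js ! i"
      proof
        assume "n \<in> set (take m js)"
        then obtain i where "i < m" "n = js ! i" using len m by (auto simp: in_set_conv_nth)
        then show ?thesis using m by (intro that[of i]) auto
      next
        assume "n \<in> set (drop (Suc (Suc m)) js)"
        then obtain i where "i < length js - Suc (Suc m)" "n = js ! (Suc (Suc m) + i)" using len m by (auto simp: in_set_conv_nth)
        then show ?thesis using len by (intro that[of "Suc (Suc m) + i"]) auto
      qed
      then show "1 \<le> n" using nth[of i] by simp
    qed
    moreover have "js ! m \<in> V_idx d" "js ! Suc m \<in> V_idx 1" using nth[of m] nth[of "Suc m"] m by auto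
    ultimately show ?R
      using len m by (intro exI[of _ "take m js"] exI[of _ "js ! m"] exI[of _ "js ! Suc m"] exI[of _ "drop (Suc (Suc m)) js"] conjI)
        (simp_all add: V_idx_def, linarith)
  next
    assume ?R
    then obtain pre p b post where js: "js = pre @ p # b # post" "length pre = m" "length post = N - m - 1" "1 \<le> p" "p \<le> d + 1"
      "b = 1 \<or> b = 2" and ge: "\<forall>n\<in>set pre \<union> set post. 1 \<le> n" by blast
    have "js ! i \<in> (if i = m then V_idx d else if i = Suc m then V_idx 1 else M_idx)" if i: "i < N + 1" for i
    proof -
      consider "i < m" | "i = m" | "i = Suc m" | e where "i = Suc (Suc (m + e))"
        using le_Suc_ex[of "Suc (Suc m)" i] by fastforce
      then show ?thesis
      proof cases
        case 4
        then have "js ! i \<in> set post" using js i m by (simp add: nth_append)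
        then show ?thesis using ge 4 by simp
      qed (use js ge in \<open>auto simp: nth_append V_idx_def\<close>)
    qed
    then show ?L using L js m by simp
  qed
qed

lemma tensor2_V_vec: "tensor2 (V_vec d n) (V_vec e q) = (if n \<in> V_idx d \<and> q \<in> V_idx e then basis_vec [n, q] else 0)"
proof -
  have z: "lin_ext f 0 = 0" for f :: "nat \<Rightarrow> nat list \<Rightarrow>\<^sub>0 complex" by (simp add: lin_ext_def)
  have one: "smult_vec 1 u = u" for u :: "nat list \<Rightarrow>\<^sub>0 complex" by (rule poly_mapping_eqI) simp
  have smz: "smult_vec 1 (0 :: nat list \<Rightarrow>\<^sub>0 complex) = 0" by (rule one)
  show ?thesis by (auto simp: tensor2_def V_vec_def z lin_ext_single one)
qed

lemma lookup_j_map: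
  shows "1 \<le> p \<Longrightarrow> p \<le> d + 1 \<Longrightarrow> b = 1 \<or> b = 2 \<Longrightarrow> Poly_Mapping.lookup (j_map \<eta> d n) [p, b]
      = (if n = p + b - 1 then j_coeff \<eta> (of_nat d / 2) (of_nat p) b else 0)"
    and "Poly_Mapping.lookup (j_map \<eta> d n) ms \<noteq> 0 \<Longrightarrow> \<exists>p b. ms = [p, b] \<and> 1 \<le> p \<and> p \<le> d + 1 \<and> (b = 1 \<or> b = 2)"
proof -
  have l: "Poly_Mapping.lookup (j_map \<eta> d n) ms =
     (if n \<in> V_idx d \<and> ms = [n, 1] then exp (\<eta>/2 * (of_nat n - 1)) else 0) +
     (if n - 1 \<in> V_idx d \<and> ms = [n - 1, 2] then exp (- \<eta>/2 * (of_nat n - 2 - of_nat d)) * (sinh ((of_nat n - 1) * \<eta>) / sinh \<eta>) else 0)" for n ms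
    unfolding j_map_def tensor2_V_vec by (auto simp: lookup_add lookup_basis_vec V_idx_def)
  show "Poly_Mapping.lookup (j_map \<eta> d n) [p, b] = (if n = p + b - 1 then j_coeff \<eta> (of_nat d / 2) (of_nat p) b else 0)"
    if p: "1 \<le> p" "p \<le> d + 1" and b: "b = 1 \<or> b = 2"
    using b
  proof
    assume "b = 1"
    then show ?thesis using p unfolding l by (auto simp: V_idx_def j_coeff_def)
  next
    assume b: "b = 2"
    have "n - 1 = p \<longleftrightarrow> n = p + 1" using p by auto
    then show ?thesis using p unfolding l b by (auto simp: V_idx_def j_coeff_def)
  qed
  show "\<exists>p b. ms = [p, b] \<and> 1 \<le> p \<and> p \<le> d + 1 \<and> (b = 1 \<or> b = 2)" if "Poly_Mapping.lookup (j_map \<eta> d n) ms \<noteq> 0"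
    using that unfolding l by (auto simp: V_idx_def split: if_splits)
qed

lemma lookup_j_site:
  assumes v: "v \<in> tensor_space (fused_idx N (Suc m) d)" and m: "m < N"
  shows "length pre = m \<Longrightarrow> 1 \<le> p \<Longrightarrow> p \<le> d + 1 \<Longrightarrow> b = 1 \<or> b = 2 \<Longrightarrow>
      Poly_Mapping.lookup (j_site \<eta> (Suc m) d v) (pre @ p # b # post)
      = j_coeff \<eta> (of_nat d / 2) (of_nat p) b * Poly_Mapping.lookup v (pre @ (p + b - 1) # post)"
    and "js \<notin> listset (unfused_idx N (Suc m) d) \<Longrightarrow> Poly_Mapping.lookup (j_site \<eta> (Suc m) d v) js = 0"
proof -
  let ?B = "\<lambda>ns. lin_ext (\<lambda>ms. basis_vec (take (Suc m - 1) ns @ ms @ drop (Suc m) ns)) (j_map \<eta> d (ns ! (Suc m - 1)))"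
  have keys: "length ns = N" "\<And>i. i < N \<Longrightarrow> 1 \<le> ns ! i" if "ns \<in> Poly_Mapping.keys v" for ns
    using that v in_fused_idx[OF m] unfolding tensor_space_def by blast+
  show "Poly_Mapping.lookup (j_site \<eta> (Suc m) d v) (pre @ p # b # post)
      = j_coeff \<eta> (of_nat d / 2) (of_nat p) b * Poly_Mapping.lookup v (pre @ (p + b - 1) # post)"
    if pre: "length pre = m" and p: "1 \<le> p" "p \<le> d + 1" and b: "b = 1 \<or> b = 2"
  proof -
    have B: "Poly_Mapping.lookup (?B ns) (pre @ p # b # post) =
       (if take m ns = pre \<and> drop (Suc m) ns = post \<and> ns ! m = p + b - 1 then j_coeff \<eta> (of_nat d / 2) (of_nat p) b else 0)"
      if len: "m < length ns" for ns
    proof -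
      have "Poly_Mapping.lookup (?B ns) (pre @ p # b # post) = Poly_Mapping.lookup (j_map \<eta> d (ns ! (Suc m - 1))) [p, b]
          * Poly_Mapping.lookup (basis_vec (take (Suc m - 1) ns @ [p, b] @ drop (Suc m) ns)) (pre @ p # b # post)"
      proof (rule lookup_lin_ext_one)
        fix ms assume ms: "ms \<in> Poly_Mapping.keys (j_map \<eta> d (ns ! (Suc m - 1)))" "ms \<noteq> [p, b]"
        then obtain q c where "ms = [q, c]" using lookup_j_map(2)[OF ms(1)[unfolded in_keys_iff]] by blast
        then show "Poly_Mapping.lookup (basis_vec (take (Suc m - 1) ns @ ms @ drop (Suc m) ns)) (pre @ p # b # post) = 0"
          using ms(2) len pre by (auto simp: lookup_basis_vec)
      qed
      then show ?thesis using len pre lookup_j_map(1)[OF p b, of \<eta> "ns ! m"] by (auto simp: lookup_basis_vec)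
    qed
    let ?k = "pre @ (p + b - 1) # post"
    have "Poly_Mapping.lookup (j_site \<eta> (Suc m) d v) (pre @ p # b # post) = Poly_Mapping.lookup v ?k * Poly_Mapping.lookup (?B ?k) (pre @ p # b # post)"
      unfolding j_site_def
    proof (rule lookup_lin_ext_one)
      fix ns assume ns: "ns \<in> Poly_Mapping.keys v" "ns \<noteq> ?k"
      have len: "m < length ns" using keys(1)[OF ns(1)] m by simp
      have "\<not> (take m ns = pre \<and> drop (Suc m) ns = post \<and> ns ! m = p + b - 1)"
        using ns(2) id_take_nth_drop[OF len] by metis
      then show "Poly_Mapping.lookup (?B ns) (pre @ p # b # post) = 0" unfolding B[OF len] by (rule if_not_P)
    qed
    moreover have "Poly_Mapping.lookup (?B ?k) (pre @ p # b # post) = j_coeff \<eta> (of_nat d / 2) (of_nat p) b"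
      using B[of ?k] pre by (simp add: nth_append)
    ultimately show ?thesis by (simp add: mult.commute)
  qed
  show "Poly_Mapping.lookup (j_site \<eta> (Suc m) d v) js = 0" if js: "js \<notin> listset (unfused_idx N (Suc m) d)"
  proof (rule ccontr)
    assume "Poly_Mapping.lookup (j_site \<eta> (Suc m) d v) js \<noteq> 0"
    then obtain ns where ns: "ns \<in> Poly_Mapping.keys v" "Poly_Mapping.lookup (?B ns) js \<noteq> 0"
      using lookup_lin_ext_neq_0[where b = ?B and u = v and j = js] unfolding j_site_def by blast
    then obtain ms where ms: "ms \<in> Poly_Mapping.keys (j_map \<eta> d (ns ! (Suc m - 1)))"
      "Poly_Mapping.lookup (basis_vec (take (Suc m - 1) ns @ ms @ drop (Suc m) ns)) js \<noteq> 0"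
      using lookup_lin_ext_neq_0[OF ns(2)] by blast
    obtain p b where pb: "ms = [p, b]" "1 \<le> p" "p \<le> d + 1" "b = 1 \<or> b = 2"
      using lookup_j_map(2) ms(1) unfolding in_keys_iff by blast
    have eq: "js = take m ns @ p # b # drop (Suc m) ns" using ms(2) pb(1) by (simp add: lookup_basis_vec split: if_splits)
    have "\<forall>n\<in>set ns. 1 \<le> n" using keys[OF ns(1)] by (metis in_set_conv_nth)
    then have "\<forall>n\<in>set (take m ns) \<union> set (drop (Suc m) ns). 1 \<le> n" by (meson Un_iff in_set_dropD in_set_takeD)
    moreover have "length (take m ns) = m" "length (drop (Suc m) ns) = N - m - 1" using keys(1)[OF ns(1)] m by auto
    ultimately have "js \<in> listset (unfused_idx N (Suc m) d)"
      unfolding in_unfused_idx[OF m] using eq pb(2-4) by blast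
    then show False using js by blast
  qed
qed

lemma j_coeff_neq_0:
  assumes "\<And>n::nat. n > 0 \<Longrightarrow> exp \<eta> ^ n \<noteq> 1"
  shows "p > 0 \<Longrightarrow> sinh (of_nat p * \<eta>) \<noteq> 0" and "j_coeff \<eta> k (of_nat p) 1 \<noteq> 0" and "p > 0 \<Longrightarrow> j_coeff \<eta> k (of_nat p) 2 \<noteq> 0"
proof -
  show s: "sinh (of_nat p * \<eta>) \<noteq> 0" if "p > 0" for p :: nat
  proof
    assume "sinh (of_nat p * \<eta>) = 0"
    then have "exp (of_nat p * \<eta>) = exp (- (of_nat p * \<eta>))" by (simp add: sinh_field_def)
    then have "exp (of_nat p * \<eta>) * exp (of_nat p * \<eta>) = exp (of_nat p * \<eta>) * exp (- (of_nat p * \<eta>))" by (simp only:)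
    also have "\<dots> = 1" by (simp add: exp_minus)
    finally have "exp (of_nat p * \<eta>) * exp (of_nat p * \<eta>) = 1" .
    then have "exp \<eta> ^ (p + p) = 1" by (simp add: exp_of_nat_mult power_add)
    then show False using assms[of "p + p"] that by simp
  qed
  show "j_coeff \<eta> k (of_nat p) 1 \<noteq> 0" by (simp add: j_coeff_def)
  show "j_coeff \<eta> k (of_nat p) 2 \<noteq> 0" if "p > 0" using s[OF that] s[of 1] by (simp add: j_coeff_def)
qed

text \<open>The image of $v_n$ with $n\le 2k+1$ is detected by $v_n\otimes v_1$, and that of $v_{2k+2}$ by
  $v_{2k+1}\otimes v_2$, whose coefficient is nonzero because $e^\eta$ is not a root of unity.\<close>

lemma j_site_injective:
  assumes gen: "\<And>n::nat. n > 0 \<Longrightarrow> exp \<eta> ^ n \<noteq> 1" and m: "m < N"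
    and v: "v \<in> tensor_space (fused_idx N (Suc m) d)" "v' \<in> tensor_space (fused_idx N (Suc m) d)"
    and eq: "j_site \<eta> (Suc m) d v = j_site \<eta> (Suc m) d v'"
  shows "v = v'"
proof (rule poly_mapping_eqI)
  fix ns
  show "Poly_Mapping.lookup v ns = Poly_Mapping.lookup v' ns"
  proof (cases "ns \<in> listset (fused_idx N (Suc m) d)")
    case False
    then have "ns \<notin> Poly_Mapping.keys v" "ns \<notin> Poly_Mapping.keys v'" using v unfolding tensor_space_def by blast+
    then show ?thesis by (simp add: in_keys_iff)
  next
    case True
    then have ns: "length ns = N" "1 \<le> ns ! m" "ns ! m \<le> d + 2" unfolding in_fused_idx[OF m] using m by auto
    define p b where "p = (if ns ! m \<le> d + 1 then ns ! m else d + 1)" and "b = (if ns ! m \<le> d + 1 then 1 else 2 :: nat)"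
    have pb: "1 \<le> p" "p \<le> d + 1" "b = 1 \<or> b = 2" "p + b - 1 = ns ! m" using ns by (auto simp: p_def b_def)
    have ns_eq: "ns = take m ns @ (p + b - 1) # drop (Suc m) ns" unfolding pb(4) using m ns by (intro id_take_nth_drop) simp
    have len: "length (take m ns) = m" using m ns by simp
    have "j_coeff \<eta> (of_nat d / 2) (of_nat p) b \<noteq> 0" using j_coeff_neq_0(2,3)[OF gen, where p = p and k = "of_nat d / 2"] pb by auto
    moreover have "j_coeff \<eta> (of_nat d / 2) (of_nat p) b * Poly_Mapping.lookup v ns = j_coeff \<eta> (of_nat d / 2) (of_nat p) b * Poly_Mapping.lookup v' ns"
      using lookup_j_site(1)[OF v(1) m len pb(1-3), of \<eta> "drop (Suc m) ns"] lookup_j_site(1)[OF v(2) m len pb(1-3), of \<eta> "drop (Suc m) ns"] eq ns_eq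
      by metis
    ultimately show ?thesis by simp
  qed
qed

section \<open>Values of meromorphic functions\<close>

lemma nonzero_holomorphic_subset: "nonzero_holomorphic N V v \<Longrightarrow> W \<subseteq> V \<Longrightarrow> nonzero_holomorphic N W v"
  unfolding nonzero_holomorphic_def by (meson holomorphic_Cn_subset order_trans)

lemma generically_subset:
  assumes "generically N U P" "open_Cn N W" "W \<subseteq> U" shows "generically N W P"
  unfolding generically_def
proof
  fix t assume t: "t \<in> W"
  then obtain V v where V: "open_Cn N V" "t \<in> V" "nonzero_holomorphic N V v" "\<forall>u\<in>V. v u \<noteq> 0 \<longrightarrow> P u"
    using assms unfolding generically_def by blast
  have "nonzero_holomorphic N (V \<inter> W) v"
    by (rule nonzero_holomorphic_subset[OF V(3)]) simp
  then show "\<exists>V v. open_Cn N V \<and> t \<in> V \<and> V \<subseteq> W \<and> nonzero_holomorphic N V v \<and> (\<forall>u\<in>V. v u \<noteq> 0 \<longrightarrow> P u)"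
    using V t open_Cn_Int[OF V(1) assms(2)] by (intro exI[of _ "V \<inter> W"] exI[of _ v]) auto
qed

lemma generically_mono: "generically N U P \<Longrightarrow> (\<And>u. u \<in> U \<Longrightarrow> P u \<Longrightarrow> Q u) \<Longrightarrow> generically N U Q"
  unfolding generically_def by (meson subsetD)

lemma nonzero_holomorphic_mult:
  assumes U: "open_Cn N U" and v: "nonzero_holomorphic N U v" "nonzero_holomorphic N U w"
  shows "nonzero_holomorphic N U (\<lambda>u. v u * w u)"
  unfolding nonzero_holomorphic_def
proof (intro conjI allI impI)
  show "holomorphic_Cn U (\<lambda>u. v u * w u)"
    using v by (intro holomorphic_Cn_mult[OF U]) (auto simp: nonzero_holomorphic_def)
  fix V assume V: "open_Cn N V \<and> V \<noteq> {} \<and> V \<subseteq> U"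
  obtain V' where "V' \<noteq> {}" "V' \<subseteq> V" "\<And>u. u \<in> V' \<Longrightarrow> v u \<noteq> 0 \<and> w u \<noteq> 0"
    using generic_onE[OF generic_on_conj[OF nonzero_holomorphic_generic_on[OF U v(1)] nonzero_holomorphic_generic_on[OF U v(2)]]] V
    by metis
  then show "\<exists>t\<in>V. v t * w t \<noteq> 0" by auto
qed

lemma generically_conj:
  assumes "generically N U P" "generically N U Q" shows "generically N U (\<lambda>u. P u \<and> Q u)"
  unfolding generically_def
proof
  fix t assume t: "t \<in> U"
  then obtain V v where V: "open_Cn N V" "t \<in> V" "V \<subseteq> U" "nonzero_holomorphic N V v" "\<forall>u\<in>V. v u \<noteq> 0 \<longrightarrow> P u"
    using assms(1) unfolding generically_def by blast
  obtain V' v' where V': "open_Cn N V'" "t \<in> V'" "V' \<subseteq> V" "nonzero_holomorphic N V' v'" "\<forall>u\<in>V'. v' u \<noteq> 0 \<longrightarrow> Q u"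
    using generically_subset[OF assms(2) V(1,3)] V(2) unfolding generically_def by blast
  have "nonzero_holomorphic N V' v"
    by (rule nonzero_holomorphic_subset[OF V(4) V'(3)])
  then have "nonzero_holomorphic N V' (\<lambda>u. v u * v' u)" by (rule nonzero_holomorphic_mult[OF V'(1) _ V'(4)])
  then show "\<exists>V v. open_Cn N V \<and> t \<in> V \<and> V \<subseteq> U \<and> nonzero_holomorphic N V v \<and> (\<forall>u\<in>V. v u \<noteq> 0 \<longrightarrow> P u \<and> Q u)"
    using V V' by (intro exI[of _ V'] exI[of _ "\<lambda>u. v u * v' u"]) auto
qed

lemma nonzero_holomorphic_one: "open_Cn N U \<Longrightarrow> nonzero_holomorphic N U (\<lambda>_. 1)"
  unfolding nonzero_holomorphic_def by (auto intro: holomorphic_Cn_const)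

lemma generically_nonzero:
  assumes "open_Cn N U" "nonzero_holomorphic N U v" "\<And>u. u \<in> U \<Longrightarrow> v u \<noteq> 0 \<Longrightarrow> P u" shows "generically N U P"
  unfolding generically_def using assms by blast

lemma regular_value_unique_0:
  assumes "regular_value N (\<lambda>_. 0) t c" shows "c = 0"
proof -
  obtain U G where U: "open_Cn N U" "t \<in> U" "holomorphic_Cn U G" "generically N U (\<lambda>u. 0 = G u)" "G t = c"
    using assms unfolding regular_value_def by blast
  have "\<exists>\<^sub>F u in nhds_Cn t. 0 = G u"
    by (rule generic_on_frequently[OF generically_imp_generic_on[OF U(4)] U(1,2)])
  then have "0 = G t" by (rule frequently_eq_limit[OF tendsto_const holomorphic_Cn_tendsto[OF U(3,2)]])
  then show ?thesis using U(5) by simp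
qed

lemma meromorphic_Cn_zero: "meromorphic_Cn N (\<lambda>_. 0)"
  unfolding meromorphic_Cn_def
proof (intro conjI allI impI)
  fix t :: "complex list" assume t: "length t = N"
  show "\<exists>U p q. open_Cn N U \<and> t \<in> U \<and> holomorphic_Cn U p \<and> nonzero_holomorphic N U q \<and> (\<forall>u\<in>U. q u \<noteq> 0 \<longrightarrow> 0 = p u / q u)"
    using open_Cn_UNIV[of N] t holomorphic_Cn_const[OF open_Cn_UNIV[of N], of 0] nonzero_holomorphic_one[OF open_Cn_UNIV[of N]]
    by (intro exI[of _ "{t. length t = N}"] exI[of _ "\<lambda>_. 0"] exI[of _ "\<lambda>_. 1"]) simp
next
  show "0 = c" if "regular_value N (\<lambda>_. 0) t c" for t c using regular_value_unique_0[OF that] by simp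
qed simp

text \<open>Near a point where the denominator v is nonzero the quotient S/v is holomorphic, and the chosen
  representative of a meromorphic function takes the correct value there.\<close>

lemma regular_value_quotient:
  assumes f: "meromorphic_Cn N f" and U: "open_Cn N U" and v: "holomorphic_Cn U v" and S: "holomorphic_Cn U S"
    and gen: "generically N U (\<lambda>u. v u * f u = S u)" and u: "u \<in> U" "v u \<noteq> 0"
  shows "regular_value N f u (S u / v u)" "f u = S u / v u"
proof -
  let ?U = "{u\<in>U. v u \<noteq> 0}"
  have U': "open_Cn N ?U" by (rule open_Cn_nonzero[OF U v])
  have "generically N ?U (\<lambda>u. f u = S u / v u)"
    by (rule generically_mono[OF generically_subset[OF gen U']]) (auto simp: field_simps)
  moreover have "holomorphic_Cn ?U (\<lambda>u. S u / v u)"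
    by (rule holomorphic_Cn_divide[OF U']) (auto intro: holomorphic_Cn_subset[OF S] holomorphic_Cn_subset[OF v])
  ultimately show r: "regular_value N f u (S u / v u)"
    unfolding regular_value_def using U' u by (intro exI[of _ ?U] exI[of _ "\<lambda>u. S u / v u"]) auto
  show "f u = S u / v u" using f r unfolding meromorphic_Cn_def by blast
qed

text \<open>A regular value depends only on the generic values of a function, and where there is none both
  representatives are 0.\<close>

lemma meromorphic_Cn_eqI:
  assumes f: "meromorphic_Cn N f" and g: "meromorphic_Cn N g" and gen: "generically N {t. length t = N} (\<lambda>t. f t = g t)"
  shows "f t = g t"
proof -
  have tr: "regular_value N f t c \<Longrightarrow> regular_value N g t c" if gen: "generically N {t. length t = N} (\<lambda>t. f t = g t)" for f g c
  proof -
    assume "regular_value N f t c"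
    then obtain U G where U: "open_Cn N U" "t \<in> U" "holomorphic_Cn U G" "generically N U (\<lambda>u. f u = G u)" "G t = c"
      unfolding regular_value_def by blast
    have "generically N U (\<lambda>u. f u = g u)"
      by (rule generically_subset[OF gen U(1)]) (use U(1) in \<open>auto simp: open_Cn_def\<close>)
    then have "generically N U (\<lambda>u. g u = G u)"
      by (rule generically_mono[OF generically_conj[OF U(4)]]) auto
    then show "regular_value N g t c" unfolding regular_value_def using U by blast
  qed
  have gen': "generically N {t. length t = N} (\<lambda>t. g t = f t)" using gen by (rule generically_mono) simp
  show ?thesis
  proof (cases "\<exists>c. regular_value N f t c")
    case True
    then show ?thesis using tr[OF gen] f g unfolding meromorphic_Cn_def by metis
  next
    case False
    then have "\<nexists>c. regular_value N g t c" using tr[OF gen'] by blast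
    then show ?thesis using False f g unfolding meromorphic_Cn_def by simp
  qed
qed

lemma is_fusion_unique:
  assumes gen: "\<And>n::nat. n > 0 \<Longrightarrow> exp \<eta> ^ n \<noteq> 1" and m: "m < N"
    and G: "is_fusion \<eta> N (Suc m) d f G" "is_fusion \<eta> N (Suc m) d f G'"
  shows "G = G'"
proof (rule ext, rule poly_mapping_eqI)
  fix t i
  have jid: "generically N {t. length t = N} (\<lambda>t. j_site \<eta> (Suc m) d (H t) = f (unfused_pt \<eta> (Suc m) d t))"
    if H: "is_fusion \<eta> N (Suc m) d f H" for H
  proof -
    have "fusion_identity \<eta> N (Suc m) d f H" using H by (simp add: is_fusion_def)
    from this[unfolded fusion_identity_def] show ?thesis by (rule generically_mono) simp
  qed
  have mem: "G u \<in> tensor_space (fused_idx N (Suc m) d)" "G' u \<in> tensor_space (fused_idx N (Suc m) d)" for u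
    using G by (simp_all add: is_fusion_def)
  have mer: "meromorphic_Cn N (\<lambda>t. Poly_Mapping.lookup (G t) i)" "meromorphic_Cn N (\<lambda>t. Poly_Mapping.lookup (G' t) i)"
    using G by (simp_all add: is_fusion_def meromorphic_vec_def)
  have "generically N {t. length t = N} (\<lambda>t. Poly_Mapping.lookup (G t) i = Poly_Mapping.lookup (G' t) i)"
  proof (rule generically_mono[OF generically_conj[OF jid[OF G(1)] jid[OF G(2)]]])
    fix u
    assume "j_site \<eta> (Suc m) d (G u) = f (unfused_pt \<eta> (Suc m) d u) \<and> j_site \<eta> (Suc m) d (G' u) = f (unfused_pt \<eta> (Suc m) d u)"
    then have "j_site \<eta> (Suc m) d (G u) = j_site \<eta> (Suc m) d (G' u)" by simp
    then have "G u = G' u" by (rule j_site_injective[OF _ m mem, rotated]) (use gen in simp)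
    then show "Poly_Mapping.lookup (G u) i = Poly_Mapping.lookup (G' u) i" by simp
  qed
  then show "Poly_Mapping.lookup (G t) i = Poly_Mapping.lookup (G' t) i" by (rule meromorphic_Cn_eqI[OF mer])
qed

section \<open>The substitution\<close>

context
  fixes \<eta> :: complex and d m N :: nat
  assumes m: "m < N"
begin

definition unfused_source :: "nat \<Rightarrow> nat" where "unfused_source i = (if i \<le> m then i else i - 1)"

definition unfused_shift :: "nat \<Rightarrow> complex" where
  "unfused_shift i = (if i = m then \<eta>/2 else if i = Suc m then - (of_nat d / 2 * \<eta>) else 0)"

abbreviation "unfused \<equiv> unfused_pt \<eta> (Suc m) d"

lemma unfused_source_less: "i < N + 1 \<Longrightarrow> unfused_source i < N"
  using m by (auto simp: unfused_source_def)

lemma length_unfused: "length t = N \<Longrightarrow> length (unfused t) = N + 1"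
  using m by (simp add: unfused_pt_def length_split_at)

lemma nth_unfused:
  assumes "length t = N" shows "unfused t ! i = t ! unfused_source i + unfused_shift i"
  using m assms nth_split_at[of m t "t ! m + \<eta>/2" "t ! m - of_nat d / 2 * \<eta>" i]
  by (cases "i < m"; cases "i = m"; cases "i = Suc m") (simp_all add: unfused_pt_def unfused_source_def unfused_shift_def)

lemma unfused_in_polydisc:
  assumes t: "length t = N" and u: "u \<in> polydisc t r" shows "unfused u \<in> polydisc (unfused t) r"
proof -
  have len: "length u = N" using u t by (simp add: polydisc_iff)
  show ?thesis
    using u unfused_source_less unfolding polydisc_iff
    by (auto simp: length_unfused t len nth_unfused[OF t] nth_unfused[OF len])
qed

lemma filterlim_unfused: "length t = N \<Longrightarrow> filterlim unfused (nhds_Cn (unfused t)) (nhds_Cn t)"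
  unfolding filterlim_iff eventually_nhds_Cn using unfused_in_polydisc by blast

text \<open>The coordinate $t_s$ enters two coordinates of $\mathbf{t}'$, so a section of the composition is a
  restriction to a complex line.\<close>

lemma holomorphic_Cn_unfused:
  assumes U: "open_Cn N U" and g: "holomorphic_Cn U' g" and sub: "\<And>t. t \<in> U \<Longrightarrow> unfused t \<in> U'"
  shows "holomorphic_Cn U (\<lambda>t. g (unfused t))"
proof (rule holomorphic_CnI[OF U])
  fix t assume t: "t \<in> U"
  have len: "length t = N" using U t by (simp add: open_Cn_def)
  show "((\<lambda>t. g (unfused t)) \<longlongrightarrow> g (unfused t)) (nhds_Cn t)"
    by (rule filterlim_compose[OF holomorphic_Cn_tendsto[OF g sub[OF t]] filterlim_unfused[OF len]])
  fix r assume r: "r < length t"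
  define e where "e = map (\<lambda>i. if unfused_source i = r then 1 else 0 :: complex) [0..<N + 1]"
  have b: "length (t[r := 0]) = N" using len by simp
  have e: "length e = length (unfused (t[r := 0]))" using length_unfused[OF b] by (simp add: e_def)
  have line: "unfused (t[r := z]) = line_Cn (unfused (t[r := 0])) e z" for z
  proof (rule nth_equalityI)
    have bz: "length (t[r := z]) = N" using len by simp
    show "length (unfused (t[r := z])) = length (line_Cn (unfused (t[r := 0])) e z)"
      using length_unfused[OF b] length_unfused[OF bz] e by simp
    fix i assume "i < length (unfused (t[r := z]))"
    then have i: "i < N + 1" using length_unfused[OF bz] by simp
    have ei: "e ! i = (if unfused_source i = r then 1 else 0)" using i unfolding e_def by (simp only: nth_map length_upt nth_upt diff_zero add_0)
    show "unfused (t[r := z]) ! i = line_Cn (unfused (t[r := 0])) e z ! i"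
      using i e length_unfused[OF b] unfused_source_less[OF i] len r
      by (cases "unfused_source i = r") (simp_all add: nth_unfused[OF b] nth_unfused[OF bz] ei)
  qed
  have "line_Cn (unfused (t[r := 0])) e (t ! r) \<in> U'" using sub[OF t] line[of "t ! r"] by simp
  then have "(\<lambda>z. g (line_Cn (unfused (t[r := 0])) e z)) field_differentiable (at (t ! r))"
    by (rule holomorphic_Cn_field_differentiable_line[OF g e])
  moreover have "(\<lambda>z. g (unfused (t[r := z]))) = (\<lambda>z. g (line_Cn (unfused (t[r := 0])) e z))"
    by (rule ext, rule arg_cong[of _ _ g], rule line)
  ultimately show "(\<lambda>z. g (unfused (t[r := z]))) field_differentiable (at (t ! r))" by (simp only:)
qed

lemma unfused_hyperplane: "length t = N \<Longrightarrow> unfused t ! m - unfused t ! Suc m - (\<eta>/2 + of_nat d / 2 * \<eta>) = 0"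
  by (simp add: nth_unfused unfused_source_def unfused_shift_def)

text \<open>The points $\mathbf{t}'$ are exactly the points of the hyperplane, and the substitution preserves the
  distances of coordinates.\<close>

lemma unfused_surj:
  assumes t: "length t = N" and u: "u \<in> polydisc (unfused t) r"
    and H: "u ! m - u ! Suc m - (\<eta>/2 + of_nat d / 2 * \<eta>) = 0"
  obtains w where "w \<in> polydisc t r" "u = unfused w"
proof
  let ?w = "take m u @ (u ! m - \<eta>/2) # drop (Suc (Suc m)) u"
  have lenu: "length u = N + 1" using u length_unfused[OF t] by (simp add: polydisc_iff)
  have w: "length ?w = N" using m lenu by simp
  have src: "?w ! unfused_source i + unfused_shift i = u ! i" if "i < N + 1" for i
  proof -
    consider "i < m" | "i = m" | "i = Suc m" | e where "i = Suc (Suc (m + e))"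
      using le_Suc_ex[of "Suc (Suc m)" i] by fastforce
    then show ?thesis
    proof cases
      case 3
      have "u ! Suc m = u ! m - (\<eta>/2 + of_nat d / 2 * \<eta>)" using H by (simp add: algebra_simps)
      then show ?thesis using 3 m lenu by (simp add: unfused_source_def unfused_shift_def nth_append)
    qed (use that m lenu in \<open>auto simp: unfused_source_def unfused_shift_def nth_append\<close>)
  qed
  show "u = unfused ?w"
    by (rule nth_equalityI) (use lenu length_unfused[OF w] src nth_unfused[OF w] in auto)
  show "?w \<in> polydisc t r"
    unfolding polydisc_iff
  proof (intro conjI allI impI)
    show "length ?w = length t" using w t by simp
    fix i assume i: "i < length t"
    define j where "j = (if i \<le> m then i else Suc i)"
    have j: "j < N + 1" "unfused_source j = i" using i t by (auto simp: j_def unfused_source_def)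
    have "dist (unfused t ! j) (u ! j) < r" using u j length_unfused[OF t] by (simp add: polydisc_iff)
    then show "dist (t ! i) (?w ! i) < r"
      unfolding nth_unfused[OF t] src[OF j(1), symmetric] j(2) by simp
  qed
qed

end

lemma generic_eq_everywhere:
  assumes U: "open_Cn N U" and f: "holomorphic_Cn U f" and g: "holomorphic_Cn U g"
    and eq: "generic_on N U (\<lambda>u. f u = g u)" and u: "u \<in> U"
  shows "f u = g u"
  by (rule frequently_eq_limit[OF holomorphic_Cn_tendsto[OF f u] holomorphic_Cn_tendsto[OF g u] generic_on_frequently[OF eq U u]])

lemma holomorphic_Cn_sum:
  assumes U: "open_Cn N U" and "finite A" and "\<And>a. a \<in> A \<Longrightarrow> holomorphic_Cn U (f a)"
  shows "holomorphic_Cn U (\<lambda>u. \<Sum>a\<in>A. f a u)"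
  by (rule holomorphic_CnI[OF U])
    (auto intro!: tendsto_sum field_differentiable_sum intro: holomorphic_Cn_tendsto[OF assms(3)] holomorphic_Cn_section[OF assms(3)])

lemma mero_uniform_onD:
  assumes "mero_uniform_on N C w U v W"
  shows "open_Cn N U" "nonzero_holomorphic N U v"
    "\<And>x i. x \<in> C \<Longrightarrow> holomorphic_Cn U (\<lambda>t. Poly_Mapping.lookup (W x t) i)"
    "\<And>x i. x \<in> C \<Longrightarrow> generically N U (\<lambda>t. Poly_Mapping.lookup (W x t) i = v t * Poly_Mapping.lookup (w x t) i)"
    "\<And>i. uniform_limit U (\<lambda>X t. \<Sum>x\<in>X. Poly_Mapping.lookup (W x t) i)
            (\<lambda>t. \<Sum>\<^sub>\<infinity>x\<in>C. Poly_Mapping.lookup (W x t) i) (finite_subsets_at_top C)"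
    "\<And>i. holomorphic_Cn U (\<lambda>t. \<Sum>\<^sub>\<infinity>x\<in>C. Poly_Mapping.lookup (W x t) i)"
    "\<And>i t. t \<in> U \<Longrightarrow> ((\<lambda>x. Poly_Mapping.lookup (W x t) i) has_sum (\<Sum>\<^sub>\<infinity>x\<in>C. Poly_Mapping.lookup (W x t) i)) C"
proof -
  note D = assms[unfolded mero_uniform_on_def]
  show U: "open_Cn N U" and "nonzero_holomorphic N U v" using D by simp_all
  show hol: "holomorphic_Cn U (\<lambda>t. Poly_Mapping.lookup (W x t) i)" if "x \<in> C" for x i
    using D that by blast
  show "generically N U (\<lambda>t. Poly_Mapping.lookup (W x t) i = v t * Poly_Mapping.lookup (w x t) i)" if "x \<in> C" for x i
    using D that by blast
  show lim: "uniform_limit U (\<lambda>X t. \<Sum>x\<in>X. Poly_Mapping.lookup (W x t) i)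
            (\<lambda>t. \<Sum>\<^sub>\<infinity>x\<in>C. Poly_Mapping.lookup (W x t) i) (finite_subsets_at_top C)" for i
    using D by blast
  show "holomorphic_Cn U (\<lambda>t. \<Sum>\<^sub>\<infinity>x\<in>C. Poly_Mapping.lookup (W x t) i)" for i
  proof (rule holomorphic_Cn_uniform_limit[OF U _ _ lim])
    have "\<forall>\<^sub>F X in finite_subsets_at_top C. finite X \<and> X \<subseteq> C" by (rule eventually_finite_subsets_at_top_weakI) auto
    then show "\<forall>\<^sub>F X in finite_subsets_at_top C. holomorphic_Cn U (\<lambda>t. \<Sum>x\<in>X. Poly_Mapping.lookup (W x t) i)"
    proof eventually_elim
      case (elim X)
      then show ?case by (intro holomorphic_Cn_sum[OF U] hol) auto
    qed
  qed simp
  show "((\<lambda>x. Poly_Mapping.lookup (W x t) i) has_sum (\<Sum>\<^sub>\<infinity>x\<in>C. Poly_Mapping.lookup (W x t) i)) C" if "t \<in> U" for i t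
    unfolding has_sum_def by (rule tendsto_uniform_limitI[OF lim that])
qed

section \<open>Fusion of Jackson integral solutions\<close>

text \<open>Near a given t the multiplier v' of the series for $\mathbf{t}'$ may vanish on the whole hyperplane of
  the points $\mathbf{t}'$, so that the defining equation of the sum says nothing there.  A power of the
  equation of the hyperplane is therefore split off from v', from each term and from the sum.  Outside
  the zeros of the multiplier v of the fused series and of the reduced multiplier both solutions are
  sums of their series divided by the multipliers, and the terms correspond under the fusion map at
  generic t, hence at all t by continuity.\<close>

lemma jackson_fusion_identity:
  fixes C :: "complex list set"
  assumes gen: "\<And>n::nat. n > 0 \<Longrightarrow> exp \<eta> ^ n \<noteq> 1" and m: "m < N"
    and ls: "length ls = N" "ls ! m = of_nat d / 2 + 1/2"
    and mer: "\<And>l. l \<in> set ls \<Longrightarrow> F l meromorphic_on UNIV"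
      "\<And>l. l \<in> set (split_at (Suc m) (of_nat d / 2) (1/2) ls) \<Longrightarrow> F' l meromorphic_on UNIV"
    and F: "\<And>r. r < N \<Longrightarrow> r \<noteq> m \<Longrightarrow> F' (ls ! r) = F (ls ! r)"
    and compat: "\<forall>\<^sub>\<approx>z\<in>UNIV. F (of_nat d / 2 + 1/2) z = F' (of_nat d / 2) (z + \<eta>/2) * F' (1/2) (z - of_nat d / 2 * \<eta>)"
    and K: "\<And>x. x \<in> C \<Longrightarrow> K_regular \<eta> \<xi> x"
    and \<Phi>: "mero_sums N C (jackson_summand \<eta> \<xi> g h F ls) \<Phi>"
    and \<Phi>': "mero_sums (N + 1) C (jackson_summand \<eta> \<xi> g h F' (split_at (Suc m) (of_nat d / 2) (1/2) ls)) \<Phi>'"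
  shows "fusion_identity \<eta> N (Suc m) d (\<lambda>t. pr (unfused_idx N (Suc m) d) (\<Phi>' t)) (\<lambda>t. pr (fused_idx N (Suc m) d) (\<Phi> t))"
proof -
  let ?ls' = "split_at (Suc m) (of_nat d / 2) (1/2) ls"
  let ?unf = "unfused_pt \<eta> (Suc m) d"
  let ?w = "jackson_summand \<eta> \<xi> g h F ls" and ?w' = "jackson_summand \<eta> \<xi> g h F' ?ls'"
  let ?c = "\<eta>/2 + of_nat d / 2 * \<eta>"
  let ?L = "\<lambda>u::complex list. u ! m - u ! Suc m - ?c"
  have \<eta>: "sinh \<eta> \<noteq> 0" using j_coeff_neq_0(1)[OF gen, where p = 1] by simp
  have len': "length ?ls' = N + 1" using ls m by (simp add: length_split_at)
  define good where "good x t \<longleftrightarrow> regular_point \<eta> F ls x t \<and> regular_point \<eta> F' ?ls' x (?unf t) \<and>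
     (\<forall>y\<in>set x. \<forall>z\<in>{t ! m + y, t ! m - y}.
         F (of_nat d / 2 + 1/2) z = F' (of_nat d / 2) (z + \<eta>/2) * F' (1/2) (z - of_nat d / 2 * \<eta>))" for x t
  have good_generic: "generic_on N {t. length t = N} (good x)" for x
    unfolding good_def
  proof (intro generic_on_conj)
    show "generic_on N {t. length t = N} (regular_point \<eta> F ls x)"
    proof (rule generic_on_regular_point[where p = "\<lambda>t. t", OF mer(1)])
      fix r assume "r < length ls"
      then show "\<exists>i<N. \<exists>c. \<forall>t::complex list. length t = N \<longrightarrow> t ! r = t ! i + c"
        using ls(1) by (intro exI[of _ r] conjI exI[of _ "0::complex"]) auto
    qed
    show "generic_on N {t. length t = N} (\<lambda>t. regular_point \<eta> F' ?ls' x (?unf t))"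
    proof (rule generic_on_regular_point[OF mer(2)])
      fix r assume "r < length ?ls'"
      then show "\<exists>i<N. \<exists>c. \<forall>t. length t = N \<longrightarrow> ?unf t ! r = t ! i + c"
        using unfused_source_less[OF m, of r] nth_unfused[OF m] len'
        by (intro exI[of _ "unfused_source m r"] conjI exI[of _ "unfused_shift \<eta> d m r"]) auto
    qed
    let ?Q = "\<lambda>z. F (of_nat d / 2 + 1/2) z = F' (of_nat d / 2) (z + \<eta>/2) * F' (1/2) (z - of_nat d / 2 * \<eta>)"
    have Q: "eventually ?Q (at z)" for z using compat by (simp add: eventually_cosparse_open_eq)
    have "generic_on N {t. length t = N} (\<lambda>t. \<forall>y\<in>set x. ?Q (t ! m + y) \<and> ?Q (t ! m - y))"
    proof (rule generic_on_ball_finite)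
      fix y
      have "generic_on N {t. length t = N} (\<lambda>t. ?Q (t ! m + y))" "generic_on N {t. length t = N} (\<lambda>t. ?Q (t ! m + (- y)))"
        by (rule generic_on_coordinate[OF eventually_at_shift[OF Q] m])+
      then show "generic_on N {t. length t = N} (\<lambda>t. ?Q (t ! m + y) \<and> ?Q (t ! m - y))"
        by (simp only: diff_conv_add_uminus generic_on_conj)
    qed simp
    then show "generic_on N {t. length t = N} (\<lambda>t. \<forall>y\<in>set x. \<forall>z\<in>{t ! m + y, t ! m - y}. ?Q z)"
      by (rule generic_on_mono) blast
  qed
  have fused: "fused \<eta> d m (?w x t) (?w' x (?unf t))" if "x \<in> C" "length t = N" "good x t" for x t
  proof (rule fused_jackson_summand[OF m ls that(2) \<eta> K[OF that(1)]])
    show "regular_point \<eta> F ls x t" "regular_point \<eta> F' ?ls' x (?unf t)" using that(3) by (simp_all add: good_def)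
    show "F' (ls ! r) = F (ls ! r)" if "r < N" "r \<noteq> m" for r by (rule F[OF that])
    show "\<forall>z\<in>{t ! m + y, t ! m - y}. F (of_nat d / 2 + 1/2) z
        = F' (of_nat d / 2) (z + \<eta>/2) * F' (1/2) (z - of_nat d / 2 * \<eta>)" if "y \<in> set x" for y
      using \<open>good x t\<close> that unfolding good_def by blast
  qed
  have cont: "((\<lambda>u. Poly_Mapping.lookup (?w' x u) i) \<longlongrightarrow> Poly_Mapping.lookup (?w' x (?unf t)) i) (nhds_Cn (?unf t))"
    if "x \<in> C" "length t = N" "good x t" for x t i
  proof -
    have "length (?unf t) = length ?ls'" using length_unfused[OF m that(2)] len' by simp
    moreover have "regular_point \<eta> F' ?ls' x (?unf t)" using that(3) by (simp add: good_def)
    ultimately have "continuous_vec (?unf t) (?w' x)" by (rule continuous_jackson_summand[OF \<eta> _ _ K[OF that(1)]])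
    then show ?thesis unfolding continuous_vec_def by blast
  qed
  have \<Phi>_mer: "meromorphic_Cn N (\<lambda>t. Poly_Mapping.lookup (\<Phi> t) i)" for i
    using \<Phi> unfolding mero_sums_def meromorphic_vec_def by blast
  have \<Phi>'_mer: "meromorphic_Cn (N + 1) (\<lambda>t. Poly_Mapping.lookup (\<Phi>' t) i)" for i
    using \<Phi>' unfolding mero_sums_def meromorphic_vec_def by blast
  show ?thesis
    unfolding fusion_identity_def generically_def[of N "{t. length t = N}"]
  proof
    fix t0 assume "t0 \<in> {t :: complex list. length t = N}"
    then have t0: "length t0 = N" by simp
    let ?t0' = "?unf t0"
    have t0': "length ?t0' = N + 1" by (rule length_unfused[OF m t0])
    obtain U v W where U: "t0 \<in> U" "mero_uniform_on N C ?w U v W"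
      and U_eq: "\<And>i. generically N U (\<lambda>t. v t * Poly_Mapping.lookup (\<Phi> t) i = (\<Sum>\<^sub>\<infinity>x\<in>C. Poly_Mapping.lookup (W x t) i))"
      using \<Phi> t0 unfolding mero_sums_def by blast
    obtain U' v' W' where U': "?t0' \<in> U'" "mero_uniform_on (N + 1) C ?w' U' v' W'"
      and U'_eq: "\<And>i. generically (N + 1) U' (\<lambda>t. v' t * Poly_Mapping.lookup (\<Phi>' t) i = (\<Sum>\<^sub>\<infinity>x\<in>C. Poly_Mapping.lookup (W' x t) i))"
      using \<Phi>' t0' unfolding mero_sums_def by blast
    note D = mero_uniform_onD[OF U(2)] and D' = mero_uniform_onD[OF U'(2)]
    obtain R1 R2 where R1: "R1 > 0" "polydisc t0 R1 \<subseteq> U" and R2: "R2 > 0" "polydisc ?t0' R2 \<subseteq> U'"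
      using U(1) U'(1) D(1) D'(1) unfolding open_Cn_def by meson
    define R where "R = min R1 R2"
    define P P' where "P = polydisc t0 R" and "P' = polydisc ?t0' R"
    have R: "R > 0" and PU: "P \<subseteq> U" "P' \<subseteq> U'"
      using R1 R2 polydisc_mono[of R R1 t0] polydisc_mono[of R R2 ?t0'] by (auto simp: R_def P_def P'_def)
    have P: "open_Cn N P" "t0 \<in> P" and P': "open_Cn (N + 1) P'" "?t0' \<in> P'"
      using open_polydisc[of t0 R] open_polydisc[of ?t0' R] t0 t0' centre_in_polydisc[OF R] by (auto simp: P_def P'_def)
    have PN: "length t = N" if "t \<in> P" for t using P(1) that by (simp add: open_Cn_def)
    have unfP: "?unf t \<in> P'" if "t \<in> P" for t
      using unfused_in_polydisc[OF m t0] that by (simp add: P_def P'_def)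
    have unfL: "?L (?unf t) = 0" if "t \<in> P" for t by (rule unfused_hyperplane[OF m PN[OF that]])
    have ij: "m < length ?t0'" "Suc m < length ?t0'" "m \<noteq> Suc m" using m t0' by auto
    \<comment> \<open>The multiplier may vanish on the hyperplane of the points t', so the power of the equation that it
      contains is split off.\<close>
    obtain u0 where u0: "u0 \<in> P'" "v' u0 \<noteq> 0"
      using D'(2) P' PU(2) unfolding nonzero_holomorphic_def by blast
    have hol_v': "holomorphic_Cn P' v'"
      using D'(2) PU(2) unfolding nonzero_holomorphic_def by (blast intro: holomorphic_Cn_subset)
    have t0H: "?t0' ! m = ?t0' ! Suc m + ?c" using unfused_hyperplane[OF m t0, of \<eta> d] by (simp add: algebra_simps)
    obtain q vh where vh: "holomorphic_Cn P' vh" "\<And>u. u \<in> P' \<Longrightarrow> v' u = ?L u ^ q * vh u"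
      "\<exists>u\<in>P'. u ! m = u ! Suc m + ?c \<and> vh u \<noteq> 0"
      using holomorphic_Cn_factor_hyperplane[OF hol_v'[unfolded P'_def] ij t0H u0[unfolded P'_def]] unfolding P'_def by metis
    define S where "S i t = (\<Sum>\<^sub>\<infinity>x\<in>C. Poly_Mapping.lookup (W x t) i)" for i t
    define S' where "S' i t = (\<Sum>\<^sub>\<infinity>x\<in>C. Poly_Mapping.lookup (W' x t) i)" for i t
    have dense: "\<exists>u'\<in>P'. u' \<in> polydisc u e \<and> ?L u' = 0 \<and>
        ((\<lambda>u. Poly_Mapping.lookup (?w' x u) i) \<longlongrightarrow> Poly_Mapping.lookup (?w' x u') i) (nhds_Cn u')"
      if x: "x \<in> C" and u: "u \<in> P'" "?L u = 0" and e: "e > 0" for x u e i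
    proof -
      obtain t where t: "t \<in> P" "u = ?unf t"
        using unfused_surj[OF m t0 u[unfolded P'_def]] unfolding P_def by metis
      have a1: "open_Cn N (polydisc t e \<inter> P)" using open_Cn_Int[OF _ P(1)] open_polydisc[of t e] PN[OF t(1)] by simp
      have a2: "polydisc t e \<inter> P \<noteq> {}" using centre_in_polydisc[OF e] t(1) by blast
      have a3: "polydisc t e \<inter> P \<subseteq> {t. length t = N}" using PN by blast
      obtain V' where V': "V' \<noteq> {}" "V' \<subseteq> polydisc t e \<inter> P" "\<And>u. u \<in> V' \<Longrightarrow> good x u"
        using generic_onE[OF good_generic[of x] a1 a2 a3] by metis
      obtain t' where "t' \<in> V'" using V'(1) by (meson ex_in_conv)
      then have t': "t' \<in> polydisc t e" "t' \<in> P" "good x t'" using V'(2,3) by (simp_all add: subset_iff)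
      have near: "?unf t' \<in> polydisc u e" unfolding t(2) by (rule unfused_in_polydisc[OF m PN[OF t(1)] t'(1)])
      show ?thesis
        by (rule bexI[OF _ unfP[OF t'(2)]], intro conjI, rule near, rule unfL[OF t'(2)], rule cont[OF x PN[OF t'(2)] t'(3)])
    qed
    define quotient_of where "quotient_of i W1 S1 \<longleftrightarrow> (\<forall>x\<in>C. holomorphic_Cn P' (W1 x)) \<and> holomorphic_Cn P' S1 \<and> (\<forall>u\<in>P'. S' i u = ?L u ^ q * S1 u) \<and>
       (\<forall>u\<in>P'. ?L u = 0 \<longrightarrow> ((\<lambda>x. W1 x u) has_sum S1 u) C) \<and>
       (\<forall>x\<in>C. \<forall>u\<in>P'. ?L u = 0 \<longrightarrow> ((\<lambda>u. Poly_Mapping.lookup (?w' x u) i) \<longlongrightarrow> Poly_Mapping.lookup (?w' x u) i) (nhds_Cn u)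
          \<longrightarrow> W1 x u = vh u * Poly_Mapping.lookup (?w' x u) i)"
      for i W1 S1
    have ex: "\<exists>W1 S1. quotient_of i W1 S1" for i
    proof -
      have W1: "holomorphic_Cn (polydisc ?t0' R) (\<lambda>u. Poly_Mapping.lookup (W' x u) i)" if "x \<in> C" for x
        using holomorphic_Cn_subset[OF D'(3)[OF that] PU(2)] unfolding P'_def .
      have W2: "generic_on (length ?t0') (polydisc ?t0' R) (\<lambda>u. Poly_Mapping.lookup (W' x u) i = v' u * Poly_Mapping.lookup (?w' x u) i)" if "x \<in> C" for x
        using generic_on_subset[OF generically_imp_generic_on[OF D'(4)[OF that]] PU(2)] unfolding P'_def t0' .
      have S1: "holomorphic_Cn (polydisc ?t0' R) (S' i)"
        using holomorphic_Cn_subset[OF D'(6) PU(2)] unfolding P'_def S'_def .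
      have lim: "uniform_limit (polydisc ?t0' R) (\<lambda>X u. \<Sum>x\<in>X. Poly_Mapping.lookup (W' x u) i) (S' i) (finite_subsets_at_top C)"
        using uniform_limit_on_subset[OF D'(5) PU(2)] unfolding P'_def S'_def .
      show ?thesis
      proof (rule divide_series_hyperplane[where t = ?t0' and R = R and i = m and j = "Suc m" and c = ?c and C = C
            and W = "\<lambda>x u. Poly_Mapping.lookup (W' x u) i" and w = "\<lambda>x u. Poly_Mapping.lookup (?w' x u) i"
            and v = v' and v' = vh and m = q and S = "S' i", OF ij])
        show "holomorphic_Cn (polydisc ?t0' R) vh" using vh(1) unfolding P'_def .
        show "v' u = ?L u ^ q * vh u" if "u \<in> polydisc ?t0' R" for u using vh(2) that unfolding P'_def by blast
        show "\<exists>u'\<in>polydisc ?t0' R. u' \<in> polydisc u e \<and> ?L u' = 0 \<and>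
            ((\<lambda>u. Poly_Mapping.lookup (?w' x u) i) \<longlongrightarrow> Poly_Mapping.lookup (?w' x u') i) (nhds_Cn u')"
          if "x \<in> C" "u \<in> polydisc ?t0' R" "?L u = 0" "e > 0" for x u e
          by (rule dense[unfolded P'_def, OF that])
        fix W1 S1
        assume a: "\<And>x. x \<in> C \<Longrightarrow> holomorphic_Cn (polydisc ?t0' R) (W1 x)" "holomorphic_Cn (polydisc ?t0' R) S1"
          "\<And>u. u \<in> polydisc ?t0' R \<Longrightarrow> S' i u = ?L u ^ q * S1 u"
          "\<And>u. u \<in> polydisc ?t0' R \<Longrightarrow> ?L u = 0 \<Longrightarrow> ((\<lambda>x. W1 x u) has_sum S1 u) C"
          "\<And>x u. x \<in> C \<Longrightarrow> u \<in> polydisc ?t0' R \<Longrightarrow> ?L u = 0 \<Longrightarrow>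
             ((\<lambda>u. Poly_Mapping.lookup (?w' x u) i) \<longlongrightarrow> Poly_Mapping.lookup (?w' x u) i) (nhds_Cn u) \<Longrightarrow>
             W1 x u = vh u * Poly_Mapping.lookup (?w' x u) i"
        show ?thesis
          unfolding quotient_of_def P'_def by (intro exI[of _ W1] exI[of _ S1] conjI ballI impI a)
      qed (rule W1 W2 S1 lim; assumption?)+
    qed
    obtain W1 S1 where quot: "\<And>i. quotient_of i (W1 i) (S1 i)" using ex by metis
    have W1: "holomorphic_Cn P' (W1 i x)" if "x \<in> C" for i x
      using quot[of i] that unfolding quotient_of_def by blast
    have S1: "holomorphic_Cn P' (S1 i)" "u \<in> P' \<Longrightarrow> S' i u = ?L u ^ q * S1 i u" for i u
      using quot[of i] unfolding quotient_of_def by blast+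
    have sum1: "((\<lambda>x. W1 i x u) has_sum S1 i u) C" if "u \<in> P'" "?L u = 0" for i u
      using quot[of i] that unfolding quotient_of_def by blast
    have val1: "W1 i x u = vh u * Poly_Mapping.lookup (?w' x u) i"
      if "x \<in> C" "u \<in> P'" "?L u = 0" "((\<lambda>u. Poly_Mapping.lookup (?w' x u) i) \<longlongrightarrow> Poly_Mapping.lookup (?w' x u) i) (nhds_Cn u)" for i x u
      using quot[of i] that unfolding quotient_of_def by blast
    \<comment> \<open>The reduced multiplier does not vanish identically on the hyperplane, so by the identity theorem its
      restriction vanishes on no open set.\<close>
    have hol_v: "holomorphic_Cn P v" and nz_v: "nonzero_holomorphic N P v"
      using nonzero_holomorphic_subset[OF D(2) PU(1)] by (simp_all add: nonzero_holomorphic_def)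
    have hol_vh: "holomorphic_Cn P (\<lambda>t. vh (?unf t))"
      by (rule holomorphic_Cn_unfused[OF m P(1) vh(1) unfP])
    have nz_vh: "nonzero_holomorphic N P (\<lambda>t. vh (?unf t))"
      unfolding nonzero_holomorphic_def
    proof (intro conjI allI impI hol_vh)
      fix V assume V: "open_Cn N V \<and> V \<noteq> {} \<and> V \<subseteq> P"
      obtain u where u: "u \<in> P'" "?L u = 0" "vh u \<noteq> 0" using vh(3) by (auto simp: algebra_simps)
      obtain t where t: "t \<in> P" "u = ?unf t"
        using unfused_surj[OF m t0 u(1,2)[unfolded P'_def]] unfolding P_def by metis
      show "\<exists>t\<in>V. vh (?unf t) \<noteq> 0"
      proof (rule ccontr)
        assume "\<not> ?thesis"
        then have "vh (?unf t) = 0"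
          by (intro identity_polydisc[OF hol_vh[unfolded P_def], of V t]) (use V t t0 in \<open>auto simp: P_def\<close>)
        then show False using u t by simp
      qed
    qed
    have "regular_vec (N + 1) (\<lambda>t. pr (unfused_idx N (Suc m) d) (\<Phi>' t)) (?unf t) \<and>
       j_site \<eta> (Suc m) d (pr (fused_idx N (Suc m) d) (\<Phi> t)) = pr (unfused_idx N (Suc m) d) (\<Phi>' (?unf t))"
      if t: "t \<in> P" and nz: "v t * vh (?unf t) \<noteq> 0" for t
    proof
      have tN: "length t = N" by (rule PN[OF t])
      have nz1: "v t \<noteq> 0" "vh (?unf t) \<noteq> 0" using nz by auto
      have "generically (N + 1) P' (\<lambda>u. vh u * Poly_Mapping.lookup (\<Phi>' u) i = S1 i u)" for i
      proof (rule generically_mono[OF generically_conj[OF generically_subset[OF U'_eq P'(1) PU(2)]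
            generically_nonzero[OF P'(1) nonzero_holomorphic_coordinate_difference[OF P'(1), of m "Suc m" ?c], where P = "\<lambda>u. ?L u \<noteq> 0"]]])
        show "m < N + 1" "Suc m < N + 1" "m \<noteq> Suc m" using m by auto
        fix u assume u: "u \<in> P'" "v' u * Poly_Mapping.lookup (\<Phi>' u) i = (\<Sum>\<^sub>\<infinity>x\<in>C. Poly_Mapping.lookup (W' x u) i) \<and> ?L u \<noteq> 0"
        have "?L u ^ q * (vh u * Poly_Mapping.lookup (\<Phi>' u) i) = v' u * Poly_Mapping.lookup (\<Phi>' u) i"
          by (simp only: vh(2)[OF u(1)] mult.assoc)
        also have "\<dots> = S' i u" using u(2) by (simp only: S'_def)
        also have "\<dots> = ?L u ^ q * S1 i u" by (rule S1(2)[OF u(1)])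
        finally have E: "?L u ^ q * (vh u * Poly_Mapping.lookup (\<Phi>' u) i) = ?L u ^ q * S1 i u" .
        have "?L u ^ q \<noteq> 0" using u(2) by (intro power_not_zero) blast
        from mult_left_cancel[OF this, THEN iffD1, OF E] show "vh u * Poly_Mapping.lookup (\<Phi>' u) i = S1 i u" .
      qed
      note reg = regular_value_quotient[OF \<Phi>'_mer P'(1) vh(1) S1(1) this unfP[OF t] nz1(2)]
      show "regular_vec (N + 1) (\<lambda>t. pr (unfused_idx N (Suc m) d) (\<Phi>' t)) (?unf t)"
        unfolding regular_vec_def lookup_pr
      proof
        fix i
        show "\<exists>c. regular_value (N + 1) (\<lambda>u. if i \<in> listset (unfused_idx N (Suc m) d) then Poly_Mapping.lookup (\<Phi>' u) i else 0) (?unf t) c"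
        proof (cases "i \<in> listset (unfused_idx N (Suc m) d)")
          case True
          then show ?thesis using reg(1)[of i] by auto
        next
          case False
          have "generically (N + 1) P' (\<lambda>u. 0 = (0::complex))"
            by (rule generically_nonzero[OF P'(1) nonzero_holomorphic_one[OF P'(1)]]) simp
          then show ?thesis using False unfP[OF t] P'(1) holomorphic_Cn_const[OF P'(1), of 0]
            unfolding regular_value_def
            by (intro exI[of _ "0::complex"] exI[of _ P'] exI[of _ "\<lambda>_. 0::complex"]) simp
        qed
      qed
      have \<Phi>t: "Poly_Mapping.lookup (\<Phi> t) i = S i t / v t" for i
      proof (rule regular_value_quotient(2)[OF \<Phi>_mer P(1) hol_v])
        show "holomorphic_Cn P (S i)" unfolding S_def by (rule holomorphic_Cn_subset[OF D(6) PU(1)])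
        show "generically N P (\<lambda>u. v u * Poly_Mapping.lookup (\<Phi> u) i = S i u)"
          unfolding S_def by (rule generically_subset[OF U_eq P(1) PU(1)])
      qed (rule t, rule nz1(1))
      show "j_site \<eta> (Suc m) d (pr (fused_idx N (Suc m) d) (\<Phi> t)) = pr (unfused_idx N (Suc m) d) (\<Phi>' (?unf t))"
      proof (rule poly_mapping_eqI)
        fix js
        show "Poly_Mapping.lookup (j_site \<eta> (Suc m) d (pr (fused_idx N (Suc m) d) (\<Phi> t))) js
          = Poly_Mapping.lookup (pr (unfused_idx N (Suc m) d) (\<Phi>' (?unf t))) js"
        proof (cases "js \<in> listset (unfused_idx N (Suc m) d)")
          case False
          then show ?thesis using lookup_j_site(2)[OF pr_in_tensor_space m False] by (simp add: lookup_pr)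
        next
          case True
          then obtain pre p b post where js: "js = pre @ p # b # post" "length pre = m" "length post = N - m - 1" "1 \<le> p" "p \<le> d + 1"
            "b = 1 \<or> b = 2" and ge: "\<forall>n\<in>set pre \<union> set post. 1 \<le> n" unfolding in_unfused_idx[OF m] by blast
          define ns where "ns = pre @ (p + b - 1) # post"
          define J where "J = j_coeff \<eta> (of_nat d / 2) (of_nat p) b"
          have "\<forall>n\<in>set ns. 1 \<le> n" using js ge by (auto simp: ns_def)
          then have ns: "ns \<in> listset (fused_idx N (Suc m) d)"
            unfolding in_fused_idx[OF m]
          proof (intro conjI allI impI)
            show len: "length ns = N" using js m by (simp add: ns_def)
            show "1 \<le> ns ! i" if "i < N" for i using \<open>\<forall>n\<in>set ns. 1 \<le> n\<close> nth_mem[of i ns] len that by simp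
            show "ns ! m \<le> d + 2" using js by (auto simp: ns_def nth_append)
          qed
          have term_eq: "v t * W1 js x (?unf t) = vh (?unf t) * (J * Poly_Mapping.lookup (W x t) ns)" if x: "x \<in> C" for x
          proof (rule generic_eq_everywhere[OF P(1) _ _ _ t, where f = "\<lambda>t. v t * W1 js x (?unf t)"
                and g = "\<lambda>t. vh (?unf t) * (J * Poly_Mapping.lookup (W x t) ns)"])
            show "holomorphic_Cn P (\<lambda>t. v t * W1 js x (?unf t))"
              by (intro holomorphic_Cn_mult[OF P(1)] hol_v holomorphic_Cn_unfused[OF m P(1) W1[OF x] unfP])
            show "holomorphic_Cn P (\<lambda>t. vh (?unf t) * (J * Poly_Mapping.lookup (W x t) ns))"
              by (intro holomorphic_Cn_mult[OF P(1)] hol_vh holomorphic_Cn_const[OF P(1)] holomorphic_Cn_subset[OF D(3)[OF x] PU(1)])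
            have "generic_on N P (\<lambda>t. Poly_Mapping.lookup (W x t) ns = v t * Poly_Mapping.lookup (?w x t) ns \<and> good x t)"
            proof (rule generic_on_conj)
              show "generic_on N P (\<lambda>t. Poly_Mapping.lookup (W x t) ns = v t * Poly_Mapping.lookup (?w x t) ns)"
                by (rule generic_on_subset[OF generically_imp_generic_on[OF D(4)[OF x]] PU(1)])
              show "generic_on N P (good x)" by (rule generic_on_subset[OF good_generic]) (use PN in auto)
            qed
            then show "generic_on N P (\<lambda>t. v t * W1 js x (?unf t) = vh (?unf t) * (J * Poly_Mapping.lookup (W x t) ns))"
            proof (rule generic_on_mono)
              fix t assume t: "t \<in> P" and a: "Poly_Mapping.lookup (W x t) ns = v t * Poly_Mapping.lookup (?w x t) ns \<and> good x t"
              have "W1 js x (?unf t) = vh (?unf t) * Poly_Mapping.lookup (?w' x (?unf t)) js"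
                by (rule val1[OF x unfP[OF t] unfL[OF t] cont[OF x PN[OF t]]]) (use a in blast)
              moreover have "Poly_Mapping.lookup (?w' x (?unf t)) js = J * Poly_Mapping.lookup (?w x t) ns"
                unfolding js(1) ns_def J_def by (rule fusedD[OF fused[OF x PN[OF t]] js(2,4-6)]) (use a in blast)
              ultimately show "v t * W1 js x (?unf t) = vh (?unf t) * (J * Poly_Mapping.lookup (W x t) ns)"
                using a by (simp add: mult_ac)
            qed
          qed
          have "((\<lambda>x. v t * W1 js x (?unf t)) has_sum v t * S1 js (?unf t)) C"
            by (rule has_sum_cmult_right[OF sum1[OF unfP[OF t] unfL[OF t]]])
          moreover have "((\<lambda>x. vh (?unf t) * (J * Poly_Mapping.lookup (W x t) ns)) has_sum vh (?unf t) * (J * S ns t)) C"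
            unfolding S_def by (intro has_sum_cmult_right D(7)) (use t PU in blast)
          then have "((\<lambda>x. v t * W1 js x (?unf t)) has_sum vh (?unf t) * (J * S ns t)) C"
            using has_sum_cong[of C "\<lambda>x. v t * W1 js x (?unf t)" "\<lambda>x. vh (?unf t) * (J * Poly_Mapping.lookup (W x t) ns)"] term_eq by blast
          ultimately have "v t * S1 js (?unf t) = vh (?unf t) * (J * S ns t)" by (rule has_sum_unique)
          then have "J * (S ns t / v t) = S1 js (?unf t) / vh (?unf t)" using nz1 by (simp add: field_simps)
          moreover have "Poly_Mapping.lookup (j_site \<eta> (Suc m) d (pr (fused_idx N (Suc m) d) (\<Phi> t))) js = J * Poly_Mapping.lookup (\<Phi> t) ns"
            unfolding js(1) using lookup_j_site(1)[OF pr_in_tensor_space m js(2,4-6), of \<eta> "\<Phi> t" post] ns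
            by (simp add: lookup_pr J_def ns_def)
          ultimately show ?thesis using True reg(2)[of js] by (simp add: \<Phi>t lookup_pr)
        qed
      qed
    qed
    then show "\<exists>V v. open_Cn N V \<and> t0 \<in> V \<and> V \<subseteq> {t. length t = N} \<and> nonzero_holomorphic N V v \<and>
        (\<forall>u\<in>V. v u \<noteq> 0 \<longrightarrow> regular_vec (N + 1) (\<lambda>t. pr (unfused_idx N (Suc m) d) (\<Phi>' t)) (?unf u) \<and>
          j_site \<eta> (Suc m) d (pr (fused_idx N (Suc m) d) (\<Phi> u)) = pr (unfused_idx N (Suc m) d) (\<Phi>' (?unf u)))"
      using P PN nonzero_holomorphic_mult[OF P(1) nz_v nz_vh]
      by (intro exI[of _ P] exI[of _ "\<lambda>t. v t * vh (?unf t)"]) blast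
  qed
qed


theorem proposition8p3:
  fixes \<eta> \<tau> \<xi>p \<xi>m k :: complex and S N s d :: nat
    and ls ls' x0 :: "complex list"
    and g h :: "complex \<Rightarrow> complex" and F F' :: "complex \<Rightarrow> complex \<Rightarrow> complex"
    and \<Phi> \<Phi>' f f' :: "complex list \<Rightarrow> nat list \<Rightarrow>\<^sub>0 complex"
  assumes "\<And>n::nat. n > 0 \<Longrightarrow> exp \<eta> ^ n \<noteq> 1" and "\<tau> \<noteq> 0"
    and "1 \<le> s" and "s \<le> N" and "length ls = N"
    and "k = of_nat d / 2" and "ls ! (s - 1) = k + 1/2"
    and "ls' = split_at s k (1/2) ls"
    and "g_weight \<eta> \<tau> \<xi>p \<xi>m g" and "h_weight \<eta> \<tau> h"
    and "\<And>l. l \<in> set ls \<Longrightarrow> F_weight \<eta> \<tau> l (F l)"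
    and "\<And>l. l \<in> set ls' \<Longrightarrow> F_weight \<eta> \<tau> l (F' l)"
    and "\<And>j. j \<in> {1..N} - {s} \<Longrightarrow> F' (ls ! (j - 1)) = F (ls ! (j - 1))"
    and "\<forall>\<^sub>\<approx>x\<in>UNIV. F (k + 1/2) x = F' k (x + \<eta>/2) * F' (1/2) (x - k * \<eta>)"
    and "length x0 = S" and "generic_base \<eta> \<tau> \<xi>m g h x0"
    and "jackson_solution \<eta> \<tau> \<xi>m g h F x0 ls \<Phi>"
    and "jackson_solution \<eta> \<tau> \<xi>m g h F' x0 ls' \<Phi>'"
    and "f = (\<lambda>t. pr (fused_idx N s d) (\<Phi> t))"
    and "f' = (\<lambda>t. pr (unfused_idx N s d) (\<Phi>' t))"
  shows "(\<exists>!G. is_fusion \<eta> N s d f' G) \<and> f = Fus \<eta> N s d f' \<and> fusion_identity \<eta> N s d f' f"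
proof -
  obtain m where s: "s = Suc m" using assms(3) by (cases s) auto
  have m: "m < N" using assms(4) s by simp
  have k: "k = of_nat d / 2" by (rule assms(6))
  have ls: "length ls = N" "ls ! m = of_nat d / 2 + 1/2" using assms(5,7) s k by simp_all
  have ls': "ls' = split_at (Suc m) (of_nat d / 2) (1/2) ls" using assms(8) s k by simp
  have len': "length ls' = N + 1" using ls' ls m by (simp add: length_split_at)
  let ?C = "jackson_lattice \<tau> x0"
  have K: "K_regular \<eta> \<xi>m x" if x: "x \<in> ?C" for x
    unfolding K_regular_def
  proof
    fix z assume "z \<in> set x"
    then obtain i where i: "i < length x" "z = x ! i" by (auto simp: in_set_conv_nth)
    then have "i < length x0" using x by (simp add: jackson_lattice_def)
    then show "sinh (\<xi>m - z - \<eta>/2) \<noteq> 0 \<and> sinh (\<xi>m + z + \<eta>/2) \<noteq> 0"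
      using assms(16) x i(2) unfolding generic_base_def by blast
  qed
  have identity: "fusion_identity \<eta> N s d f' f"
    unfolding assms(19,20) s
  proof (rule jackson_fusion_identity[OF assms(1) m ls _ _ _ _ K])
    show "F l meromorphic_on UNIV" if "l \<in> set ls" for l using assms(11)[OF that] by (simp add: F_weight_def)
    show "F' l meromorphic_on UNIV" if "l \<in> set (split_at (Suc m) (of_nat d / 2) (1/2) ls)" for l
      using assms(12)[of l] that ls' by (simp add: F_weight_def)
    show "F' (ls ! r) = F (ls ! r)" if "r < N" "r \<noteq> m" for r
      using assms(13)[of "Suc r"] that s by simp
    show "\<forall>\<^sub>\<approx>z\<in>UNIV. F (of_nat d / 2 + 1/2) z = F' (of_nat d / 2) (z + \<eta>/2) * F' (1/2) (z - of_nat d / 2 * \<eta>)"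
      using assms(14) unfolding k .
    show "mero_sums N ?C (jackson_summand \<eta> \<xi>m g h F ls) \<Phi>"
      using assms(17) ls(1) unfolding jackson_solution_def by simp
    show "mero_sums (N + 1) ?C (jackson_summand \<eta> \<xi>m g h F' (split_at (Suc m) (of_nat d / 2) (1/2) ls)) \<Phi>'"
      using assms(18) unfolding jackson_solution_def len' ls'[symmetric] .
  qed
  have mer: "meromorphic_Cn N (\<lambda>t. Poly_Mapping.lookup (\<Phi> t) i)" for i
    using assms(17) ls(1) unfolding jackson_solution_def mero_sums_def meromorphic_vec_def by blast
  have "meromorphic_vec N f"
    unfolding meromorphic_vec_def
  proof
    fix i
    show "meromorphic_Cn N (\<lambda>t. Poly_Mapping.lookup (f t) i)"
      by (cases "i \<in> listset (fused_idx N s d)") (simp_all add: assms(19) lookup_pr mer meromorphic_Cn_zero)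
  qed
  then have f: "is_fusion \<eta> N s d f' f"
    unfolding is_fusion_def using identity by (simp add: assms(19) pr_in_tensor_space)
  have unique: "G = f" if G: "is_fusion \<eta> N s d f' G" for G
    by (rule is_fusion_unique[OF assms(1) m G[unfolded s] f[unfolded s]])
  have ex1: "\<exists>!G. is_fusion \<eta> N s d f' G" using f unique by (rule ex1I)
  have "f = Fus \<eta> N s d f'" unfolding Fus_def by (intro the_equality[symmetric] f unique)
  then show ?thesis using ex1 identity by blast
qed

end
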